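(* Let $U_\omega$, $\omega\in\Omega$, be a random unitary operator on $\ell^2(\mathbb Z)$ with a band structure whose generalized eigenvalue equation $U_\omega\psi=e^{i\lambda}\psi$ is governed by an ergodic family of $2\times2$ transfer matrices. Assume that, for each $\lambda$, the transfer matrices at spectral parameter $e^{i\lambda}$ induce two Lyapunov exponents $\gamma_1(\lambda)\ge\gamma_2(\lambda)=-\gamma_1(\lambda)$ which are constant almost surely. Then, almost surely, $$\sigma_{ac}(U_\omega)\subseteq\overline{\{e^{i\lambda}\in S^1:\ \gamma_1(\lambda)=0\}} .$$
   Context: A matrix $(M_{j,k})_{j,k\in\mathbb Z}$ has a band structure of order $2p+1$ ($p\in\mathbb N$) if $|j-k|>p$ implies $M_{j,k}=0$; an operator on $\ell^2(\mathbb Z)$ has a band structure if its matrix in the canonical basis $(\varphi_k)_{k\in\mathbb Z}$ does. Such a matrix acts on arbitrary sequences. Setting: $(\Omega,\mathcal F,\mathbb P)$ is a probability space with an invertible ergodic measure-preserving map $S$, and $\omega\mapsto U_\omega$ is (weakly) measurable. "Governed by an ergodic family of $2\times 2$ transfer matrices" means: for every real $\lambda$ there are matrices $T_\lambda(k,\omega)\in GL_2(\mathbb C)$, $k\in\mathbb Z$, jointly measurable in $(\lambda,\omega)$, with $|\det T_\lambda(k,\omega)|=1$, $T_\lambda(k+1,\omega)=T_\lambda(k,S\omega)$ and $\ln^+\|T_\lambda(1,\cdot)\|,\ \ln^+\|T_\lambda(1,\cdot)^{-1}\|\in L^1(\Omega,\mathbb P)$, such that an arbitrary sequence $\psi=\sum_k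 c_k\varphi_k$ solves $U_\omega\psi=e^{i\lambda}\psi$ if and only if $\binom{c_{2k}}{c_{2k+1}}=T_\lambda(k,\omega)\binom{c_{2k-2}}{c_{2k-1}}$ for all $k\in\mathbb Z$. The Lyapunov exponents $\gamma_1(\lambda)\ge\gamma_2(\lambda)$ are those given by the multiplicative ergodic theorem for the products $\Phi_\lambda(n,\omega)=T_\lambda(n,\omega)\cdots T_\lambda(1,\omega)$, i.e. $e^{\gamma_1(\lambda)}\ge e^{\gamma_2(\lambda)}$ are the eigenvalues of $\lim_{n\to\infty}(\Phi_\lambda(n,\omega)^*\Phi_\lambda(n,\omega))^{1/(2n)}$ almost surely. $\sigma_{ac}$ denotes the absolutely continuous spectrum. *)

theory Defs
  imports "HOL-Probability.Probability"
begin

section \<open>The Hilbert space of square-summable bilateral sequences\<close>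

definition ell2 :: "(int \<Rightarrow> complex) set" where
  "ell2 = {\<psi>. (\<lambda>k. (cmod (\<psi> k))\<^sup>2) summable_on UNIV}"

definition inner2 :: "(int \<Rightarrow> complex) \<Rightarrow> (int \<Rightarrow> complex) \<Rightarrow> complex" where
  "inner2 \<phi> \<psi> = (\<Sum>\<^sub>\<infinity>k. cnj (\<phi> k) * \<psi> k)"

definition norm2 :: "(int \<Rightarrow> complex) \<Rightarrow> real" where
  "norm2 \<psi> = sqrt (\<Sum>\<^sub>\<infinity>k. (cmod (\<psi> k))\<^sup>2)"

definition basis2 :: "int \<Rightarrow> int \<Rightarrow> complex" where
  "basis2 k = (\<lambda>j. if j = k then 1 else 0)"

text \<open>
  Operators are maps of sequences of which only the restriction to \<^const>\<open>ell2\<close> is meaningful.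
\<close>

definition unitary2 :: "((int \<Rightarrow> complex) \<Rightarrow> (int \<Rightarrow> complex)) \<Rightarrow> bool" where
  "unitary2 U \<longleftrightarrow>
     bij_betw U ell2 ell2 \<and>
     (\<forall>\<phi>\<in>ell2. \<forall>\<psi>\<in>ell2. U (\<lambda>k. \<phi> k + \<psi> k) = (\<lambda>k. U \<phi> k + U \<psi> k)) \<and>
     (\<forall>c. \<forall>\<psi>\<in>ell2. U (\<lambda>k. c * \<psi> k) = (\<lambda>k. c * U \<psi> k)) \<and>
     (\<forall>\<phi>\<in>ell2. \<forall>\<psi>\<in>ell2. inner2 (U \<phi>) (U \<psi>) = inner2 \<phi> \<psi>)"


section \<open>Band matrices\<close>

definition op_matrix :: "((int \<Rightarrow> complex) \<Rightarrow> (int \<Rightarrow> complex)) \<Rightarrow> int \<Rightarrow> int \<Rightarrow> complex" where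
  "op_matrix U j k = inner2 (basis2 j) (U (basis2 k))"

definition band_order :: "nat \<Rightarrow> (int \<Rightarrow> int \<Rightarrow> complex) \<Rightarrow> bool" where
  "band_order p A \<longleftrightarrow> (\<forall>j k. \<bar>j - k\<bar> > int p \<longrightarrow> A j k = 0)"

definition has_band_structure :: "((int \<Rightarrow> complex) \<Rightarrow> (int \<Rightarrow> complex)) \<Rightarrow> bool" where
  "has_band_structure U \<longleftrightarrow> (\<exists>p. band_order p (op_matrix U))"

text \<open>For a band matrix each row has finite support, so the sum below is a finite sum.\<close>

definition matrix_action :: "(int \<Rightarrow> int \<Rightarrow> complex) \<Rightarrow> (int \<Rightarrow> complex) \<Rightarrow> (int \<Rightarrow> complex)" where
  "matrix_action A \<psi> = (\<lambda>j. \<Sum>k | A j k \<noteq> 0. A j k * \<psi> k)"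

text \<open>The equation \<open>U \<psi> = e\<^sup>i\<^sup>\<theta> \<psi>\<close> for an arbitrary, not necessarily square-summable, sequence.\<close>

definition generalized_eigenvector ::
    "((int \<Rightarrow> complex) \<Rightarrow> (int \<Rightarrow> complex)) \<Rightarrow> real \<Rightarrow> (int \<Rightarrow> complex) \<Rightarrow> bool" where
  "generalized_eigenvector U \<theta> \<psi> \<longleftrightarrow> matrix_action (op_matrix U) \<psi> = (\<lambda>k. cis \<theta> * \<psi> k)"


section \<open>Absolutely continuous spectrum\<close>

text \<open>
  The spectral measure \<open>\<mu>\<close> of \<open>U\<close> at \<open>\<psi>\<close> is the unique finite Borel measure on the unit circle with
  \<open>\<langle>\<psi>, U\<^sup>n \<psi>\<rangle> = \<integral> z\<^sup>n d\<mu>(z)\<close> for all integers \<open>n\<close>. For a unitary \<open>U\<close> and a positive measure, the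
  moments of negative index are the complex conjugates of those of positive index.
\<close>

definition is_spectral_measure ::
    "((int \<Rightarrow> complex) \<Rightarrow> (int \<Rightarrow> complex)) \<Rightarrow> (int \<Rightarrow> complex) \<Rightarrow> complex measure \<Rightarrow> bool" where
  "is_spectral_measure U \<psi> \<mu> \<longleftrightarrow>
     sets \<mu> = sets borel \<and> finite_measure \<mu> \<and> emeasure \<mu> (- sphere 0 1) = 0 \<and>
     (\<forall>n::nat. inner2 \<psi> ((U ^^ n) \<psi>) = (\<integral>z. z ^ n \<partial>\<mu>))"

definition arc_length :: "complex measure" where
  "arc_length = distr (restrict_space lborel {0..<2 * pi}) borel cis"

definition ac_subspace ::
    "((int \<Rightarrow> complex) \<Rightarrow> (int \<Rightarrow> complex)) \<Rightarrow> (int \<Rightarrow> complex) set" where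
  "ac_subspace U =
     {\<psi> \<in> ell2. \<exists>\<mu>. is_spectral_measure U \<psi> \<mu> \<and> absolutely_continuous arc_length \<mu>}"

text \<open>
  The spectrum of the restriction of \<open>A\<close> to an invariant subspace \<open>V\<close>: the complement of those \<open>z\<close>
  for which \<open>A - z\<close> is a bijection of \<open>V\<close> with bounded inverse.
\<close>

definition spectrum_on ::
    "(int \<Rightarrow> complex) set \<Rightarrow> ((int \<Rightarrow> complex) \<Rightarrow> (int \<Rightarrow> complex)) \<Rightarrow> complex set" where
  "spectrum_on V A =
     {z. \<not> (bij_betw (\<lambda>\<psi> k. A \<psi> k - z * \<psi> k) V V \<and>
             (\<exists>C. \<forall>\<psi>\<in>V. norm2 \<psi> \<le> C * norm2 (\<lambda>k. A \<psi> k - z * \<psi> k)))}"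

definition ac_spectrum :: "((int \<Rightarrow> complex) \<Rightarrow> (int \<Rightarrow> complex)) \<Rightarrow> complex set" where
  "ac_spectrum U = spectrum_on (ac_subspace U) U"


section \<open>Ergodic families of transfer matrices\<close>

definition invertible_ergodic :: "'w measure \<Rightarrow> ('w \<Rightarrow> 'w) \<Rightarrow> bool" where
  "invertible_ergodic M S \<longleftrightarrow>
     bij_betw S (space M) (space M) \<and>
     S \<in> measurable M M \<and> inv_into (space M) S \<in> measurable M M \<and>
     distr M M S = M \<and>
     (\<forall>A\<in>sets M. S -` A \<inter> space M = A \<longrightarrow> measure M A = 0 \<or> measure M A = 1)"

definition weakly_measurable ::
    "'w measure \<Rightarrow> ('w \<Rightarrow> (int \<Rightarrow> complex) \<Rightarrow> (int \<Rightarrow> complex)) \<Rightarrow> bool" where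
  "weakly_measurable M U \<longleftrightarrow>
     (\<forall>\<phi>\<in>ell2. \<forall>\<psi>\<in>ell2. (\<lambda>\<omega>. inner2 \<phi> (U \<omega> \<psi>)) \<in> borel_measurable M)"

definition ln_plus :: "real \<Rightarrow> real" where
  "ln_plus x = max 0 (ln x)"

definition op_norm :: "complex^2^2 \<Rightarrow> real" where
  "op_norm A = onorm (\<lambda>v. A *v v)"

definition governed_by_transfer_matrices ::
    "'w measure \<Rightarrow> ('w \<Rightarrow> 'w) \<Rightarrow> ('w \<Rightarrow> (int \<Rightarrow> complex) \<Rightarrow> (int \<Rightarrow> complex))
       \<Rightarrow> (real \<Rightarrow> int \<Rightarrow> 'w \<Rightarrow> complex^2^2) \<Rightarrow> bool" where
  "governed_by_transfer_matrices M S U T \<longleftrightarrow>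
     (\<forall>k. (\<lambda>(\<theta>, \<omega>). T \<theta> k \<omega>) \<in> measurable (borel \<Otimes>\<^sub>M M) borel) \<and>
     (\<forall>\<theta> k. \<forall>\<omega>\<in>space M.
        invertible (T \<theta> k \<omega>) \<and> cmod (det (T \<theta> k \<omega>)) = 1 \<and>
        T \<theta> (k + 1) \<omega> = T \<theta> k (S \<omega>)) \<and>
     (\<forall>\<theta>. integrable M (\<lambda>\<omega>. ln_plus (op_norm (T \<theta> 1 \<omega>))) \<and>
          integrable M (\<lambda>\<omega>. ln_plus (op_norm (matrix_inv (T \<theta> 1 \<omega>))))) \<and>
     (\<forall>\<theta>. \<forall>\<omega>\<in>space M. \<forall>c. generalized_eigenvector (U \<omega>) \<theta> c \<longleftrightarrow>
        (\<forall>k. (vector [c (2 * k), c (2 * k + 1)] :: complex^2) =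
              T \<theta> k \<omega> *v vector [c (2 * k - 2), c (2 * k - 1)]))"


section \<open>Lyapunov exponents\<close>

text \<open>
  Products and powers of matrices are formed with \<open>**\<close>; the operations \<open>*\<close> and \<open>^\<close> of the type of
  vectors are componentwise.
\<close>

definition matrix_power :: "complex^2^2 \<Rightarrow> nat \<Rightarrow> complex^2^2" where
  "matrix_power A n = ((\<lambda>B. A ** B) ^^ n) (mat 1)"

definition conj_transpose :: "complex^2^2 \<Rightarrow> complex^2^2" where
  "conj_transpose A = (\<chi> i j. cnj (A $ j $ i))"

definition positive_semidefinite :: "complex^2^2 \<Rightarrow> bool" where
  "positive_semidefinite A \<longleftrightarrow>
     conj_transpose A = A \<and> (\<forall>v. 0 \<le> Re (\<Sum>i\<in>UNIV. cnj (v $ i) * (A *v v) $ i))"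

definition eigenvalues :: "complex^2^2 \<Rightarrow> complex set" where
  "eigenvalues A = {x. \<exists>v. v \<noteq> 0 \<and> A *v v = x *s v}"

primrec transfer_product :: "(int \<Rightarrow> complex^2^2) \<Rightarrow> nat \<Rightarrow> complex^2^2" where
  "transfer_product T 0 = mat 1"
| "transfer_product T (Suc n) = T (int (Suc n)) ** transfer_product T n"

text \<open>
  For \<open>n \<ge> 1\<close> the matrix \<open>R n\<close> is \<open>(\<Phi>(n)\<^sup>* \<Phi>(n))\<^sup>1\<^sup>/\<^sup>2\<^sup>n\<close>, the unique positive semidefinite root. A
  \<open>2 \<times> 2\<close> matrix has two eigenvalues counted with multiplicity, so for the Hermitian limit \<open>L\<close> the
  equality of sets below also covers the case \<open>\<gamma>\<^sub>1 = \<gamma>\<^sub>2\<close>.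
\<close>

definition lyapunov_exponents :: "(nat \<Rightarrow> complex^2^2) \<Rightarrow> real \<Rightarrow> real \<Rightarrow> bool" where
  "lyapunov_exponents \<Phi> \<gamma>\<^sub>1 \<gamma>\<^sub>2 \<longleftrightarrow> \<gamma>\<^sub>2 \<le> \<gamma>\<^sub>1 \<and>
     (\<exists>R L. (\<forall>n\<ge>1. positive_semidefinite (R n) \<and>
                    matrix_power (R n) (2 * n) = conj_transpose (\<Phi> n) ** \<Phi> n) \<and>
            R \<longlonglongrightarrow> L \<and>
            eigenvalues L = {complex_of_real (exp \<gamma>\<^sub>1), complex_of_real (exp \<gamma>\<^sub>2)})"

end

theory Submission
  imports Defs "HOL-Real_Asymp.Real_Asymp"
begin

text \<open>
  Let \<open>\<psi>\<close> have an absolutely continuous spectral measure \<open>\<mu>\<close>. Projecting the basis vectors onto the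
  cyclic subspace of \<open>\<psi>\<close>, which is the closure of the Laurent polynomials in \<open>L\<^sup>2(\<mu>)\<close>, yields functions
  \<open>g\<^sub>k\<close> such that \<open>k \<mapsto> cnj (g\<^sub>k w)\<close> is, for \<open>\<mu>\<close>-almost every \<open>w\<close>, a nonzero linearly bounded generalized
  eigenvector. On the other hand, put \<open>X = T(0) \<cdots> T(1-n)\<close> and \<open>Y = T(n) \<cdots> T(1)\<close>. Since the determinants
  have modulus one, such an eigenvector forces \<open>\<parallel>Y X\<parallel> \<le> C (1 + n) (\<parallel>X\<parallel> + \<parallel>Y\<parallel>)\<close> for all \<open>n\<close>. By stationarity
  the three norms grow in probability like \<open>exp (2 n \<gamma>\<^sub>1)\<close>, \<open>exp (n \<gamma>\<^sub>1)\<close> and \<open>exp (n \<gamma>\<^sub>1)\<close>, so this has probability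
  zero when \<open>\<gamma>\<^sub>1 > 0\<close>. By Fubini, almost surely \<open>\<mu>\<close> gives no mass to the complement of the closure of
  \<open>{\<gamma>\<^sub>1 = 0}\<close>, and \<open>(U - z)\<^sup>-\<^sup>1\<close> is constructed on the absolutely continuous subspace for \<open>z\<close> in that complement
  by approximating \<open>1 / (w - z)\<close> by Laurent polynomials. Neither the spectral theorem nor the Oseledets
  decomposition is needed.
\<close>

section \<open>Square-summable sequences\<close>

text \<open>Linear growth of the eigenvectors comes from Bessel's inequality: each
  \<open>g\<^sub>k\<close> has norm at most 1 in L2(\<mu>), so the weights (1 + |k|)^-2 make the sum
  of all |\<open>g\<^sub>k\<close>|^2 integrable. A polynomial rate is harmless, because it is
  compared with exponentials. Two kinds of null sets have to be matched. The Lyapunov hypothesis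
  discards a null set of \<omega> for each fixed angle, whereas a spectral measure calls, for fixed
  \<omega>, for a Lebesgue null set of angles, which absolute continuity then makes negligible.
  Existence of an eigenvector quantifies over uncountably many sequences, so Fubini is applied to
  the norm inequality instead, which involves countably many measurable functions. The products X
  end at site 0 but start ever further to the left, so the hypothesis on forward products gives no
  almost sure growth for them. Their law at each n agrees with that of the forward product, and this
  suffices because the inequality with a fixed constant is a single event. The closure enters
  through its open complement: a whole ball around z carries no mass, and its radius bounds the
  inverse of U - z.\<close>

lemma ell2_summable: "\<psi> \<in> ell2 \<Longrightarrow> (\<lambda>k. (cmod (\<psi> k))\<^sup>2) summable_on UNIV"
  by (simp add: ell2_def)

lemma ell2_scale: "\<psi> \<in> ell2 \<Longrightarrow> (\<lambda>k. c * \<psi> k) \<in> ell2"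
  by (simp add: ell2_def norm_mult power_mult_distrib summable_on_cmult_right)

lemma cmod_add_sq_le: "(cmod (a + b))\<^sup>2 \<le> 2 * (cmod a)\<^sup>2 + 2 * (cmod b)\<^sup>2"
proof -
  have "(cmod (a + b))\<^sup>2 \<le> (cmod a + cmod b)\<^sup>2"
    by (intro power_mono norm_triangle_ineq) auto
  also have "\<dots> \<le> 2 * (cmod a)\<^sup>2 + 2 * (cmod b)\<^sup>2"
    using zero_le_power2[of "cmod a - cmod b"] by (simp add: power2_eq_square algebra_simps)
  finally show ?thesis .
qed

lemma ell2_add:
  assumes "\<phi> \<in> ell2" "\<psi> \<in> ell2"
  shows "(\<lambda>k. \<phi> k + \<psi> k) \<in> ell2"
proof -
  have "(\<lambda>k. 2 * (cmod (\<phi> k))\<^sup>2 + 2 * (cmod (\<psi> k))\<^sup>2) summable_on UNIV"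
    using assms by (intro summable_on_add summable_on_cmult_right) (simp_all add: ell2_def)
  then have "(\<lambda>k. (cmod (\<phi> k + \<psi> k))\<^sup>2) summable_on UNIV"
    by (rule summable_on_comparison_test) (use cmod_add_sq_le in auto)
  then show ?thesis by (simp add: ell2_def)
qed

lemma ell2_diff:
  assumes "\<phi> \<in> ell2" "\<psi> \<in> ell2"
  shows "(\<lambda>k. \<phi> k - \<psi> k) \<in> ell2"
  using ell2_add[OF assms(1) ell2_scale[OF assms(2), of "-1"]] by simp

lemma ell2_zero [simp]: "(\<lambda>k. 0) \<in> ell2"
  by (simp add: ell2_def)

lemma ell2_basis [simp]: "basis2 k \<in> ell2"
proof -
  have "(\<lambda>j. (cmod (basis2 k j))\<^sup>2) summable_on {k}" by simp
  then have "(\<lambda>j. (cmod (basis2 k j))\<^sup>2) summable_on UNIV"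
    by (rule summable_on_cong_neutral[THEN iffD1, rotated -1]) (auto simp: basis2_def)
  then show ?thesis by (simp add: ell2_def)
qed

text \<open>\<open>infsum\<close> is 0 on a family that is not summable, so identities for
  \<open>inner2\<close> are derived from \<open>has_sum\<close> statements. Absolute summability
  comes from |ab| \<le> |a|^2 + |b|^2.\<close>

lemma inner2_has_sum:
  assumes "\<phi> \<in> ell2" "\<psi> \<in> ell2"
  shows "((\<lambda>k. cnj (\<phi> k) * \<psi> k) has_sum inner2 \<phi> \<psi>) UNIV"
proof -
  have *: "cmod (cnj a * b) \<le> (cmod a)\<^sup>2 + (cmod b)\<^sup>2" for a b
  proof -
    have "2 * (cmod a * cmod b) \<le> (cmod a)\<^sup>2 + (cmod b)\<^sup>2"
      using zero_le_power2[of "cmod a - cmod b"] by (simp add: power2_eq_square algebra_simps)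
    moreover have "0 \<le> cmod a * cmod b" by simp
    ultimately have "cmod a * cmod b \<le> (cmod a)\<^sup>2 + (cmod b)\<^sup>2" by linarith
    then show ?thesis by (simp add: norm_mult)
  qed
  have "(\<lambda>k. (cmod (\<phi> k))\<^sup>2 + (cmod (\<psi> k))\<^sup>2) summable_on UNIV"
    using assms by (intro summable_on_add) (simp_all add: ell2_def)
  then have "(\<lambda>k. cmod (cnj (\<phi> k) * \<psi> k)) summable_on UNIV"
    by (rule summable_on_comparison_test) (use * in auto)
  then show ?thesis unfolding inner2_def
    by (rule has_sum_infsum[OF abs_summable_summable])
qed

lemma inner2_eqI:
  assumes "((\<lambda>k. cnj (\<phi> k) * \<psi> k) has_sum s) UNIV"
  shows "inner2 \<phi> \<psi> = s"
  unfolding inner2_def using assms by (rule infsumI)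

lemma inner2_cnj: "inner2 \<psi> \<phi> = cnj (inner2 \<phi> \<psi>)"
  unfolding inner2_def infsum_cnj[symmetric] by (simp add: mult.commute)

lemma inner2_add_right:
  "\<lbrakk>\<rho> \<in> ell2; \<phi> \<in> ell2; \<psi> \<in> ell2\<rbrakk> \<Longrightarrow>
     inner2 \<rho> (\<lambda>k. \<phi> k + \<psi> k) = inner2 \<rho> \<phi> + inner2 \<rho> \<psi>"
  by (rule inner2_eqI) (simp add: distrib_left has_sum_add inner2_has_sum)

lemma inner2_scale_right:
  "\<lbrakk>\<rho> \<in> ell2; \<phi> \<in> ell2\<rbrakk> \<Longrightarrow> inner2 \<rho> (\<lambda>k. c * \<phi> k) = c * inner2 \<rho> \<phi>"
  by (rule inner2_eqI) (simp add: mult.left_commute has_sum_cmult_right inner2_has_sum)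

lemma inner2_add_left:
  "\<lbrakk>\<rho> \<in> ell2; \<phi> \<in> ell2; \<psi> \<in> ell2\<rbrakk> \<Longrightarrow>
     inner2 (\<lambda>k. \<phi> k + \<psi> k) \<rho> = inner2 \<phi> \<rho> + inner2 \<psi> \<rho>"
  by (rule inner2_eqI) (simp add: distrib_right has_sum_add inner2_has_sum)

lemma inner2_scale_left:
  "\<lbrakk>\<rho> \<in> ell2; \<phi> \<in> ell2\<rbrakk> \<Longrightarrow> inner2 (\<lambda>k. c * \<phi> k) \<rho> = cnj c * inner2 \<phi> \<rho>"
  by (rule inner2_eqI) (simp add: mult.assoc has_sum_cmult_right inner2_has_sum)

lemma inner2_diff_right:
  "\<lbrakk>\<rho> \<in> ell2; \<phi> \<in> ell2; \<psi> \<in> ell2\<rbrakk> \<Longrightarrow>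
     inner2 \<rho> (\<lambda>k. \<phi> k - \<psi> k) = inner2 \<rho> \<phi> - inner2 \<rho> \<psi>"
  using inner2_add_right[of \<rho> \<phi> "\<lambda>k. -1 * \<psi> k"] inner2_scale_right[of \<rho> \<psi> "-1"] ell2_scale[of \<psi> "-1"]
  by simp

lemma inner2_diff_left:
  "\<lbrakk>\<rho> \<in> ell2; \<phi> \<in> ell2; \<psi> \<in> ell2\<rbrakk> \<Longrightarrow>
     inner2 (\<lambda>k. \<phi> k - \<psi> k) \<rho> = inner2 \<phi> \<rho> - inner2 \<psi> \<rho>"
  using inner2_add_left[of \<rho> \<phi> "\<lambda>k. -1 * \<psi> k"] inner2_scale_left[of \<rho> \<psi> "-1"] ell2_scale[of \<psi> "-1"]
  by simp

lemma inner2_basis: "inner2 (basis2 k) \<psi> = \<psi> k"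
proof (rule inner2_eqI)
  have "((\<lambda>j. cnj (basis2 k j) * \<psi> j) has_sum \<psi> k) {k}"
    by (rule has_sum_finiteI) (auto simp: basis2_def)
  then show "((\<lambda>j. cnj (basis2 k j) * \<psi> j) has_sum \<psi> k) UNIV"
    by (rule has_sum_cong_neutral[THEN iffD1, rotated -1]) (auto simp: basis2_def)
qed

section \<open>Norm, Cauchy-Schwarz inequality and completeness\<close>

lemma norm2_nonneg [simp]: "norm2 \<psi> \<ge> 0"
  by (simp add: norm2_def infsum_nonneg)

lemma norm2_power2: "(norm2 \<psi>)\<^sup>2 = (\<Sum>\<^sub>\<infinity>k. (cmod (\<psi> k))\<^sup>2)"
  by (simp add: norm2_def infsum_nonneg)

lemma norm2_has_sum: "\<psi> \<in> ell2 \<Longrightarrow> ((\<lambda>k. (cmod (\<psi> k))\<^sup>2) has_sum (norm2 \<psi>)\<^sup>2) UNIV"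
  by (simp add: norm2_power2 ell2_summable)

lemma inner2_self: "\<psi> \<in> ell2 \<Longrightarrow> inner2 \<psi> \<psi> = complex_of_real ((norm2 \<psi>)\<^sup>2)"
  using has_sum_of_real[OF norm2_has_sum, where 'a = complex]
  by (intro inner2_eqI) (simp add: complex_norm_square[symmetric] mult.commute[of "cnj _"])

lemma sum_le_norm2:
  "\<psi> \<in> ell2 \<Longrightarrow> finite F \<Longrightarrow> (\<Sum>k\<in>F. (cmod (\<psi> k))\<^sup>2) \<le> (norm2 \<psi>)\<^sup>2"
  by (rule finite_sum_le_has_sum[OF norm2_has_sum]) auto

lemma cmod_le_norm2: "\<psi> \<in> ell2 \<Longrightarrow> cmod (\<psi> k) \<le> norm2 \<psi>"
  by (rule power2_le_imp_le) (use sum_le_norm2[of \<psi> "{k}"] in auto)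

lemma norm2_eq_0D: "\<psi> \<in> ell2 \<Longrightarrow> norm2 \<psi> = 0 \<Longrightarrow> \<psi> = (\<lambda>k. 0)"
  using cmod_le_norm2[of \<psi>] by auto

lemma norm2_zero [simp]: "norm2 (\<lambda>k. 0) = 0"
  by (simp add: norm2_def)

lemma norm2_scale: "norm2 (\<lambda>k. c * \<psi> k) = cmod c * norm2 \<psi>"
  by (simp add: norm2_def norm_mult power_mult_distrib infsum_cmult_right' real_sqrt_mult)

lemma norm2_add_power2:
  assumes "\<phi> \<in> ell2" "\<psi> \<in> ell2"
  shows "(norm2 (\<lambda>k. \<phi> k + \<psi> k))\<^sup>2 = (norm2 \<phi>)\<^sup>2 + (norm2 \<psi>)\<^sup>2 + 2 * Re (inner2 \<phi> \<psi>)"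
proof -
  have "complex_of_real ((norm2 (\<lambda>k. \<phi> k + \<psi> k))\<^sup>2) =
    inner2 \<phi> \<phi> + inner2 \<psi> \<psi> + (inner2 \<phi> \<psi> + inner2 \<psi> \<phi>)"
    using assms
    by (simp add: inner2_self[symmetric] ell2_add inner2_add_left inner2_add_right del: of_real_power)
  also have "inner2 \<phi> \<psi> + inner2 \<psi> \<phi> = complex_of_real (2 * Re (inner2 \<phi> \<psi>))"
    by (subst (2) inner2_cnj) (rule complex_add_cnj)
  finally show ?thesis using assms
    by (simp only: inner2_self of_real_add[symmetric] of_real_eq_iff)
qed

lemma norm2_diff_power2:
  assumes "\<phi> \<in> ell2" "\<psi> \<in> ell2"
  shows "(norm2 (\<lambda>k. \<phi> k - \<psi> k))\<^sup>2 = (norm2 \<phi>)\<^sup>2 + (norm2 \<psi>)\<^sup>2 - 2 * Re (inner2 \<phi> \<psi>)"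
  using norm2_add_power2[OF assms(1) ell2_scale[OF assms(2), of "-1"]] assms
    norm2_scale[of "-1" \<psi>] inner2_scale_right[OF assms, of "-1"]
  by simp

lemma inner2_Cauchy_Schwarz:
  assumes "\<phi> \<in> ell2" "\<psi> \<in> ell2"
  shows "cmod (inner2 \<phi> \<psi>) \<le> norm2 \<phi> * norm2 \<psi>"
proof (cases "norm2 \<phi> = 0")
  case True
  then have "\<phi> = (\<lambda>k. 0)" using assms norm2_eq_0D by blast
  then show ?thesis by (simp add: inner2_def)
next
  case False
  \<comment> \<open>\<open>?N \<psi> - ?a \<phi>\<close> is \<open>?N\<close> times the component of
    \<open>\<psi>\<close> orthogonal to \<open>\<phi>\<close>. Expanding its squared norm gives the
    inequality after cancelling \<open>?N\<close>.\<close>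
  let ?N = "(norm2 \<phi>)\<^sup>2" and ?a = "inner2 \<phi> \<psi>"
  have N: "?N > 0" using False by simp
  have "inner2 (\<lambda>k. of_real ?N * \<psi> k) (\<lambda>k. ?a * \<phi> k) = of_real ?N * (?a * cnj ?a)"
    using assms
    by (simp add: inner2_scale_left inner2_scale_right ell2_scale inner2_cnj[of \<psi> \<phi>])
  also have "\<dots> = of_real (?N * (cmod ?a)\<^sup>2)"
    by (simp add: complex_norm_square[symmetric] del: of_real_power)
  finally have *: "Re (inner2 (\<lambda>k. of_real ?N * \<psi> k) (\<lambda>k. ?a * \<phi> k)) = ?N * (cmod ?a)\<^sup>2"
    by (simp only: Re_complex_of_real)
  have "norm2 (\<lambda>k. of_real ?N * \<psi> k) = ?N * norm2 \<psi>"
    unfolding norm2_scale norm_of_real by simp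
  with * have "(norm2 (\<lambda>k. of_real ?N * \<psi> k - ?a * \<phi> k))\<^sup>2 =
     (?N * norm2 \<psi>)\<^sup>2 + (cmod ?a * norm2 \<phi>)\<^sup>2 - 2 * (?N * (cmod ?a)\<^sup>2)"
    using norm2_diff_power2[OF ell2_scale[OF assms(2), of "of_real ?N"] ell2_scale[OF assms(1), of ?a]]
    by (simp only: norm2_scale[of ?a])
  then have "0 \<le> (?N * norm2 \<psi>)\<^sup>2 + (cmod ?a * norm2 \<phi>)\<^sup>2 - 2 * (?N * (cmod ?a)\<^sup>2)"
    by (metis zero_le_power2)
  also have "\<dots> = ?N * ((norm2 \<phi> * norm2 \<psi>)\<^sup>2 - (cmod ?a)\<^sup>2)"
    by (simp add: power2_eq_square algebra_simps)
  finally have "(cmod ?a)\<^sup>2 \<le> (norm2 \<phi> * norm2 \<psi>)\<^sup>2"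
    using N by (simp add: zero_le_mult_iff)
  then show ?thesis by (rule power2_le_imp_le) simp
qed

lemma norm2_triangle:
  assumes "\<phi> \<in> ell2" "\<psi> \<in> ell2"
  shows "norm2 (\<lambda>k. \<phi> k + \<psi> k) \<le> norm2 \<phi> + norm2 \<psi>"
proof (rule power2_le_imp_le)
  show "(norm2 (\<lambda>k. \<phi> k + \<psi> k))\<^sup>2 \<le> (norm2 \<phi> + norm2 \<psi>)\<^sup>2"
    using norm2_add_power2[OF assms] inner2_Cauchy_Schwarz[OF assms]
      complex_Re_le_cmod[of "inner2 \<phi> \<psi>"]
    by (simp add: power2_sum)
qed simp

text \<open>Coordinates converge, and on each finite set of coordinates the Cauchy bound passes to
  the limit with a constant independent of the set. The resolvent of \<open>U\<close> is later
  obtained as such a limit.\<close>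

lemma ell2_complete:
  assumes mem: "\<And>m. \<eta> m \<in> ell2"
    and cauchy: "\<And>e. e > 0 \<Longrightarrow> \<exists>N. \<forall>m\<ge>N. \<forall>n\<ge>N. norm2 (\<lambda>k. \<eta> m k - \<eta> n k) \<le> e"
  shows "\<exists>\<zeta>\<in>ell2. (\<lambda>m. norm2 (\<lambda>k. \<zeta> k - \<eta> m k)) \<longlonglongrightarrow> 0"
proof -
  have "Cauchy (\<lambda>m. \<eta> m k)" for k
  proof (rule metric_CauchyI)
    fix e :: real assume "e > 0"
    then obtain N where "\<forall>m\<ge>N. \<forall>n\<ge>N. norm2 (\<lambda>k. \<eta> m k - \<eta> n k) \<le> e / 2"
      using cauchy[of "e / 2"] by auto
    moreover have "dist (\<eta> m k) (\<eta> n k) \<le> norm2 (\<lambda>k. \<eta> m k - \<eta> n k)" for m n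
      using cmod_le_norm2[OF ell2_diff[OF mem mem], where k = k] by (simp add: dist_norm)
    ultimately have "dist (\<eta> m k) (\<eta> n k) \<le> e / 2" if "m \<ge> N" "n \<ge> N" for m n
      using that by (meson order_trans)
    moreover have "e / 2 < e" using \<open>e > 0\<close> by simp
    ultimately show "\<exists>N. \<forall>m\<ge>N. \<forall>n\<ge>N. dist (\<eta> m k) (\<eta> n k) < e"
      by (meson le_less_trans)
  qed
  then have "\<forall>k. \<exists>l. (\<lambda>m. \<eta> m k) \<longlonglongrightarrow> l"
    using Cauchy_convergent_iff convergent_def by blast
  then obtain \<zeta> where lim: "\<And>k. (\<lambda>m. \<eta> m k) \<longlonglongrightarrow> \<zeta> k" by metis
  have fin: "(\<Sum>k\<in>F. (cmod (\<zeta> k - \<eta> m k))\<^sup>2) \<le> e\<^sup>2"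
    if "finite F" "e > 0" "\<forall>n\<ge>N. norm2 (\<lambda>k. \<eta> n k - \<eta> m k) \<le> e" for F e m N
  proof (rule Lim_bounded[where M = N])
    show "(\<lambda>n. \<Sum>k\<in>F. (cmod (\<eta> n k - \<eta> m k))\<^sup>2) \<longlonglongrightarrow> (\<Sum>k\<in>F. (cmod (\<zeta> k - \<eta> m k))\<^sup>2)"
      by (intro tendsto_intros lim)
    show "\<forall>n\<ge>N. (\<Sum>k\<in>F. (cmod (\<eta> n k - \<eta> m k))\<^sup>2) \<le> e\<^sup>2"
    proof (intro allI impI)
      fix n assume "n \<ge> N"
      have "(\<Sum>k\<in>F. (cmod (\<eta> n k - \<eta> m k))\<^sup>2) \<le> (norm2 (\<lambda>k. \<eta> n k - \<eta> m k))\<^sup>2"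
        using sum_le_norm2[OF ell2_diff[OF mem mem] \<open>finite F\<close>] .
      also have "\<dots> \<le> e\<^sup>2" using that \<open>n \<ge> N\<close> by (intro power_mono) auto
      finally show "(\<Sum>k\<in>F. (cmod (\<eta> n k - \<eta> m k))\<^sup>2) \<le> e\<^sup>2" .
    qed
  qed
  have bound: "(\<lambda>k. \<zeta> k - \<eta> m k) \<in> ell2 \<and> norm2 (\<lambda>k. \<zeta> k - \<eta> m k) \<le> e"
    if "e > 0" "\<forall>n\<ge>N. norm2 (\<lambda>k. \<eta> n k - \<eta> m k) \<le> e" for e m N
  proof -
    have "(\<lambda>k. (cmod (\<zeta> k - \<eta> m k))\<^sup>2) summable_on UNIV"
    proof (rule nonneg_bdd_above_summable_on)
      show "bdd_above (sum (\<lambda>k. (cmod (\<zeta> k - \<eta> m k))\<^sup>2) ` {F. F \<subseteq> UNIV \<and> finite F})"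
        by (rule bdd_aboveI2[where M = "e\<^sup>2"]) (use fin[OF _ that] in simp)
    qed simp
    then have mem': "(\<lambda>k. \<zeta> k - \<eta> m k) \<in> ell2" by (simp add: ell2_def)
    have "(norm2 (\<lambda>k. \<zeta> k - \<eta> m k))\<^sup>2 \<le> e\<^sup>2"
      by (rule has_sum_le_finite_sums[OF norm2_has_sum[OF mem']]) (rule fin[OF _ that])
    then have "norm2 (\<lambda>k. \<zeta> k - \<eta> m k) \<le> e" by (rule power2_le_imp_le) (use \<open>e > 0\<close> in simp)
    then show ?thesis using mem' by simp
  qed
  obtain N where "\<forall>m\<ge>N. \<forall>n\<ge>N. norm2 (\<lambda>k. \<eta> m k - \<eta> n k) \<le> 1" using cauchy[of 1] by auto
  then have "(\<lambda>k. \<zeta> k - \<eta> N k) \<in> ell2" using bound[of 1 N N] by auto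
  from ell2_add[OF this mem[of N]] have "\<zeta> \<in> ell2" by simp
  moreover have "(\<lambda>m. norm2 (\<lambda>k. \<zeta> k - \<eta> m k)) \<longlonglongrightarrow> 0"
  proof (rule LIMSEQ_I)
    fix e :: real assume "e > 0"
    then obtain N where "\<forall>m\<ge>N. \<forall>n\<ge>N. norm2 (\<lambda>k. \<eta> m k - \<eta> n k) \<le> e / 2"
      using cauchy[of "e / 2"] by auto
    then have "norm2 (\<lambda>k. \<zeta> k - \<eta> m k) \<le> e / 2" if "m \<ge> N" for m
      using bound[of "e / 2" N m] \<open>e > 0\<close> that by simp
    moreover have "e / 2 < e" using \<open>e > 0\<close> by simp
    ultimately have "norm2 (\<lambda>k. \<zeta> k - \<eta> m k) < e" if "m \<ge> N" for m
      using that by (meson le_less_trans)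
    then show "\<exists>N. \<forall>m\<ge>N. norm (norm2 (\<lambda>k. \<zeta> k - \<eta> m k) - 0) < e"
      by auto
  qed
  ultimately show ?thesis by blast
qed

lemma inner2_tendsto:
  assumes mem: "\<And>m. \<eta> m \<in> ell2" "\<And>m. \<xi> m \<in> ell2" "\<phi> \<in> ell2" "\<psi> \<in> ell2"
    and lim: "(\<lambda>m. norm2 (\<lambda>k. \<phi> k - \<eta> m k)) \<longlonglongrightarrow> 0" "(\<lambda>m. norm2 (\<lambda>k. \<psi> k - \<xi> m k)) \<longlonglongrightarrow> 0"
  shows "(\<lambda>m. inner2 (\<eta> m) (\<xi> m)) \<longlonglongrightarrow> inner2 \<phi> \<psi>"
proof -
  define a where "a m = norm2 (\<lambda>k. \<phi> k - \<eta> m k)" for m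
  define b where "b m = norm2 (\<lambda>k. \<psi> k - \<xi> m k)" for m
  have bound: "cmod (inner2 (\<eta> m) (\<xi> m) - inner2 \<phi> \<psi>) \<le> a m * norm2 \<psi> + (norm2 \<phi> * b m + a m * b m)" for m
  proof -
    define x where "x = inner2 (\<lambda>k. \<phi> k - \<eta> m k) \<psi>"
    define y where "y = inner2 \<phi> (\<lambda>k. \<psi> k - \<xi> m k)"
    define z where "z = inner2 (\<lambda>k. \<phi> k - \<eta> m k) (\<lambda>k. \<psi> k - \<xi> m k)"
    have "inner2 (\<eta> m) (\<xi> m) - inner2 \<phi> \<psi> = - (x + (y - z))"
      unfolding x_def y_def z_def using mem by (simp add: inner2_diff_left inner2_diff_right ell2_diff)
    then have "cmod (inner2 (\<eta> m) (\<xi> m) - inner2 \<phi> \<psi>) \<le> cmod x + (cmod y + cmod z)"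
      using norm_triangle_ineq[of x "y - z"] norm_triangle_ineq4[of y z]
      by (simp only: norm_minus_cancel)
    moreover have "cmod x \<le> a m * norm2 \<psi>" "cmod y \<le> norm2 \<phi> * b m" "cmod z \<le> a m * b m"
      unfolding x_def y_def z_def a_def b_def using mem by (simp_all add: inner2_Cauchy_Schwarz ell2_diff)
    ultimately show ?thesis by linarith
  qed
  have "a \<longlonglongrightarrow> 0" "b \<longlonglongrightarrow> 0" using lim by (simp_all add: a_def[abs_def] b_def[abs_def])
  then have "(\<lambda>m. a m * norm2 \<psi> + (norm2 \<phi> * b m + a m * b m)) \<longlonglongrightarrow>
      0 * norm2 \<psi> + (norm2 \<phi> * 0 + 0 * 0)"
    by (intro tendsto_add tendsto_mult tendsto_const)
  then have "(\<lambda>m. a m * norm2 \<psi> + (norm2 \<phi> * b m + a m * b m)) \<longlonglongrightarrow> 0" by simp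
  with always_eventually[OF allI, OF bound]
  have "(\<lambda>m. inner2 (\<eta> m) (\<xi> m) - inner2 \<phi> \<psi>) \<longlonglongrightarrow> 0"
    by (rule Lim_null_comparison)
  then show ?thesis by (rule LIM_zero_cancel)
qed

section \<open>Square-integrable functions\<close>

text \<open>Functions rather than classes modulo null sets: the generalized eigenvectors are
  assembled from pointwise values of countably many such functions.\<close>

definition L2 :: "'a measure \<Rightarrow> ('a \<Rightarrow> complex) \<Rightarrow> bool" where
  "L2 M f \<longleftrightarrow> f \<in> borel_measurable M \<and> integrable M (\<lambda>x. (cmod (f x))\<^sup>2)"

lemma L2_measurable [measurable_dest]: "L2 M f \<Longrightarrow> f \<in> borel_measurable M"
  by (simp add: L2_def)

lemma L2_integrable: "L2 M f \<Longrightarrow> integrable M (\<lambda>x. (cmod (f x))\<^sup>2)"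
  by (simp add: L2_def)

lemma L2_add:
  assumes "L2 M f" "L2 M g"
  shows "L2 M (\<lambda>x. f x + g x)"
  unfolding L2_def
proof
  note [measurable] = assms[THEN L2_measurable]
  show "(\<lambda>x. f x + g x) \<in> borel_measurable M" by measurable
  have "integrable M (\<lambda>x. 2 * (cmod (f x))\<^sup>2 + 2 * (cmod (g x))\<^sup>2)"
    using assms by (simp add: L2_integrable)
  then show "integrable M (\<lambda>x. (cmod (f x + g x))\<^sup>2)"
    by (rule Bochner_Integration.integrable_bound) (simp, simp add: cmod_add_sq_le)
qed

lemma L2_mult_bounded:
  assumes "L2 M f" and [measurable]: "h \<in> borel_measurable M" and h: "AE x in M. cmod (h x) \<le> B"
  shows "L2 M (\<lambda>x. h x * f x)"
  unfolding L2_def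
proof
  note [measurable] = assms(1)[THEN L2_measurable]
  show "(\<lambda>x. h x * f x) \<in> borel_measurable M" by measurable
  have "integrable M (\<lambda>x. B\<^sup>2 * (cmod (f x))\<^sup>2)"
    using assms by (simp add: L2_integrable)
  then show "integrable M (\<lambda>x. (cmod (h x * f x))\<^sup>2)"
  proof (rule Bochner_Integration.integrable_bound)
    show "AE x in M. norm ((cmod (h x * f x))\<^sup>2) \<le> norm (B\<^sup>2 * (cmod (f x))\<^sup>2)"
      using h
    proof eventually_elim
      case (elim x)
      then show ?case
        by (simp add: norm_mult power_mult_distrib mult_right_mono power_mono)
    qed
  qed simp
qed

lemma L2_scale: "L2 M f \<Longrightarrow> L2 M (\<lambda>x. c * f x)"
  by (rule L2_mult_bounded[where B = "cmod c"]) auto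

lemma L2_diff:
  assumes "L2 M f" "L2 M g"
  shows "L2 M (\<lambda>x. f x - g x)"
  using L2_add[OF assms(1) L2_scale[OF assms(2), of "-1"]] by simp

lemma L2_inner_integrable:
  assumes "L2 M f" "L2 M g"
  shows "integrable M (\<lambda>x. cnj (f x) * g x)"
proof (rule Bochner_Integration.integrable_bound)
  note [measurable] = assms[THEN L2_measurable]
  show "integrable M (\<lambda>x. (cmod (f x))\<^sup>2 + (cmod (g x))\<^sup>2)"
    using assms by (simp add: L2_integrable)
  show "(\<lambda>x. cnj (f x) * g x) \<in> borel_measurable M"
    using borel_measurable_continuous_on[of cnj f M] by (simp add: continuous_intros)
  show "AE x in M. cmod (cnj (f x) * g x) \<le> norm ((cmod (f x))\<^sup>2 + (cmod (g x))\<^sup>2)"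
  proof (rule AE_I2)
    fix x
    have "2 * (cmod (f x) * cmod (g x)) \<le> (cmod (f x))\<^sup>2 + (cmod (g x))\<^sup>2"
      using zero_le_power2[of "cmod (f x) - cmod (g x)"] by (simp add: power2_eq_square algebra_simps)
    moreover have "0 \<le> cmod (f x) * cmod (g x)" by simp
    ultimately have "cmod (f x) * cmod (g x) \<le> (cmod (f x))\<^sup>2 + (cmod (g x))\<^sup>2" by linarith
    then show "cmod (cnj (f x) * g x) \<le> norm ((cmod (f x))\<^sup>2 + (cmod (g x))\<^sup>2)"
      by (simp add: norm_mult)
  qed
qed

lemma cmod_diff_power2: "(cmod (a - b))\<^sup>2 = (cmod a)\<^sup>2 + (cmod b)\<^sup>2 - 2 * Re (cnj a * b)"
  by (simp add: cmod_power2 power2_diff)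

lemma L2_diff_power2:
  assumes "L2 M f" "L2 M g"
  shows "(\<integral>x. (cmod (f x - g x))\<^sup>2 \<partial>M) =
    (\<integral>x. (cmod (f x))\<^sup>2 \<partial>M) + (\<integral>x. (cmod (g x))\<^sup>2 \<partial>M) - 2 * Re (\<integral>x. cnj (f x) * g x \<partial>M)"
proof -
  have "integrable M (\<lambda>x. Re (cnj (f x) * g x))"
    "Re (\<integral>x. cnj (f x) * g x \<partial>M) = (\<integral>x. Re (cnj (f x) * g x) \<partial>M)"
    using L2_inner_integrable[OF assms] by (simp_all only: integrable_Re integral_Re)
  then show ?thesis
    using assms[THEN L2_integrable] unfolding cmod_diff_power2
    by (simp del: complex_cnj_cnj times_complex.sel)
qed

lemma L2_add_power2_le:
  assumes "L2 M f" "L2 M g"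
  shows "(\<integral>x. (cmod (f x + g x))\<^sup>2 \<partial>M) \<le> 2 * (\<integral>x. (cmod (f x))\<^sup>2 \<partial>M) + 2 * (\<integral>x. (cmod (g x))\<^sup>2 \<partial>M)"
proof -
  have "(\<integral>x. (cmod (f x + g x))\<^sup>2 \<partial>M) \<le> (\<integral>x. 2 * (cmod (f x))\<^sup>2 + 2 * (cmod (g x))\<^sup>2 \<partial>M)"
    using assms by (intro integral_mono) (simp_all add: L2_integrable L2_add cmod_add_sq_le)
  then show ?thesis using assms[THEN L2_integrable] by simp
qed

text \<open>The inequality \<open>2 d \<le> 2\<^sup>-\<^sup>m + 2\<^sup>m d\<^sup>2\<close> turns the \<open>L\<^sup>2\<close> bounds into a summable majorant of the increments.\<close>

lemma L2_fast_Cauchy: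
  assumes "finite_measure M" and L2: "\<And>m. L2 M (f m)" and "c \<ge> 0"
    and cauchy: "\<And>m n. m \<le> n \<Longrightarrow> (\<integral>x. (cmod (f n x - f m x))\<^sup>2 \<partial>M) \<le> c * (1/4) ^ m"
  shows "\<exists>g. L2 M g \<and> (\<forall>m. (\<integral>x. (cmod (g x - f m x))\<^sup>2 \<partial>M) \<le> c * (1/4) ^ m)"
proof -
  interpret finite_measure M by fact
  note [measurable] = L2[THEN L2_measurable]
  define d where "d m x = cmod (f (Suc m) x - f m x)" for m x
  have [measurable]: "d m \<in> borel_measurable M" for m
    unfolding d_def by measurable
  have intd2: "integrable M (\<lambda>x. (d m x)\<^sup>2)" for m
    unfolding d_def by (intro L2_integrable L2_diff L2)
  have dle: "d m x \<le> (1/2) ^ m + 2 ^ m * (d m x)\<^sup>2" for m x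
  proof -
    have "0 \<le> (1/2) ^ m * (1 - 2 ^ m * d m x)\<^sup>2" by simp
    also have "\<dots> = (1/2) ^ m + 2 ^ m * (d m x)\<^sup>2 - 2 * d m x"
      by (simp add: power2_diff power_mult_distrib algebra_simps power_one_over power2_eq_square)
    finally show ?thesis using norm_ge_zero[of "f (Suc m) x - f m x"] unfolding d_def by linarith
  qed
  have nn: "(\<integral>\<^sup>+x. ennreal (d m x) \<partial>M) \<le> ennreal ((measure M (space M) + c) * (1/2) ^ m)" for m
  proof -
    have "(\<integral>\<^sup>+x. ennreal (d m x) \<partial>M) \<le> (\<integral>\<^sup>+x. ennreal ((1/2) ^ m + 2 ^ m * (d m x)\<^sup>2) \<partial>M)"
      by (intro nn_integral_mono ennreal_leI dle)
    also have "\<dots> = ennreal (\<integral>x. (1/2) ^ m + 2 ^ m * (d m x)\<^sup>2 \<partial>M)"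
      by (intro nn_integral_eq_integral) (auto simp: intd2)
    also have "(\<integral>x. (1/2) ^ m + 2 ^ m * (d m x)\<^sup>2 \<partial>M) =
        measure M (space M) * (1/2) ^ m + 2 ^ m * (\<integral>x. (d m x)\<^sup>2 \<partial>M)"
      using intd2 by simp
    also have "\<dots> \<le> measure M (space M) * (1/2) ^ m + 2 ^ m * (c * (1/4) ^ m)"
      using cauchy[of m "Suc m"] by (intro add_left_mono mult_left_mono) (auto simp: d_def)
    also have "\<dots> = (measure M (space M) + c) * (1/2) ^ m"
    proof -
      have "2 ^ m * (1/4) ^ m = (1/2 :: real) ^ m" by (simp flip: power_mult_distrib)
      then show ?thesis by (simp only: mult.left_commute[of _ c] distrib_right)
    qed
    finally show ?thesis by (simp add: ennreal_leI)
  qed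
  have "(\<integral>\<^sup>+x. (\<Sum>m. ennreal (d m x)) \<partial>M) = (\<Sum>m. \<integral>\<^sup>+x. ennreal (d m x) \<partial>M)"
    by (rule nn_integral_suminf) simp
  also have "\<dots> \<le> (\<Sum>m. ennreal ((measure M (space M) + c) * (1/2) ^ m))"
    by (intro suminf_le nn) auto
  also have "\<dots> = ennreal (\<Sum>m. (measure M (space M) + c) * (1/2) ^ m)"
    using \<open>c \<ge> 0\<close> by (intro suminf_ennreal2) (auto intro!: summable_mult summable_geometric)
  finally have "(\<integral>\<^sup>+x. (\<Sum>m. ennreal (d m x)) \<partial>M) \<noteq> \<infinity>"
    using ennreal_neq_top[of "\<Sum>m. (measure M (space M) + c) * (1/2) ^ m"]
    by (metis infinity_ennreal_def top.extremum_unique)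
  then have "AE x in M. (\<Sum>m. ennreal (d m x)) \<noteq> \<infinity>"
    by (intro nn_integral_PInf_AE) auto
  then have conv: "AE x in M. convergent (\<lambda>m. f m x)"
  proof eventually_elim
    case (elim x)
    then have "summable (\<lambda>m. d m x)"
      by (intro summable_suminf_not_top) (auto simp: d_def)
    then have "summable (\<lambda>m. f (Suc m) x - f m x)"
      unfolding d_def by (rule summable_norm_cancel)
    then have "convergent (\<lambda>n. \<Sum>m<n. f (Suc m) x - f m x)"
      by (simp add: summable_iff_convergent)
    then have "convergent (\<lambda>n. f n x - f 0 x)"
      by (simp only: sum_lessThan_telescope[of "\<lambda>m. f m x"])
    then show ?case by (simp add: convergent_diff_const_right_iff)
  qed
  \<comment> \<open>Where the sequence diverges \<open>lim\<close> returns an unspecified value;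
    \<open>conv\<close> says that this happens on a null set only.\<close>
  define g where "g x = lim (\<lambda>m. f m x)" for x
  have [measurable]: "g \<in> borel_measurable M"
    unfolding g_def[abs_def] by (rule borel_measurable_lim_metric) simp
  have nng: "(\<integral>\<^sup>+x. ennreal ((cmod (g x - f m x))\<^sup>2) \<partial>M) \<le> ennreal (c * (1/4) ^ m)" for m
  proof -
    \<comment> \<open>Fatou's lemma in n with m fixed turns the bounds on \<open>f n - f m\<close>
      into a bound on \<open>g - f m\<close>.\<close>
    have "AE x in M. ennreal ((cmod (g x - f m x))\<^sup>2) \<le> liminf (\<lambda>n. ennreal ((cmod (f n x - f m x))\<^sup>2))"
      using conv
    proof eventually_elim
      case (elim x)
      then have "(\<lambda>n. f n x) \<longlonglongrightarrow> g x" by (simp add: g_def convergent_LIMSEQ_iff)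
      then have "(\<lambda>n. ennreal ((cmod (f n x - f m x))\<^sup>2)) \<longlonglongrightarrow> ennreal ((cmod (g x - f m x))\<^sup>2)"
        by (intro tendsto_ennrealI tendsto_power tendsto_norm tendsto_diff tendsto_const)
      then show ?case using lim_imp_Liminf[OF sequentially_bot] by fastforce
    qed
    then have "(\<integral>\<^sup>+x. ennreal ((cmod (g x - f m x))\<^sup>2) \<partial>M) \<le>
        (\<integral>\<^sup>+x. liminf (\<lambda>n. ennreal ((cmod (f n x - f m x))\<^sup>2)) \<partial>M)"
      by (rule nn_integral_mono_AE)
    also have "\<dots> \<le> liminf (\<lambda>n. \<integral>\<^sup>+x. ennreal ((cmod (f n x - f m x))\<^sup>2) \<partial>M)"
      by (rule nn_integral_liminf) simp
    also have "\<dots> \<le> ennreal (c * (1/4) ^ m)"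
    proof (rule Liminf_le)
      show "\<forall>\<^sub>F n in sequentially. (\<integral>\<^sup>+x. ennreal ((cmod (f n x - f m x))\<^sup>2) \<partial>M) \<le> ennreal (c * (1/4) ^ m)"
        using eventually_ge_at_top[of m]
      proof eventually_elim
        case (elim n)
        have "(\<integral>\<^sup>+x. ennreal ((cmod (f n x - f m x))\<^sup>2) \<partial>M) = ennreal (\<integral>x. (cmod (f n x - f m x))\<^sup>2 \<partial>M)"
          by (intro nn_integral_eq_integral L2_integrable L2_diff L2) auto
        then show ?case using cauchy[OF elim] by (simp add: ennreal_leI)
      qed
    qed simp
    finally show ?thesis .
  qed
  have L2g: "L2 M (\<lambda>x. g x - f m x)" for m
    unfolding L2_def
  proof
    show "integrable M (\<lambda>x. (cmod (g x - f m x))\<^sup>2)"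
      using order_le_less_trans[OF nng[of m] ennreal_less_top]
      by (intro integrableI_bounded) auto
  qed simp
  have "L2 M g" using L2_add[OF L2g[of 0] L2[of 0]] by simp
  moreover have "(\<integral>x. (cmod (g x - f m x))\<^sup>2 \<partial>M) \<le> c * (1/4) ^ m" for m
  proof -
    have "ennreal (\<integral>x. (cmod (g x - f m x))\<^sup>2 \<partial>M) = (\<integral>\<^sup>+x. ennreal ((cmod (g x - f m x))\<^sup>2) \<partial>M)"
      by (intro nn_integral_eq_integral[symmetric] L2_integrable L2g) auto
    also have "\<dots> \<le> ennreal (c * (1/4) ^ m)" by (rule nng)
    finally show ?thesis using \<open>c \<ge> 0\<close> by (simp add: ennreal_le_iff)
  qed
  ultimately show ?thesis by blast
qed

section \<open>Laurent polynomials of a unitary operator\<close>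

locale unitary_seq =
  fixes U :: "(int \<Rightarrow> complex) \<Rightarrow> (int \<Rightarrow> complex)"
  assumes unitary: "unitary2 U"
begin

abbreviation V :: "(int \<Rightarrow> complex) \<Rightarrow> (int \<Rightarrow> complex)" where
  "V \<equiv> inv_into ell2 U"

lemma U_bij: "bij_betw U ell2 ell2"
  using unitary by (simp add: unitary2_def)

lemma U_mem [simp]: "\<psi> \<in> ell2 \<Longrightarrow> U \<psi> \<in> ell2"
  using U_bij by (auto simp: bij_betw_def)

lemma V_mem [simp]: "\<psi> \<in> ell2 \<Longrightarrow> V \<psi> \<in> ell2"
  using bij_betw_inv_into[OF U_bij] by (auto simp: bij_betw_def)

lemma UV [simp]: "\<psi> \<in> ell2 \<Longrightarrow> U (V \<psi>) = \<psi>"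
  using bij_betw_inv_into_right[OF U_bij] .

lemma VU [simp]: "\<psi> \<in> ell2 \<Longrightarrow> V (U \<psi>) = \<psi>"
  using bij_betw_inv_into_left[OF U_bij] .

lemma Upow_mem [simp]: "\<psi> \<in> ell2 \<Longrightarrow> (U ^^ n) \<psi> \<in> ell2"
  by (induction n) auto

lemma Vpow_mem [simp]: "\<psi> \<in> ell2 \<Longrightarrow> (V ^^ n) \<psi> \<in> ell2"
  by (induction n) auto

lemma U_add: "\<phi> \<in> ell2 \<Longrightarrow> \<psi> \<in> ell2 \<Longrightarrow> U (\<lambda>k. \<phi> k + \<psi> k) = (\<lambda>k. U \<phi> k + U \<psi> k)"
  using unitary by (simp add: unitary2_def)

lemma U_scale: "\<psi> \<in> ell2 \<Longrightarrow> U (\<lambda>k. c * \<psi> k) = (\<lambda>k. c * U \<psi> k)"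
  using unitary by (simp add: unitary2_def)

lemma U_diff: "\<phi> \<in> ell2 \<Longrightarrow> \<psi> \<in> ell2 \<Longrightarrow> U (\<lambda>k. \<phi> k - \<psi> k) = (\<lambda>k. U \<phi> k - U \<psi> k)"
  using U_add[of \<phi> "\<lambda>k. -1 * \<psi> k"] U_scale[of \<psi> "-1"] ell2_scale[of \<psi> "-1"] by simp

lemma U_inner: "\<phi> \<in> ell2 \<Longrightarrow> \<psi> \<in> ell2 \<Longrightarrow> inner2 (U \<phi>) (U \<psi>) = inner2 \<phi> \<psi>"
  using unitary by (simp add: unitary2_def)

lemma V_inner: "\<phi> \<in> ell2 \<Longrightarrow> \<psi> \<in> ell2 \<Longrightarrow> inner2 (V \<phi>) \<psi> = inner2 \<phi> (U \<psi>)"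
  using U_inner[of "V \<phi>" \<psi>] by simp

lemma U_inner_V: "\<phi> \<in> ell2 \<Longrightarrow> \<psi> \<in> ell2 \<Longrightarrow> inner2 (U \<phi>) \<psi> = inner2 \<phi> (V \<psi>)"
  using U_inner[of \<phi> "V \<psi>"] by simp

lemma Vpow_inner: "\<phi> \<in> ell2 \<Longrightarrow> \<psi> \<in> ell2 \<Longrightarrow> inner2 ((V ^^ n) \<phi>) \<psi> = inner2 \<phi> ((U ^^ n) \<psi>)"
proof (induction n arbitrary: \<phi>)
  case (Suc n)
  then show ?case by (simp add: V_inner funpow_swap1)
qed simp

lemma U_norm: "\<psi> \<in> ell2 \<Longrightarrow> norm2 (U \<psi>) = norm2 \<psi>"
  using inner2_self[of \<psi>] inner2_self[of "U \<psi>"] U_inner[of \<psi> \<psi>]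
  by (simp add: power2_eq_iff_nonneg flip: of_real_power)

end

text \<open>\<open>lrep U \<psi> \<eta> p\<close>: the Laurent polynomial \<open>p\<close> satisfies \<open>\<eta> = p(U) \<psi>\<close>, where \<open>z\<^sup>-\<^sup>1\<close> is written \<open>cnj z\<close>.\<close>

inductive lrep :: "((int \<Rightarrow> complex) \<Rightarrow> (int \<Rightarrow> complex)) \<Rightarrow> (int \<Rightarrow> complex) \<Rightarrow>
    (int \<Rightarrow> complex) \<Rightarrow> (complex \<Rightarrow> complex) \<Rightarrow> bool" for U \<psi> where
  base: "lrep U \<psi> \<psi> (\<lambda>w. 1)"
| add: "lrep U \<psi> \<eta> p \<Longrightarrow> lrep U \<psi> \<zeta> q \<Longrightarrow> lrep U \<psi> (\<lambda>k. \<eta> k + \<zeta> k) (\<lambda>w. p w + q w)"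
| scale: "lrep U \<psi> \<eta> p \<Longrightarrow> lrep U \<psi> (\<lambda>k. c * \<eta> k) (\<lambda>w. c * p w)"
| shift: "lrep U \<psi> \<eta> p \<Longrightarrow> lrep U \<psi> (U \<eta>) (\<lambda>w. w * p w)"
| unshift: "lrep U \<psi> \<eta> p \<Longrightarrow> lrep U \<psi> (inv_into ell2 U \<eta>) (\<lambda>w. cnj w * p w)"

lemma lrep_diff:
  "lrep U \<psi> \<eta> p \<Longrightarrow> lrep U \<psi> \<zeta> q \<Longrightarrow> lrep U \<psi> (\<lambda>k. \<eta> k - \<zeta> k) (\<lambda>w. p w - q w)"
  using lrep.add[OF _ lrep.scale[of U \<psi> \<zeta> q "-1"], of \<eta> p] by simp

lemma lrep_funpow: "lrep U \<psi> \<eta> p \<Longrightarrow> lrep U \<psi> ((U ^^ n) \<eta>) (\<lambda>w. w ^ n * p w)"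
proof (induction n)
  case (Suc n)
  then show ?case using lrep.shift[of U \<psi> "(U ^^ n) \<eta>" "\<lambda>w. w ^ n * p w"] by (simp add: mult.assoc)
qed simp

text \<open>The induction applies q(U) to \<open>\<eta>\<close> generator by generator. It makes the
  represented functions an algebra, as Stone-Weierstrass requires.\<close>

lemma lrep_mult:
  assumes "lrep U \<psi> \<zeta> q" "lrep U \<psi> \<eta> p"
  shows "\<exists>\<xi>. lrep U \<psi> \<xi> (\<lambda>w. q w * p w)"
  using assms(1)
proof (induction rule: lrep.induct)
  case base
  then show ?case using assms(2) by auto
next
  case (add \<eta> p \<zeta> q)
  then show ?case by (auto simp: distrib_right intro: lrep.add)
next
  case (scale \<eta> p c)
  then show ?case by (auto simp: mult.assoc intro: lrep.scale)
next
  case (shift \<eta> p)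
  then show ?case by (auto simp: mult.assoc intro: lrep.shift)
next
  case (unshift \<eta> p)
  then show ?case by (auto simp: mult.assoc intro: lrep.unshift)
qed

lemma lrep_continuous: "lrep U \<psi> \<eta> p \<Longrightarrow> continuous_on UNIV p"
  by (induction rule: lrep.induct) (auto intro!: continuous_intros)

lemma lrep_real_polynomial_function:
  assumes "real_polynomial_function g"
  shows "\<exists>\<eta>. lrep U \<psi> \<eta> (\<lambda>w. complex_of_real (g w))"
  using assms
proof (induction rule: real_polynomial_function.induct)
  case (linear f)
  interpret bounded_linear f by fact
  let ?a = "complex_of_real (f 1)" and ?b = "complex_of_real (f \<i>)"
  \<comment> \<open>Here Re w = (w + cnj w)/2 and Im w = (w - cnj w)/(2i) are inserted into f w = Re
    w f(1) + Im w f(i).\<close>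
  have "complex_of_real (f w) = (?a / 2 - \<i> * ?b / 2) * (w * 1) + (?a / 2 + \<i> * ?b / 2) * (cnj w * 1)" for w
  proof -
    have "f w = f (Re w *\<^sub>R 1 + Im w *\<^sub>R \<i>)"
      by (rule arg_cong[where f = f]) (simp add: complex_eq_iff)
    also have "\<dots> = Re w * f 1 + Im w * f \<i>" by (simp only: add scale real_scaleR_def)
    finally show ?thesis by (simp add: complex_eq_iff algebra_simps)
  qed
  then have "(\<lambda>w. complex_of_real (f w)) =
      (\<lambda>w. (?a / 2 - \<i> * ?b / 2) * (w * 1) + (?a / 2 + \<i> * ?b / 2) * (cnj w * 1))"
    by (rule ext)
  then show ?case
    using lrep.add[OF lrep.scale[OF lrep.shift[OF lrep.base], where c = "?a / 2 - \<i> * ?b / 2"]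
        lrep.scale[OF lrep.unshift[OF lrep.base], where c = "?a / 2 + \<i> * ?b / 2"], of U \<psi>]
    by metis
next
  case (const c)
  then show ?case using lrep.scale[OF lrep.base, of U \<psi> "complex_of_real c"] by auto
next
  case (add f g)
  then show ?case by (auto intro: lrep.add)
next
  case (mult f g)
  then show ?case using lrep_mult by force
qed

lemma lrep_dense:
  assumes f: "continuous_on (sphere 0 1) f" and "e > 0"
  shows "\<exists>\<eta> p. lrep U \<psi> \<eta> p \<and> (\<forall>w\<in>sphere 0 1. cmod (f w - p w) < e)"
proof -
  obtain g where g: "real_polynomial_function g" "\<And>w. w \<in> sphere 0 1 \<Longrightarrow> \<bar>Re (f w) - g w\<bar> < e / 2"
    using Stone_Weierstrass_real_polynomial_function[of "sphere 0 1" "\<lambda>w. Re (f w)" "e / 2"] f \<open>e > 0\<close>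
    by (auto intro!: continuous_intros)
  obtain h where h: "real_polynomial_function h" "\<And>w. w \<in> sphere 0 1 \<Longrightarrow> \<bar>Im (f w) - h w\<bar> < e / 2"
    using Stone_Weierstrass_real_polynomial_function[of "sphere 0 1" "\<lambda>w. Im (f w)" "e / 2"] f \<open>e > 0\<close>
    by (auto intro!: continuous_intros)
  obtain \<eta> where \<eta>: "lrep U \<psi> \<eta> (\<lambda>w. complex_of_real (g w))"
    using lrep_real_polynomial_function[OF g(1)] by blast
  obtain \<zeta> where \<zeta>: "lrep U \<psi> \<zeta> (\<lambda>w. complex_of_real (h w))"
    using lrep_real_polynomial_function[OF h(1)] by blast
  have "cmod (f w - (complex_of_real (g w) + \<i> * complex_of_real (h w))) < e" if "w \<in> sphere 0 1" for w
  proof -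
    have "cmod (f w - (complex_of_real (g w) + \<i> * complex_of_real (h w))) \<le>
      \<bar>Re (f w) - g w\<bar> + \<bar>Im (f w) - h w\<bar>"
      using cmod_le[of "f w - (complex_of_real (g w) + \<i> * complex_of_real (h w))"] by simp
    also have "\<dots> < e" using g(2)[OF that] h(2)[OF that] by simp
    finally show ?thesis .
  qed
  then show ?thesis using lrep.add[OF \<eta> lrep.scale[OF \<zeta>, of "\<i>"]] by blast
qed

section \<open>The isometry between Laurent polynomials in L2(\<mu>) and the cyclic subspace\<close>

locale cyclic_subspace = unitary_seq +
  fixes \<psi> :: "int \<Rightarrow> complex" and \<mu> :: "complex measure"
  assumes psi_mem [simp]: "\<psi> \<in> ell2" and spectral: "is_spectral_measure U \<psi> \<mu>"
begin

lemma sets_mu [measurable_cong]: "sets \<mu> = sets borel"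
  using spectral by (simp add: is_spectral_measure_def)

lemma space_mu [simp]: "space \<mu> = UNIV"
  using sets_eq_imp_space_eq[OF sets_mu] by simp

lemma finite_mu: "finite_measure \<mu>"
  using spectral by (simp add: is_spectral_measure_def)

lemma AE_circle: "AE w in \<mu>. cmod w = 1"
proof (rule AE_I[where N = "- sphere 0 1"])
  show "emeasure \<mu> (- sphere 0 1) = 0"
    using spectral by (simp add: is_spectral_measure_def)
qed (auto simp: sets_mu)

lemma moment: "inner2 \<psi> ((U ^^ n) \<psi>) = (\<integral>z. z ^ n \<partial>\<mu>)"
  using spectral by (simp add: is_spectral_measure_def)

lemma integrable_circle:
  fixes f :: "complex \<Rightarrow> 'b::{banach, second_countable_topology}"
  assumes [measurable]: "f \<in> borel_measurable borel" and B: "\<And>w. cmod w = 1 \<Longrightarrow> norm (f w) \<le> B"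
  shows "integrable \<mu> f"
proof (rule finite_measure.integrable_const_bound[OF finite_mu])
  show "AE w in \<mu>. norm (f w) \<le> B" using AE_circle by eventually_elim (rule B)
qed measurable

lemma bounded_circle:
  fixes f :: "complex \<Rightarrow> complex"
  assumes "continuous_on UNIV f"
  obtains B where "\<And>w. cmod w = 1 \<Longrightarrow> cmod (f w) \<le> B"
proof -
  have "compact (f ` sphere 0 1)"
    by (intro compact_continuous_image continuous_on_subset[OF assms]) auto
  then have "bounded (f ` sphere 0 1)" by (rule compact_imp_bounded)
  then obtain B where "\<forall>w\<in>sphere 0 1. cmod (f w) \<le> B" by (auto simp: bounded_iff)
  then show ?thesis by (intro that[of B]) simp
qed

lemma integrable_continuous:
  fixes f :: "complex \<Rightarrow> complex"
  assumes "continuous_on UNIV f"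
  shows "integrable \<mu> f"
proof -
  obtain B where "\<And>w. cmod w = 1 \<Longrightarrow> cmod (f w) \<le> B" using bounded_circle[OF assms] by blast
  with borel_measurable_continuous_onI[OF assms] show ?thesis by (rule integrable_circle)
qed

lemma continuous_L2:
  assumes "continuous_on UNIV f"
  shows "L2 \<mu> f"
proof -
  obtain B where B: "\<And>w. cmod w = 1 \<Longrightarrow> cmod (f w) \<le> B" using bounded_circle[OF assms] by blast
  have [measurable]: "f \<in> borel_measurable borel" using assms by (rule borel_measurable_continuous_onI)
  have "integrable \<mu> (\<lambda>w. (cmod (f w))\<^sup>2)"
    by (rule integrable_circle[where B = "B\<^sup>2"]) (auto intro: power_mono B)
  then show ?thesis by (simp add: L2_def)
qed

lemma lrep_mem [simp]: "lrep U \<psi> \<eta> p \<Longrightarrow> \<eta> \<in> ell2"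
  by (induction rule: lrep.induct) (simp_all add: ell2_add ell2_scale)

lemmas lrep_L2 = continuous_L2[OF lrep_continuous]

text \<open>The two families need each other: at n = 0 the step \<open>shift\<close> moves
  \<open>U\<close> to the left and meets \<open>V \<psi>\<close>, and \<open>unshift\<close> meets
  \<open>U \<psi>\<close>. For n > 0 a factor cancels, which on the function side is w cnj w = 1,
  true only on the circle and hence almost everywhere.\<close>

lemma lrep_moments:
  assumes "lrep U \<psi> \<eta> p"
  shows "inner2 ((U ^^ n) \<psi>) \<eta> = (\<integral>w. cnj w ^ n * p w \<partial>\<mu>) \<and>
         inner2 ((V ^^ n) \<psi>) \<eta> = (\<integral>w. w ^ n * p w \<partial>\<mu>)"
  using assms
proof (induction arbitrary: n rule: lrep.induct)
  case base
  have "inner2 ((U ^^ n) \<psi>) \<psi> = cnj (\<integral>w. w ^ n \<partial>\<mu>)"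
    by (subst inner2_cnj) (simp add: moment)
  also have "\<dots> = (\<integral>w. cnj (w ^ n) \<partial>\<mu>)" by (rule Bochner_Integration.integral_cnj[symmetric])
  finally show ?case by (simp add: Vpow_inner moment)
next
  case (add \<eta> p \<zeta> q)
  have "integrable \<mu> (\<lambda>w. cnj w ^ n * p w)" "integrable \<mu> (\<lambda>w. cnj w ^ n * q w)"
    "integrable \<mu> (\<lambda>w. w ^ n * p w)" "integrable \<mu> (\<lambda>w. w ^ n * q w)"
    using add.hyps[THEN lrep_continuous] by (auto intro!: integrable_continuous continuous_intros)
  then show ?case using add by (simp add: inner2_add_right distrib_left)
next
  case (scale \<eta> p c)
  then show ?case by (simp add: inner2_scale_right mult.left_commute[of _ c])
next
  case (shift \<eta> p)
  have "inner2 ((U ^^ n) \<psi>) (U \<eta>) = (\<integral>w. cnj w ^ n * (w * p w) \<partial>\<mu>)"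
  proof (cases n)
    case 0
    then show ?thesis using shift.IH[of 1] shift.hyps V_inner[of \<psi> \<eta>] by simp
  next
    case (Suc m)
    have "inner2 ((U ^^ n) \<psi>) (U \<eta>) = (\<integral>w. cnj w ^ m * p w \<partial>\<mu>)"
      using shift.IH[of m] shift.hyps by (simp add: Suc U_inner)
    also have "\<dots> = (\<integral>w. cnj w ^ n * (w * p w) \<partial>\<mu>)"
    proof (rule integral_cong_AE)
      show "AE w in \<mu>. cnj w ^ m * p w = cnj w ^ n * (w * p w)"
        using AE_circle
      proof eventually_elim
        case (elim w)
        then have "cnj w * w = 1" using complex_norm_square[of w] by (simp add: mult.commute)
        moreover have "cnj w ^ n * (w * p w) = (cnj w * w) * (cnj w ^ m * p w)"
          by (simp add: Suc mult_ac)
        ultimately show ?case by (simp only: mult_1)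
      qed
    qed (use lrep_continuous[OF shift.hyps] in \<open>auto intro!: borel_measurable_integrable integrable_continuous continuous_intros\<close>)
    finally show ?thesis .
  qed
  moreover have "inner2 ((V ^^ n) \<psi>) (U \<eta>) = (\<integral>w. w ^ n * (w * p w) \<partial>\<mu>)"
    using shift.IH[of "Suc n"] shift.hyps V_inner[of "(V ^^ n) \<psi>" \<eta>] by (simp add: mult.assoc mult.left_commute)
  ultimately show ?case by simp
next
  case (unshift \<eta> p)
  have "inner2 ((V ^^ n) \<psi>) (V \<eta>) = (\<integral>w. w ^ n * (cnj w * p w) \<partial>\<mu>)"
  proof (cases n)
    case 0
    then show ?thesis using unshift.IH[of 1] unshift.hyps U_inner_V[of \<psi> \<eta>] by simp
  next
    case (Suc m)
    have "inner2 ((V ^^ n) \<psi>) (V \<eta>) = (\<integral>w. w ^ m * p w \<partial>\<mu>)"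
      using unshift.IH[of m] unshift.hyps by (simp add: Suc V_inner)
    also have "\<dots> = (\<integral>w. w ^ n * (cnj w * p w) \<partial>\<mu>)"
    proof (rule integral_cong_AE)
      show "AE w in \<mu>. w ^ m * p w = w ^ n * (cnj w * p w)"
        using AE_circle
      proof eventually_elim
        case (elim w)
        then have "w * cnj w = 1" using complex_norm_square[of w] by simp
        moreover have "w ^ n * (cnj w * p w) = (w * cnj w) * (w ^ m * p w)"
          by (simp add: Suc mult_ac)
        ultimately show ?case by (simp only: mult_1)
      qed
    qed (use lrep_continuous[OF unshift.hyps] in \<open>auto intro!: borel_measurable_integrable integrable_continuous continuous_intros\<close>)
    finally show ?thesis .
  qed
  moreover have "inner2 ((U ^^ n) \<psi>) (V \<eta>) = (\<integral>w. cnj w ^ n * (cnj w * p w) \<partial>\<mu>)"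
    using unshift.IH[of "Suc n"] unshift.hyps U_inner_V[of "(U ^^ n) \<psi>" \<eta>] by (simp add: mult.assoc mult.left_commute)
  ultimately show ?case by simp
qed

text \<open>The adjoint of each generator is again a generator, so the induction strips the left
  argument down to \<open>\<psi>\<close>, where \<open>lrep_moments\<close> with exponent 0
  applies.\<close>

lemma lrep_inner:
  assumes "lrep U \<psi> \<zeta> q" "lrep U \<psi> \<eta> p"
  shows "inner2 \<zeta> \<eta> = (\<integral>w. cnj (q w) * p w \<partial>\<mu>)"
  using assms
proof (induction arbitrary: \<eta> p rule: lrep.induct)
  case base
  then show ?case using lrep_moments[of \<eta> p 0] by simp
next
  case (add \<zeta> q \<zeta>' q')
  then show ?case
    by (simp add: inner2_add_left distrib_right L2_inner_integrable lrep_L2)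
next
  case (scale \<zeta> q c)
  then show ?case by (simp add: inner2_scale_left mult.assoc)
next
  case (shift \<zeta> q)
  then show ?case using shift.IH[OF lrep.unshift[OF shift.prems]]
    by (simp add: U_inner_V mult.assoc mult.left_commute)
next
  case (unshift \<zeta> q)
  then show ?case using unshift.IH[OF lrep.shift[OF unshift.prems]]
    by (simp add: V_inner mult.assoc mult.left_commute)
qed

lemma lrep_norm:
  assumes "lrep U \<psi> \<eta> p"
  shows "(norm2 \<eta>)\<^sup>2 = (\<integral>w. (cmod (p w))\<^sup>2 \<partial>\<mu>)"
proof -
  have "complex_of_real ((norm2 \<eta>)\<^sup>2) = (\<integral>w. complex_of_real ((cmod (p w))\<^sup>2) \<partial>\<mu>)"
    using lrep_inner[OF assms assms] inner2_self[of \<eta>] assms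
    by (simp add: complex_norm_square mult.commute del: of_real_power)
  also have "\<dots> = complex_of_real (\<integral>w. (cmod (p w))\<^sup>2 \<partial>\<mu>)" by (rule integral_complex_of_real)
  finally show ?thesis by (simp only: of_real_eq_iff)
qed

end

section \<open>Projections onto a cyclic subspace\<close>

text \<open>Cauchy-Schwarz in a weighted additive form. The parameter s balances a small factor
  against a fixed one; it is used with s = 2^m.\<close>

lemma L2_inner_bound:
  assumes "L2 M f" "L2 M g" "s > 0"
  shows "2 * cmod (\<integral>x. cnj (f x) * g x \<partial>M) \<le> s * (\<integral>x. (cmod (f x))\<^sup>2 \<partial>M) + (\<integral>x. (cmod (g x))\<^sup>2 \<partial>M) / s"
proof -
  have "2 * cmod (cnj (f x) * g x) \<le> s * (cmod (f x))\<^sup>2 + (cmod (g x))\<^sup>2 / s" for x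
  proof -
    have "0 \<le> (s * cmod (f x) - cmod (g x))\<^sup>2 / s" using \<open>s > 0\<close> by simp
    also have "\<dots> = s * (cmod (f x))\<^sup>2 + (cmod (g x))\<^sup>2 / s - 2 * cmod (cnj (f x) * g x)"
      using \<open>s > 0\<close> by (simp add: norm_mult power2_eq_square field_simps)
    finally show ?thesis by simp
  qed
  note le = this
  have "2 * cmod (\<integral>x. cnj (f x) * g x \<partial>M) \<le> 2 * (\<integral>x. cmod (cnj (f x) * g x) \<partial>M)"
    by (simp add: integral_norm_bound)
  also have "\<dots> = (\<integral>x. 2 * cmod (cnj (f x) * g x) \<partial>M)" by simp
  also have "\<dots> \<le> (\<integral>x. s * (cmod (f x))\<^sup>2 + (cmod (g x))\<^sup>2 / s \<partial>M)"
  proof (rule integral_mono)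
    show "integrable M (\<lambda>x. 2 * cmod (cnj (f x) * g x))"
      using L2_inner_integrable[OF assms(1,2)] by (intro integrable_mult_right integrable_norm) auto
    show "integrable M (\<lambda>x. s * (cmod (f x))\<^sup>2 + (cmod (g x))\<^sup>2 / s)"
      using assms by (simp add: L2_integrable)
  qed (rule le)
  also have "\<dots> = s * (\<integral>x. (cmod (f x))\<^sup>2 \<partial>M) + (\<integral>x. (cmod (g x))\<^sup>2 \<partial>M) / s"
    using assms by (simp add: L2_integrable)
  finally show ?thesis .
qed

context cyclic_subspace begin

text \<open>The pairings in \<open>proj_rep\<close> test a function against Laurent polynomials
  only. Being a limit of such polynomials is what lets these pairings control its norm.\<close>

definition laurent_closure :: "(complex \<Rightarrow> complex) \<Rightarrow> bool" where
  "laurent_closure f \<longleftrightarrow> L2 \<mu> f \<and>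
     (\<forall>e>0. \<exists>\<eta> p. lrep U \<psi> \<eta> p \<and> (\<integral>w. (cmod (f w - p w))\<^sup>2 \<partial>\<mu>) < e)"

text \<open>\<open>proj_rep \<rho> f\<close>: the orthogonal projection of \<open>\<rho>\<close> onto the cyclic subspace of \<open>\<psi>\<close> corresponds to \<open>f \<in> L\<^sup>2(\<mu>)\<close>.\<close>

definition proj_rep :: "(int \<Rightarrow> complex) \<Rightarrow> (complex \<Rightarrow> complex) \<Rightarrow> bool" where
  "proj_rep \<rho> f \<longleftrightarrow> \<rho> \<in> ell2 \<and> laurent_closure f \<and>
     (\<forall>\<eta> p. lrep U \<psi> \<eta> p \<longrightarrow> inner2 \<rho> \<eta> = (\<integral>w. cnj (f w) * p w \<partial>\<mu>))"

lemma proj_rep_L2: "proj_rep \<rho> f \<Longrightarrow> L2 \<mu> f"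
  by (simp add: proj_rep_def laurent_closure_def)

lemma proj_rep_mem: "proj_rep \<rho> f \<Longrightarrow> \<rho> \<in> ell2"
  by (simp add: proj_rep_def)

lemma proj_rep_inner: "proj_rep \<rho> f \<Longrightarrow> lrep U \<psi> \<eta> p \<Longrightarrow> inner2 \<rho> \<eta> = (\<integral>w. cnj (f w) * p w \<partial>\<mu>)"
  by (simp add: proj_rep_def)

lemma proj_repI:
  assumes "\<rho> \<in> ell2" "L2 \<mu> f"
    and "\<And>e. e > 0 \<Longrightarrow> \<exists>\<eta> p. lrep U \<psi> \<eta> p \<and> (\<integral>w. (cmod (f w - p w))\<^sup>2 \<partial>\<mu>) < e"
    and "\<And>\<eta> p. lrep U \<psi> \<eta> p \<Longrightarrow> inner2 \<rho> \<eta> = (\<integral>w. cnj (f w) * p w \<partial>\<mu>)"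
  shows "proj_rep \<rho> f"
  using assms by (simp add: proj_rep_def laurent_closure_def)

lemma proj_rep_approx:
  assumes "proj_rep \<rho> f" "e > 0"
  obtains \<eta> p where "lrep U \<psi> \<eta> p" "(\<integral>w. (cmod (f w - p w))\<^sup>2 \<partial>\<mu>) < e"
  using assms unfolding proj_rep_def laurent_closure_def by blast

lemma lrep_proj_rep:
  assumes "lrep U \<psi> \<zeta> q"
  shows "proj_rep \<zeta> q"
proof (rule proj_repI)
  fix e :: real assume "e > 0"
  then show "\<exists>\<eta> p. lrep U \<psi> \<eta> p \<and> (\<integral>w. (cmod (q w - p w))\<^sup>2 \<partial>\<mu>) < e"
    using assms by (intro exI[of _ \<zeta>] exI[of _ q]) simp
qed (use assms in \<open>auto intro: lrep_L2 lrep_inner\<close>)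

lemma proj_rep_add:
  assumes f: "proj_rep \<rho> f" and g: "proj_rep \<sigma> g"
  shows "proj_rep (\<lambda>k. \<rho> k + \<sigma> k) (\<lambda>w. f w + g w)"
proof (rule proj_repI)
  show "(\<lambda>k. \<rho> k + \<sigma> k) \<in> ell2" using f g by (intro ell2_add proj_rep_mem)
  show "L2 \<mu> (\<lambda>w. f w + g w)" using f g by (intro L2_add proj_rep_L2)
  show "inner2 (\<lambda>k. \<rho> k + \<sigma> k) \<eta> = (\<integral>w. cnj (f w + g w) * p w \<partial>\<mu>)" if "lrep U \<psi> \<eta> p" for \<eta> p
    using f g that
    by (simp add: inner2_add_left proj_rep_mem proj_rep_inner distrib_right L2_inner_integrable proj_rep_L2 lrep_L2)
  fix e :: real assume "e > 0"
  then have e: "e / 4 > 0" by simp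
  obtain \<eta> p where p: "lrep U \<psi> \<eta> p" "(\<integral>w. (cmod (f w - p w))\<^sup>2 \<partial>\<mu>) < e / 4"
    using proj_rep_approx[OF f e] .
  obtain \<zeta> q where q: "lrep U \<psi> \<zeta> q" "(\<integral>w. (cmod (g w - q w))\<^sup>2 \<partial>\<mu>) < e / 4"
    using proj_rep_approx[OF g e] .
  have "(\<integral>w. (cmod ((f w - p w) + (g w - q w)))\<^sup>2 \<partial>\<mu>) < e"
    using L2_add_power2_le[OF L2_diff[OF proj_rep_L2[OF f] lrep_L2[OF p(1)]] L2_diff[OF proj_rep_L2[OF g] lrep_L2[OF q(1)]]]
      p(2) q(2) by linarith
  then have "(\<integral>w. (cmod ((f w + g w) - (p w + q w)))\<^sup>2 \<partial>\<mu>) < e"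
    by (simp add: add_diff_add)
  then show "\<exists>\<eta> p. lrep U \<psi> \<eta> p \<and> (\<integral>w. (cmod ((f w + g w) - p w))\<^sup>2 \<partial>\<mu>) < e"
    using lrep.add[OF p(1) q(1)] by blast
qed

lemma proj_rep_scale:
  assumes f: "proj_rep \<rho> f"
  shows "proj_rep (\<lambda>k. c * \<rho> k) (\<lambda>w. c * f w)"
proof (rule proj_repI)
  show "(\<lambda>k. c * \<rho> k) \<in> ell2" using f by (intro ell2_scale proj_rep_mem)
  show "L2 \<mu> (\<lambda>w. c * f w)" using f by (intro L2_scale proj_rep_L2)
  show "inner2 (\<lambda>k. c * \<rho> k) \<eta> = (\<integral>w. cnj (c * f w) * p w \<partial>\<mu>)" if "lrep U \<psi> \<eta> p" for \<eta> p
    using f that by (simp add: inner2_scale_left proj_rep_mem proj_rep_inner mult.assoc)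
  fix e :: real assume "e > 0"
  \<comment> \<open>Adding 1 keeps the divisor positive when c = 0.\<close>
  have c: "(cmod c)\<^sup>2 + 1 > 0" by (simp add: add_nonneg_pos)
  with \<open>e > 0\<close> have e: "e / ((cmod c)\<^sup>2 + 1) > 0" by simp
  obtain \<eta> p where p: "lrep U \<psi> \<eta> p" "(\<integral>w. (cmod (f w - p w))\<^sup>2 \<partial>\<mu>) < e / ((cmod c)\<^sup>2 + 1)"
    using proj_rep_approx[OF f e] .
  have "(\<integral>w. (cmod (c * f w - c * p w))\<^sup>2 \<partial>\<mu>) = (cmod c)\<^sup>2 * (\<integral>w. (cmod (f w - p w))\<^sup>2 \<partial>\<mu>)"
    by (simp add: norm_mult power_mult_distrib flip: right_diff_distrib)
  also have "\<dots> \<le> ((cmod c)\<^sup>2 + 1) * (\<integral>w. (cmod (f w - p w))\<^sup>2 \<partial>\<mu>)"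
    by (intro mult_right_mono) auto
  also have "\<dots> < e" using p(2) c by (simp add: pos_less_divide_eq mult.commute)
  finally show "\<exists>\<eta> p. lrep U \<psi> \<eta> p \<and> (\<integral>w. (cmod (c * f w - p w))\<^sup>2 \<partial>\<mu>) < e"
    using lrep.scale[OF p(1)] by blast
qed

lemma proj_rep_diff:
  assumes "proj_rep \<rho> f" "proj_rep \<sigma> g"
  shows "proj_rep (\<lambda>k. \<rho> k - \<sigma> k) (\<lambda>w. f w - g w)"
  using proj_rep_add[OF assms(1) proj_rep_scale[OF assms(2), of "-1"]] by simp

lemma proj_rep_sum:
  assumes "finite F" "\<And>i. i \<in> F \<Longrightarrow> proj_rep (\<rho> i) (f i)"
  shows "proj_rep (\<lambda>k. \<Sum>i\<in>F. \<rho> i k) (\<lambda>w. \<Sum>i\<in>F. f i w)"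
  using assms
proof (induction F rule: finite_induct)
  case empty
  then show ?case using proj_rep_scale[OF lrep_proj_rep[OF lrep.base], of 0] by simp
next
  case (insert i F)
  then show ?case by (simp add: proj_rep_add)
qed

lemma proj_rep_V:
  assumes f: "proj_rep \<rho> f"
  shows "proj_rep (V \<rho>) (\<lambda>w. cnj w * f w)"
proof (rule proj_repI)
  show "V \<rho> \<in> ell2" using f by (simp add: proj_rep_mem)
  show "L2 \<mu> (\<lambda>w. cnj w * f w)"
  proof (rule L2_mult_bounded[OF proj_rep_L2[OF f], where B = 1])
    show "AE w in \<mu>. cmod (cnj w) \<le> 1" using AE_circle by eventually_elim simp
  qed (simp add: measurable_cong_sets[OF sets_mu refl] borel_measurable_continuous_onI continuous_intros)
  show "inner2 (V \<rho>) \<eta> = (\<integral>w. cnj (cnj w * f w) * p w \<partial>\<mu>)" if "lrep U \<psi> \<eta> p" for \<eta> p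
    using proj_rep_inner[OF f lrep.shift[OF that]] proj_rep_mem[OF f] that
    by (simp add: V_inner mult.assoc mult.left_commute)
  fix e :: real assume "e > 0"
  then obtain \<eta> p where p: "lrep U \<psi> \<eta> p" "(\<integral>w. (cmod (f w - p w))\<^sup>2 \<partial>\<mu>) < e"
    using proj_rep_approx[OF f] by blast
  have [measurable]: "f \<in> borel_measurable \<mu>" "p \<in> borel_measurable \<mu>" "cnj \<in> borel_measurable borel"
    using proj_rep_L2[OF f] lrep_L2[OF p(1)]
    by (auto simp: L2_def intro!: borel_measurable_continuous_onI continuous_intros)
  have "(\<integral>w. (cmod (cnj w * f w - cnj w * p w))\<^sup>2 \<partial>\<mu>) = (\<integral>w. (cmod (f w - p w))\<^sup>2 \<partial>\<mu>)"
  proof (rule integral_cong_AE)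
    show "AE w in \<mu>. (cmod (cnj w * f w - cnj w * p w))\<^sup>2 = (cmod (f w - p w))\<^sup>2"
      using AE_circle by eventually_elim (simp add: norm_mult flip: right_diff_distrib)
  qed measurable
  then show "\<exists>\<eta> p. lrep U \<psi> \<eta> p \<and> (\<integral>w. (cmod (cnj w * f w - p w))\<^sup>2 \<partial>\<mu>) < e"
    using lrep.unshift[OF p(1)] p(2) by metis
qed

text \<open>Expanding both squares and using the isometry on p gives |\<rho>|^2 - |f|^2 = |\<rho> -
  \<eta>|^2 - |f - p|^2, which is at least -e for an approximant p.\<close>

lemma proj_rep_Bessel:
  assumes f: "proj_rep \<rho> f"
  shows "(\<integral>w. (cmod (f w))\<^sup>2 \<partial>\<mu>) \<le> (norm2 \<rho>)\<^sup>2"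
proof (rule field_le_epsilon)
  fix e :: real assume "e > 0"
  then obtain \<eta> p where p: "lrep U \<psi> \<eta> p" "(\<integral>w. (cmod (f w - p w))\<^sup>2 \<partial>\<mu>) < e"
    using proj_rep_approx[OF f] by blast
  have "0 \<le> (norm2 \<rho>)\<^sup>2 + (norm2 \<eta>)\<^sup>2 - 2 * Re (inner2 \<rho> \<eta>)"
    using norm2_diff_power2[OF proj_rep_mem[OF f] lrep_mem[OF p(1)]] by (metis zero_le_power2)
  then show "(\<integral>w. (cmod (f w))\<^sup>2 \<partial>\<mu>) \<le> (norm2 \<rho>)\<^sup>2 + e"
    using L2_diff_power2[OF proj_rep_L2[OF f] lrep_L2[OF p(1)]] p(2)
    by (simp add: lrep_norm[OF p(1)] proj_rep_inner[OF f p(1)])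
qed

text \<open>The difference represents the zero vector, so Bessel's inequality makes its norm
  0.\<close>

lemma proj_rep_unique:
  assumes "proj_rep \<rho> f" "proj_rep \<rho> g"
  shows "AE w in \<mu>. f w = g w"
proof -
  have d: "proj_rep (\<lambda>k. 0) (\<lambda>w. f w - g w)" using proj_rep_diff[OF assms] by simp
  have "(\<integral>w. (cmod (f w - g w))\<^sup>2 \<partial>\<mu>) = 0"
    using proj_rep_Bessel[OF d] by (intro antisym) auto
  then have "AE w in \<mu>. (cmod (f w - g w))\<^sup>2 = 0"
    using integral_nonneg_eq_0_iff_AE[OF L2_integrable[OF proj_rep_L2[OF d]]] by simp
  then show ?thesis by eventually_elim simp
qed

text \<open>The projection theorem by a minimizing sequence. The isometry moves the Cauchy property
  to L2(\<mu>), so the projection is found directly as a function. The rate 4^-m is the one that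
  \<open>L2_fast_Cauchy\<close> asks for.\<close>

lemma proj_rep_exists:
  assumes rho: "\<rho> \<in> ell2"
  shows "\<exists>f. proj_rep \<rho> f"
proof -
  define X where "X = {(norm2 (\<lambda>k. \<rho> k - \<eta> k))\<^sup>2 | \<eta> p. lrep U \<psi> \<eta> p}"
  define D where "D = Inf X"
  have "X \<noteq> {}" unfolding X_def using lrep.base by blast
  have D_le: "D \<le> (norm2 (\<lambda>k. \<rho> k - \<eta> k))\<^sup>2" if "lrep U \<psi> \<eta> p" for \<eta> p
    unfolding D_def
  proof (rule cInf_lower)
    show "(norm2 (\<lambda>k. \<rho> k - \<eta> k))\<^sup>2 \<in> X" unfolding X_def using that by blast
    show "bdd_below X" unfolding X_def by (rule bdd_belowI[of _ 0]) auto
  qed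
  have "\<exists>\<eta> p. lrep U \<psi> \<eta> p \<and> (norm2 (\<lambda>k. \<rho> k - \<eta> k))\<^sup>2 < D + (1/4) ^ m" for m :: nat
  proof -
    have "Inf X < D + (1/4) ^ m" by (simp add: D_def)
    from cInf_lessD[OF \<open>X \<noteq> {}\<close> this] show ?thesis unfolding X_def by blast
  qed
  then obtain \<eta> p where lrep: "\<And>m. lrep U \<psi> (\<eta> m) (p m)"
    and close: "\<And>m. (norm2 (\<lambda>k. \<rho> k - \<eta> m k))\<^sup>2 < D + (1/4) ^ m"
    by metis
  have mem: "\<eta> m \<in> ell2" "(\<lambda>k. \<rho> k - \<eta> m k) \<in> ell2" for m
    using lrep_mem[OF lrep] rho by (simp_all add: ell2_diff)
  \<comment> \<open>By the parallelogram law the left side is below 2 (D + 4^-m) + 2 (D + 4^-n) - 4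
    D, since the midpoint of the two approximants is also at squared distance at least D. With m
    \<le> n this is at most 4 times 4^-m.\<close>
  have cauchy: "(\<integral>w. (cmod (p n w - p m w))\<^sup>2 \<partial>\<mu>) \<le> 4 * (1/4) ^ m" if "m \<le> n" for m n
  proof -
    have "D \<le> (norm2 (\<lambda>k. \<rho> k - 1/2 * (\<eta> m k + \<eta> n k)))\<^sup>2"
      by (rule D_le[OF lrep.scale[OF lrep.add[OF lrep lrep]]])
    also have "(\<lambda>k. \<rho> k - 1/2 * (\<eta> m k + \<eta> n k)) = (\<lambda>k. 1/2 * ((\<rho> k - \<eta> m k) + (\<rho> k - \<eta> n k)))"
      by (simp add: field_simps)
    also have "(norm2 \<dots>)\<^sup>2 = (norm2 (\<lambda>k. (\<rho> k - \<eta> m k) + (\<rho> k - \<eta> n k)))\<^sup>2 / 4"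
      by (simp only: norm2_scale) (simp add: power_mult_distrib power_divide)
    finally have "4 * D \<le> (norm2 (\<lambda>k. (\<rho> k - \<eta> m k) + (\<rho> k - \<eta> n k)))\<^sup>2" by simp
    moreover have "(norm2 (\<lambda>k. \<eta> n k - \<eta> m k))\<^sup>2 = (norm2 (\<lambda>k. (\<rho> k - \<eta> m k) - (\<rho> k - \<eta> n k)))\<^sup>2"
      by simp
    moreover have "(1/4 :: real) ^ n \<le> (1/4) ^ m" using that by (intro power_decreasing) auto
    moreover have "(norm2 (\<lambda>k. \<eta> n k - \<eta> m k))\<^sup>2 = (\<integral>w. (cmod (p n w - p m w))\<^sup>2 \<partial>\<mu>)"
      by (rule lrep_norm[OF lrep_diff[OF lrep lrep]])
    ultimately show ?thesis
      using norm2_add_power2[OF mem(2)[of m] mem(2)[of n]] norm2_diff_power2[OF mem(2)[of m] mem(2)[of n]]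
        close[of m] close[of n] by linarith
  qed
  obtain g where g: "L2 \<mu> g" "\<And>m. (\<integral>w. (cmod (g w - p m w))\<^sup>2 \<partial>\<mu>) \<le> 4 * (1/4) ^ m"
    using L2_fast_Cauchy[OF finite_mu, of p 4] lrep_L2[OF lrep] cauchy by auto
  have "proj_rep \<rho> g"
  proof (rule proj_repI[OF rho g(1)])
    fix e :: real assume "e > 0"
    then obtain m where "(1/4) ^ m < e / 4" using real_arch_pow_inv[of "e / 4" "1/4"] by auto
    then have "(\<integral>w. (cmod (g w - p m w))\<^sup>2 \<partial>\<mu>) < e" using g(2)[of m] by simp
    then show "\<exists>\<eta> p. lrep U \<psi> \<eta> p \<and> (\<integral>w. (cmod (g w - p w))\<^sup>2 \<partial>\<mu>) < e" using lrep by blast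
  next
    fix \<zeta> q assume q: "lrep U \<psi> \<zeta> q"
    define N where "N = (norm2 \<zeta>)\<^sup>2"
    have "N \<ge> 0" by (simp add: N_def)
    have le: "cmod (inner2 \<rho> \<zeta> - (\<integral>w. cnj (g w) * q w \<partial>\<mu>)) \<le> (5 + 2 * N) * (1/2) ^ m" for m :: nat
    proof -
      define z where "z = inner2 (\<lambda>k. \<rho> k - \<eta> m k) \<zeta>"
      \<comment> \<open>A trial step in the direction of \<open>\<zeta>\<close>. Its phase makes t z
        real and nonnegative; its size 2^-m matches the excess 4^-m over the infimum. The
        first-order gain 2 * 2^-m |z| can then not exceed 4^-m (1 + N), so the residual z is of
        order 2^-m.\<close>
      define t where "t = (1/2) ^ m * cnj (sgn z)"
      have tz: "t * z = complex_of_real ((1/2) ^ m * cmod z)"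
      proof -
        have "cnj (sgn z) * z = complex_of_real (cmod z)"
          by (cases "z = 0") (simp_all add: sgn_eq complex_norm_square[symmetric] mult.commute power2_eq_square)
        then show ?thesis by (simp add: t_def)
      qed
      have pw: "((1/2 :: real) ^ m)\<^sup>2 = (1/4) ^ m"
        by (simp add: power2_eq_square flip: power_mult_distrib)
      have "cmod t \<le> (1/2) ^ m"
        by (simp add: t_def norm_mult norm_sgn norm_power)
      then have tt: "(cmod t)\<^sup>2 \<le> (1/4) ^ m"
        using power_mono[of "cmod t" "(1/2) ^ m" 2] pw by simp
      have "D \<le> (norm2 (\<lambda>k. \<rho> k - (\<eta> m k + t * \<zeta> k)))\<^sup>2"
        by (rule D_le[OF lrep.add[OF lrep lrep.scale[OF q]]])
      also have "(\<lambda>k. \<rho> k - (\<eta> m k + t * \<zeta> k)) = (\<lambda>k. (\<rho> k - \<eta> m k) - t * \<zeta> k)"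
        by (simp add: algebra_simps)
      also have "(norm2 \<dots>)\<^sup>2 = (norm2 (\<lambda>k. \<rho> k - \<eta> m k))\<^sup>2 + (cmod t)\<^sup>2 * N - 2 * ((1/2) ^ m * cmod z)"
        using norm2_diff_power2[OF mem(2)[of m] ell2_scale[OF lrep_mem[OF q], of t]] lrep_mem[OF q] mem(2)[of m] tz
        by (simp add: norm2_scale power_mult_distrib N_def inner2_scale_right flip: z_def)
      finally have "2 * ((1/2) ^ m * cmod z) \<le> (1/4) ^ m + (cmod t)\<^sup>2 * N" using close[of m] by simp
      also have "\<dots> \<le> (1/4) ^ m + (1/4) ^ m * N"
        using tt \<open>N \<ge> 0\<close> by (intro add_left_mono mult_right_mono)
      also have "\<dots> = (1/2) ^ m * ((1/2) ^ m * (1 + N))"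
        by (simp add: pw[symmetric] power2_eq_square algebra_simps)
      finally have "(1/2) ^ m * (2 * cmod z) \<le> (1/2) ^ m * ((1/2) ^ m * (1 + N))"
        by (simp only: mult.left_commute)
      then have zle: "2 * cmod z \<le> (1/2) ^ m * (1 + N)" by (rule mult_left_le_imp_le) simp
      define y where "y = (\<integral>w. cnj (g w - p m w) * q w \<partial>\<mu>)"
      have "2 * cmod y \<le> 2 ^ m * (\<integral>w. (cmod (g w - p m w))\<^sup>2 \<partial>\<mu>) + N / 2 ^ m"
        unfolding y_def N_def lrep_norm[OF q]
        by (intro L2_inner_bound L2_diff g(1) lrep_L2[OF lrep] lrep_L2[OF q]) simp
      also have "\<dots> \<le> 2 ^ m * (4 * (1/4) ^ m) + N / 2 ^ m"
        by (intro add_right_mono mult_left_mono g(2)) simp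
      also have "\<dots> = (1/2) ^ m * (4 + N)"
      proof -
        have "2 ^ m * (1/4) ^ m = (1/2 :: real) ^ m" by (simp flip: power_mult_distrib)
        moreover have "N / 2 ^ m = (1/2) ^ m * N" by (simp add: power_one_over)
        ultimately show ?thesis
          by (simp only: mult.left_commute[of _ 4] distrib_left)
      qed
      finally have yle: "2 * cmod y \<le> (1/2) ^ m * (4 + N)" .
      have "y = (\<integral>w. cnj (g w) * q w \<partial>\<mu>) - (\<integral>w. cnj (p m w) * q w \<partial>\<mu>)"
        unfolding y_def
        by (simp add: left_diff_distrib L2_inner_integrable g(1) lrep_L2[OF lrep] lrep_L2[OF q])
      moreover have "z = inner2 \<rho> \<zeta> - (\<integral>w. cnj (p m w) * q w \<partial>\<mu>)"
        unfolding z_def using rho mem(1) lrep_mem[OF q]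
        by (simp add: inner2_diff_left lrep_inner[OF lrep q])
      ultimately have "inner2 \<rho> \<zeta> - (\<integral>w. cnj (g w) * q w \<partial>\<mu>) = z - y" by simp
      then have "cmod (inner2 \<rho> \<zeta> - (\<integral>w. cnj (g w) * q w \<partial>\<mu>)) \<le> cmod z + cmod y"
        using norm_triangle_ineq4[of z y] by simp
      also have "\<dots> \<le> (5 + 2 * N) * (1/2) ^ m"
      proof -
        have "0 \<le> N * (1/2) ^ m" "0 \<le> (1/2 :: real) ^ m" using \<open>N \<ge> 0\<close> by simp_all
        then show ?thesis using zle yle unfolding distrib_left distrib_right mult.commute[of _ N] mult.commute[of "(1/2) ^ m"]
          by linarith
      qed
      finally show ?thesis .
    qed
    have "(\<lambda>m. (5 + 2 * N) * (1/2) ^ m) \<longlonglongrightarrow> (5 + 2 * N) * 0"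
      by (intro tendsto_mult tendsto_const LIMSEQ_realpow_zero) auto
    then have "cmod (inner2 \<rho> \<zeta> - (\<integral>w. cnj (g w) * q w \<partial>\<mu>)) \<le> (5 + 2 * N) * 0"
      by (rule LIMSEQ_le_const) (use le in blast)
    then show "inner2 \<rho> \<zeta> = (\<integral>w. cnj (g w) * q w \<partial>\<mu>)" by simp
  qed
  then show ?thesis by blast
qed

end

section \<open>Generalized eigenvectors\<close>

definition linearly_bounded :: "(int \<Rightarrow> complex) \<Rightarrow> bool" where
  "linearly_bounded c \<longleftrightarrow> (\<exists>B. \<forall>k. cmod (c k) \<le> B * (1 + real_of_int \<bar>k\<bar>))"

context cyclic_subspace begin

text \<open>The weighted squares have a summable sequence of integrals, so their sum is finite
  almost everywhere. Each term is bounded by that sum, and undoing the weight costs a factor 1 +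
  |k|.\<close>

lemma AE_linearly_bounded:
  assumes g: "\<And>k. L2 \<mu> (g k)" "\<And>k. (\<integral>w. (cmod (g k w))\<^sup>2 \<partial>\<mu>) \<le> 1"
  shows "AE w in \<mu>. linearly_bounded (\<lambda>k. g k w)"
proof -
  note [measurable] = g(1)[THEN L2_measurable]
  \<comment> \<open>Sites n and -n share one term, so that the series runs over natural numbers;
    site 0 is merely counted twice.\<close>
  define h where "h n w = ((cmod (g (int n) w))\<^sup>2 + (cmod (g (- int n) w))\<^sup>2) * inverse ((real (Suc n))\<^sup>2)" for n w
  have [measurable]: "h n \<in> borel_measurable \<mu>" for n unfolding h_def by measurable
  have h0: "h n w \<ge> 0" for n w by (simp add: h_def)
  have summ: "summable (\<lambda>n. 2 * inverse ((real (Suc n))\<^sup>2))"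
    by (intro summable_mult, subst summable_Suc_iff) (rule inverse_power_summable, simp)
  have "(\<integral>\<^sup>+w. ennreal (h n w) \<partial>\<mu>) \<le> ennreal (2 * inverse ((real (Suc n))\<^sup>2))" for n
  proof -
    have i: "integrable \<mu> (h n)" unfolding h_def using g(1)[THEN L2_integrable] by simp
    have "(\<integral>w. h n w \<partial>\<mu>) = ((\<integral>w. (cmod (g (int n) w))\<^sup>2 \<partial>\<mu>) + (\<integral>w. (cmod (g (- int n) w))\<^sup>2 \<partial>\<mu>)) * inverse ((real (Suc n))\<^sup>2)"
      unfolding h_def using g(1)[THEN L2_integrable] by simp
    also have "\<dots> \<le> 2 * inverse ((real (Suc n))\<^sup>2)"
      using g(2)[of "int n"] g(2)[of "- int n"] by (intro mult_right_mono) auto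
    finally show ?thesis using nn_integral_eq_integral[OF i] h0 by (simp add: ennreal_leI)
  qed
  then have "(\<Sum>n. \<integral>\<^sup>+w. ennreal (h n w) \<partial>\<mu>) \<le> (\<Sum>n. ennreal (2 * inverse ((real (Suc n))\<^sup>2)))"
    by (intro suminf_le) auto
  also have "\<dots> = ennreal (\<Sum>n. 2 * inverse ((real (Suc n))\<^sup>2))"
    by (intro suminf_ennreal2 summ) simp
  finally have "(\<integral>\<^sup>+w. (\<Sum>n. ennreal (h n w)) \<partial>\<mu>) \<le> ennreal (\<Sum>n. 2 * inverse ((real (Suc n))\<^sup>2))"
    by (subst nn_integral_suminf) auto
  then have "(\<integral>\<^sup>+w. (\<Sum>n. ennreal (h n w)) \<partial>\<mu>) \<noteq> \<infinity>"
    using ennreal_neq_top by (metis infinity_ennreal_def top.extremum_unique)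
  then have "AE w in \<mu>. (\<Sum>n. ennreal (h n w)) \<noteq> \<infinity>"
    by (intro nn_integral_PInf_AE) auto
  then show ?thesis
  proof eventually_elim
    case (elim w)
    then have "summable (\<lambda>n. h n w)" by (intro summable_suminf_not_top h0) simp
    define B where "B = (\<Sum>n. h n w)"
    have hB: "h n w \<le> B" for n
      unfolding B_def using sum_le_suminf[OF \<open>summable (\<lambda>n. h n w)\<close>, of "{n}"] h0 by simp
    have "B \<ge> 0" using hB[of 0] h0[of 0 w] by linarith
    have "cmod (g k w) \<le> sqrt B * (1 + real_of_int \<bar>k\<bar>)" for k
    proof -
      define n where "n = nat \<bar>k\<bar>"
      have k: "k = int n \<or> k = - int n" and n: "real_of_int \<bar>k\<bar> = real n" by (auto simp: n_def)
      have "(cmod (g k w))\<^sup>2 \<le> (cmod (g (int n) w))\<^sup>2 + (cmod (g (- int n) w))\<^sup>2" using k by auto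
      also have "\<dots> = h n w * (real (Suc n))\<^sup>2" by (simp add: h_def field_simps del: of_nat_Suc)
      also have "\<dots> \<le> B * (real (Suc n))\<^sup>2" by (intro mult_right_mono hB) simp
      also have "\<dots> = (sqrt B * (1 + real_of_int \<bar>k\<bar>))\<^sup>2"
        using \<open>B \<ge> 0\<close> n by (simp add: power_mult_distrib)
      finally show ?thesis by (rule power2_le_imp_le) (use \<open>B \<ge> 0\<close> in simp)
    qed
    then show ?case unfolding linearly_bounded_def by blast
  qed
qed

lemma norm2_diff_truncation:
  assumes "\<rho> \<in> ell2" "finite F"
  shows "(norm2 (\<lambda>k. \<rho> k - (\<Sum>i\<in>F. \<rho> i * basis2 i k)))\<^sup>2 = (norm2 \<rho>)\<^sup>2 - (\<Sum>k\<in>F. (cmod (\<rho> k))\<^sup>2)"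
proof -
  have trunc: "(\<Sum>i\<in>F. \<rho> i * basis2 i k) = (if k \<in> F then \<rho> k else 0)" for k
    using assms(2) by (simp add: basis2_def if_distrib[of "(*) _"] sum.delta cong: if_cong)
  have "((\<lambda>k. if k \<in> F then (cmod (\<rho> k))\<^sup>2 else 0) has_sum (\<Sum>k\<in>F. (cmod (\<rho> k))\<^sup>2)) UNIV"
    using assms(2) by (intro has_sum_finite_neutralI[where B = F]) auto
  then have "((\<lambda>k. - (if k \<in> F then (cmod (\<rho> k))\<^sup>2 else 0)) has_sum - (\<Sum>k\<in>F. (cmod (\<rho> k))\<^sup>2)) UNIV"
    by (subst has_sum_uminus) simp
  note sum = has_sum_add[OF norm2_has_sum[OF assms(1)] this]
  have eq: "(\<lambda>k. (cmod (\<rho> k - (if k \<in> F then \<rho> k else 0)))\<^sup>2) =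
      (\<lambda>k. (cmod (\<rho> k))\<^sup>2 + - (if k \<in> F then (cmod (\<rho> k))\<^sup>2 else 0))"
    by auto
  have "(norm2 (\<lambda>k. \<rho> k - (\<Sum>i\<in>F. \<rho> i * basis2 i k)))\<^sup>2 =
      (\<Sum>\<^sub>\<infinity>k. (cmod (\<rho> k))\<^sup>2 + - (if k \<in> F then (cmod (\<rho> k))\<^sup>2 else 0))"
    by (simp only: norm2_power2 trunc eq)
  also have "\<dots> = (norm2 \<rho>)\<^sup>2 + - (\<Sum>k\<in>F. (cmod (\<rho> k))\<^sup>2)"
    by (rule infsumI[OF sum])
  finally show ?thesis by simp
qed

text \<open>The projection of \<open>V (basis2 k)\<close> is computed twice: as multiplication of g
  k by cnj w, and through the finite expansion of \<open>V (basis2 k)\<close> that the band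
  structure provides. Uniqueness equates the two almost everywhere.\<close>

lemma AE_generalized_eigenvector:
  assumes "has_band_structure U"
  shows "AE w in \<mu>. \<exists>c. c \<noteq> (\<lambda>k. 0) \<and> linearly_bounded c \<and>
    matrix_action (op_matrix U) c = (\<lambda>k. w * c k)"
proof -
  have "\<forall>k. \<exists>f. proj_rep (basis2 k) f" using proj_rep_exists by simp
  then obtain g where g: "\<And>k. proj_rep (basis2 k) (g k)" by metis
  note L2g = proj_rep_L2[OF g]
  note [measurable] = L2_measurable[OF L2g]
  have norm_basis: "norm2 (basis2 k) = 1" for k
  proof -
    have "complex_of_real ((norm2 (basis2 k))\<^sup>2) = 1"
      by (subst inner2_self[symmetric]) (simp_all add: inner2_basis, simp add: basis2_def)
    then have "(norm2 (basis2 k))\<^sup>2 = 1" by (simp only: of_real_eq_1_iff)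
    then show ?thesis using norm2_nonneg[of "basis2 k"] by (simp add: power2_eq_1_iff)
  qed
  have bdd: "AE w in \<mu>. linearly_bounded (\<lambda>k. g k w)"
    using proj_rep_Bessel[OF g] by (intro AE_linearly_bounded L2g) (simp add: norm_basis)
  obtain p where band: "\<And>j k. \<bar>j - k\<bar> > int p \<Longrightarrow> op_matrix U j k = 0"
    using assms unfolding has_band_structure_def band_order_def by blast
  have eq: "AE w in \<mu>. \<forall>k. (\<Sum>i | op_matrix U k i \<noteq> 0. op_matrix U k i * cnj (g i w)) = w * cnj (g k w)"
    unfolding AE_all_countable
  proof
    fix k
    define F where "F = {i. op_matrix U k i \<noteq> 0}"
    have "F \<subseteq> {k - int p..k + int p}" unfolding F_def using band[of k] by force
    then have fin: "finite F" by (rule finite_subset) simp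
    \<comment> \<open>\<open>V\<close> is the adjoint of \<open>U\<close>, so its k-th column is the
      conjugate of the k-th row of the matrix. This is why the eigenvector is formed from cnj (g k
      w).\<close>
    have "V (basis2 k) = (\<lambda>j. \<Sum>i\<in>F. cnj (op_matrix U k i) * basis2 i j)"
    proof
      fix j
      have "V (basis2 k) j = inner2 (basis2 j) (V (basis2 k))" by (simp add: inner2_basis)
      also have "\<dots> = cnj (inner2 (V (basis2 k)) (basis2 j))" by (rule inner2_cnj)
      also have "\<dots> = cnj (op_matrix U k j)" by (simp add: V_inner op_matrix_def)
      also have "\<dots> = (\<Sum>i\<in>F. if i = j then cnj (op_matrix U k i) else 0)"
        using fin by (simp add: sum.delta) (simp add: F_def)
      also have "\<dots> = (\<Sum>i\<in>F. cnj (op_matrix U k i) * basis2 i j)"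
        by (intro sum.cong) (auto simp: basis2_def)
      finally show "V (basis2 k) j = (\<Sum>i\<in>F. cnj (op_matrix U k i) * basis2 i j)" .
    qed
    moreover have "proj_rep (\<lambda>j. \<Sum>i\<in>F. cnj (op_matrix U k i) * basis2 i j)
        (\<lambda>w. \<Sum>i\<in>F. cnj (op_matrix U k i) * g i w)"
      by (intro proj_rep_sum proj_rep_scale g fin)
    ultimately have "AE w in \<mu>. cnj w * g k w = (\<Sum>i\<in>F. cnj (op_matrix U k i) * g i w)"
      using proj_rep_unique[OF proj_rep_V[OF g[of k]]] by simp
    then show "AE w in \<mu>. (\<Sum>i | op_matrix U k i \<noteq> 0. op_matrix U k i * cnj (g i w)) = w * cnj (g k w)"
    proof eventually_elim
      case (elim w)
      from arg_cong[OF elim, of cnj] show ?case by (simp add: F_def)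
    qed
  qed
  \<comment> \<open>The constant 1 represents \<open>\<psi>\<close>, and finite combinations of the
    g i represent truncations of \<open>\<psi>\<close>. On N those combinations vanish and the
    difference is 1, so Bessel's inequality bounds the mass of N by the squared tail of
    \<open>\<psi>\<close>.\<close>
  have nonzero: "AE w in \<mu>. \<exists>k. g k w \<noteq> 0"
  proof -
    define N where "N = {w \<in> space \<mu>. \<forall>k. g k w = 0}"
    have [measurable]: "N \<in> sets \<mu>" unfolding N_def by measurable
    have le: "measure \<mu> N \<le> (norm2 (\<lambda>k. \<psi> k - (\<Sum>i\<in>F. \<psi> i * basis2 i k)))\<^sup>2" if "finite F" for F
    proof -
      have rep: "proj_rep (\<lambda>k. \<psi> k - (\<Sum>i\<in>F. \<psi> i * basis2 i k)) (\<lambda>w. 1 - (\<Sum>i\<in>F. \<psi> i * g i w))"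
        by (intro proj_rep_diff lrep_proj_rep[OF lrep.base] proj_rep_sum proj_rep_scale g that)
      have "measure \<mu> N = (\<integral>w. indicator N w \<partial>\<mu>)" by simp
      also have "\<dots> \<le> (\<integral>w. (cmod (1 - (\<Sum>i\<in>F. \<psi> i * g i w)))\<^sup>2 \<partial>\<mu>)"
      proof (rule integral_mono)
        show "integrable \<mu> (indicator N :: _ \<Rightarrow> real)"
          using finite_measure.emeasure_finite[OF finite_mu, of N]
          by (intro integrable_real_indicator) (auto simp: top.not_eq_extremum)
        show "integrable \<mu> (\<lambda>w. (cmod (1 - (\<Sum>i\<in>F. \<psi> i * g i w)))\<^sup>2)"
          by (rule L2_integrable[OF proj_rep_L2[OF rep]])
      qed (auto simp: indicator_def N_def)
      also have "\<dots> \<le> (norm2 (\<lambda>k. \<psi> k - (\<Sum>i\<in>F. \<psi> i * basis2 i k)))\<^sup>2"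
        by (rule proj_rep_Bessel[OF rep])
      finally show ?thesis .
    qed
    have "measure \<mu> N \<le> 0"
    proof (rule field_le_epsilon)
      fix e :: real assume "e > 0"
      then obtain F where F: "finite F" "dist (\<Sum>k\<in>F. (cmod (\<psi> k))\<^sup>2) ((norm2 \<psi>)\<^sup>2) \<le> e"
        using has_sum_finite_approximation[OF norm2_has_sum[OF psi_mem]] by blast
      then show "measure \<mu> N \<le> 0 + e"
        using le[OF F(1)] by (simp add: norm2_diff_truncation dist_real_def)
    qed
    then have "emeasure \<mu> N = 0"
      by (simp add: finite_measure.emeasure_eq_measure[OF finite_mu] measure_le_0_iff)
    then show ?thesis by (intro AE_I[where N = N]) (auto simp: N_def)
  qed
  show ?thesis using bdd eq nonzero
  proof eventually_elim
    case (elim w)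
    have "(\<lambda>k. cnj (g k w)) \<noteq> (\<lambda>k. 0)" using elim(3) by (auto simp: fun_eq_iff)
    moreover have "linearly_bounded (\<lambda>k. cnj (g k w))" using elim(1) by (simp add: linearly_bounded_def)
    moreover have "matrix_action (op_matrix U) (\<lambda>k. cnj (g k w)) = (\<lambda>k. w * cnj (g k w))"
      unfolding matrix_action_def using elim(2) by auto
    ultimately show ?case by blast
  qed
qed

text \<open>Used for \<eta> = f(U) \<psi> with h = |f|^2 on the circle: the spectral measure of f(U)
  \<psi> has density |f|^2 with respect to that of \<open>\<psi>\<close>, so it inherits absolute
  continuity.\<close>

lemma spectral_density:
  assumes eta: "\<eta> \<in> ell2" and [measurable]: "h \<in> borel_measurable borel"
    and h: "\<And>w. 0 \<le> h w" "\<And>w. cmod w = 1 \<Longrightarrow> h w \<le> B"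
    and moments: "\<And>n. inner2 \<eta> ((U ^^ n) \<eta>) = (\<integral>w. w ^ n * complex_of_real (h w) \<partial>\<mu>)"
    and ac: "absolutely_continuous arc_length \<mu>"
  shows "\<eta> \<in> ac_subspace U"
proof -
  define \<nu> where "\<nu> = density \<mu> (\<lambda>w. ennreal (h w))"
  have [measurable]: "h \<in> borel_measurable \<mu>" by measurable
  have ac': "absolutely_continuous \<mu> \<nu>"
    unfolding \<nu>_def by (rule absolutely_continuousI_density) measurable
  have "is_spectral_measure U \<eta> \<nu>"
    unfolding is_spectral_measure_def
  proof (intro conjI allI)
    show "sets \<nu> = sets borel" by (simp add: \<nu>_def sets_mu)
    have int: "integrable \<mu> h"
      by (rule integrable_circle[where B = B]) (use h in auto)
    have "emeasure \<nu> (space \<nu>) = (\<integral>\<^sup>+w. ennreal (h w) \<partial>\<mu>)"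
      by (simp add: \<nu>_def emeasure_density cong: nn_integral_cong)
    also have "\<dots> = ennreal (\<integral>w. h w \<partial>\<mu>)" by (rule nn_integral_eq_integral[OF int]) (simp add: h)
    finally show "finite_measure \<nu>" by (intro finite_measureI) simp
    have "- sphere 0 1 \<in> null_sets \<mu>"
      using spectral by (intro null_setsI) (auto simp: is_spectral_measure_def sets_mu)
    then have "- sphere 0 1 \<in> null_sets \<nu>" using ac' by (auto simp: absolutely_continuous_def)
    then show "emeasure \<nu> (- sphere 0 1) = 0" by auto
    fix n
    have "(\<integral>w. w ^ n \<partial>\<nu>) = (\<integral>w. h w *\<^sub>R w ^ n \<partial>\<mu>)"
      unfolding \<nu>_def
      by (rule integral_density) (simp_all add: h measurable_cong_sets[OF sets_mu refl])
    then show "inner2 \<eta> ((U ^^ n) \<eta>) = (\<integral>w. w ^ n \<partial>\<nu>)"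
      by (simp add: moments scaleR_conv_of_real mult.commute)
  qed
  moreover have "absolutely_continuous arc_length \<nu>"
    using ac ac' by (auto simp: absolutely_continuous_def)
  ultimately show ?thesis using eta unfolding ac_subspace_def by blast
qed

lemma shifted_in_ac_subspace:
  assumes "absolutely_continuous arc_length \<mu>"
  shows "(\<lambda>k. U \<psi> k - z * \<psi> k) \<in> ac_subspace U"
proof (rule spectral_density[where h = "\<lambda>w. (cmod (w - z))\<^sup>2" and B = "(1 + cmod z)\<^sup>2", OF _ _ _ _ _ assms])
  have rep: "lrep U \<psi> (\<lambda>k. U \<psi> k - z * \<psi> k) (\<lambda>w. w * 1 - z * 1)"
    by (intro lrep_diff lrep.scale lrep.shift lrep.base)
  show "(\<lambda>k. U \<psi> k - z * \<psi> k) \<in> ell2" by (rule lrep_mem[OF rep])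
  show "(cmod (w - z))\<^sup>2 \<le> (1 + cmod z)\<^sup>2" if "cmod w = 1" for w
    using norm_triangle_ineq4[of w z] that by (intro power_mono) auto
  show "inner2 (\<lambda>k. U \<psi> k - z * \<psi> k) ((U ^^ n) (\<lambda>k. U \<psi> k - z * \<psi> k)) =
      (\<integral>w. w ^ n * complex_of_real ((cmod (w - z))\<^sup>2) \<partial>\<mu>)" for n
    unfolding lrep_inner[OF rep lrep_funpow[OF rep]] complex_norm_square by (simp add: mult_ac)
qed simp_all

text \<open>Under the isometry, \<open>U - z\<close> becomes multiplication by w - z, which has
  modulus at least \<delta> almost everywhere.\<close>

lemma shifted_norm_bound:
  assumes "\<delta> > 0" and away: "AE w in \<mu>. \<delta> \<le> cmod (w - z)"
  shows "norm2 \<psi> \<le> 1 / \<delta> * norm2 (\<lambda>k. U \<psi> k - z * \<psi> k)"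
proof -
  have rep: "lrep U \<psi> (\<lambda>k. U \<psi> k - z * \<psi> k) (\<lambda>w. w * 1 - z * 1)"
    by (intro lrep_diff lrep.scale lrep.shift lrep.base)
  have "\<delta>\<^sup>2 * (norm2 \<psi>)\<^sup>2 = (\<integral>w. \<delta>\<^sup>2 * (cmod 1)\<^sup>2 \<partial>\<mu>)"
    by (subst lrep_norm[OF lrep.base]) simp
  also have "\<dots> \<le> (\<integral>w. (cmod (w * 1 - z * 1))\<^sup>2 \<partial>\<mu>)"
  proof (rule integral_mono_AE)
    show "AE w in \<mu>. \<delta>\<^sup>2 * (cmod 1)\<^sup>2 \<le> (cmod (w * 1 - z * 1))\<^sup>2"
      using away by eventually_elim (use \<open>\<delta> > 0\<close> in \<open>simp add: power_mono\<close>)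
  qed (intro integrable_mult_right L2_integrable lrep_L2[OF rep] lrep_L2[OF lrep.base])+
  also have "\<dots> = (norm2 (\<lambda>k. U \<psi> k - z * \<psi> k))\<^sup>2" by (rule lrep_norm[OF rep, symmetric])
  finally have "(\<delta> * norm2 \<psi>)\<^sup>2 \<le> (norm2 (\<lambda>k. U \<psi> k - z * \<psi> k))\<^sup>2" by (simp add: power_mult_distrib)
  then have "\<delta> * norm2 \<psi> \<le> norm2 (\<lambda>k. U \<psi> k - z * \<psi> k)" by (rule power2_le_imp_le) simp
  then show ?thesis using \<open>\<delta> > 0\<close> by (simp add: field_simps)
qed

end

section \<open>The absolutely continuous spectrum\<close>

context cyclic_subspace begin

text \<open>The solution is f(U) \<psi> for a continuous f that inverts w - z almost everywhere. It
  is built as the limit of p(U) \<psi> for Laurent polynomials p that converge to f uniformly on the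
  circle, and its membership in \<open>ac_subspace U\<close> follows from
  \<open>spectral_density\<close> with |f|^2.\<close>

lemma resolvent_in_ac_subspace:
  assumes "\<delta> > 0" and away: "AE w in \<mu>. \<delta> \<le> cmod (w - z)"
    and ac: "absolutely_continuous arc_length \<mu>"
  shows "\<exists>\<zeta>\<in>ac_subspace U. (\<lambda>k. U \<zeta> k - z * \<zeta> k) = \<psi>"
proof -
  define K where "K = measure \<mu> (space \<mu>)"
  have "K \<ge> 0" by (simp add: K_def)
  \<comment> \<open>A continuous function that agrees with \<open>1 / (w - z)\<close> \<open>\<mu>\<close>-almost everywhere.\<close>
  define f where "f w = cnj (w - z) / complex_of_real (max (\<delta>\<^sup>2) ((cmod (w - z))\<^sup>2))" for w
  have max_pos: "max (\<delta>\<^sup>2) x > 0" for x using \<open>\<delta> > 0\<close> by (simp add: less_max_iff_disj)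
  have cont: "continuous_on A f" for A
    unfolding f_def using max_pos by (intro continuous_intros) (metis less_irrefl of_real_eq_0_iff)
  have inverse: "AE w in \<mu>. (w - z) * f w = 1"
    using away
  proof eventually_elim
    case (elim w)
    then have "max (\<delta>\<^sup>2) ((cmod (w - z))\<^sup>2) = (cmod (w - z))\<^sup>2" "w - z \<noteq> 0"
      using \<open>\<delta> > 0\<close> by (auto simp: power_mono)
    then show ?case unfolding f_def
      by (simp add: complex_norm_square del: complex_cnj_diff of_real_power)
  qed
  have "\<exists>\<eta> p. lrep U \<psi> \<eta> p \<and> (\<forall>w\<in>sphere 0 1. cmod (f w - p w) < 1 / real (Suc m))" for m
    by (rule lrep_dense[OF cont]) simp
  then obtain \<eta> p where lrep: "\<And>m. lrep U \<psi> (\<eta> m) (p m)"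
    and close': "\<And>m w. w \<in> sphere 0 1 \<Longrightarrow> cmod (f w - p m w) < 1 / real (Suc m)"
    by metis
  have close: "cmod (f w - p m w) \<le> 1 / real (Suc m)" if "cmod w = 1" for m w
    using close'[of w m] that by simp
  note mem = lrep_mem[OF lrep]
  \<comment> \<open>Uniform bounds on the circle become norm bounds, at the price of the square root
    of the total mass K.\<close>
  have bound: "norm2 \<xi> \<le> sqrt K * B" if "lrep U \<psi> \<xi> q" "B \<ge> 0" "AE w in \<mu>. cmod (q w) \<le> B" for \<xi> q B
  proof -
    have "(norm2 \<xi>)\<^sup>2 \<le> (\<integral>w. B\<^sup>2 \<partial>\<mu>)"
      unfolding lrep_norm[OF that(1)]
    proof (rule integral_mono_AE)
      show "AE w in \<mu>. (cmod (q w))\<^sup>2 \<le> B\<^sup>2" using that(3) by eventually_elim (simp add: power_mono)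
      show "integrable \<mu> (\<lambda>w. B\<^sup>2)" by (rule integrable_circle[where B = "B\<^sup>2"]) auto
    qed (rule L2_integrable[OF lrep_L2[OF that(1)]])
    also have "\<dots> = (sqrt K * B)\<^sup>2" using \<open>K \<ge> 0\<close> by (simp add: K_def power_mult_distrib)
    finally show ?thesis by (rule power2_le_imp_le) (use \<open>K \<ge> 0\<close> that in simp)
  qed
  have null: "(\<lambda>m. c * (1 / real (Suc m))) \<longlonglongrightarrow> 0" for c
    using tendsto_mult[OF tendsto_const[of c] LIMSEQ_inverse_real_of_nat] by (simp add: inverse_eq_divide)
  have "\<exists>\<zeta>\<in>ell2. (\<lambda>m. norm2 (\<lambda>k. \<zeta> k - \<eta> m k)) \<longlonglongrightarrow> 0"
  proof (rule ell2_complete[OF mem])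
    fix e :: real assume "e > 0"
    then have "\<forall>\<^sub>F m in sequentially. sqrt K * 2 * (1 / real (Suc m)) < e"
      using order_tendstoD(2)[OF null[of "sqrt K * 2"]] by simp
    then obtain N where N: "sqrt K * 2 * (1 / real (Suc N)) < e"
      by (auto simp: eventually_sequentially)
    have "norm2 (\<lambda>k. \<eta> m k - \<eta> n k) \<le> e" if "m \<ge> N" "n \<ge> N" for m n
    proof -
      have "norm2 (\<lambda>k. \<eta> m k - \<eta> n k) \<le> sqrt K * (2 * (1 / real (Suc N)))"
      proof (rule bound[OF lrep_diff[OF lrep lrep]])
        show "AE w in \<mu>. cmod (p m w - p n w) \<le> 2 * (1 / real (Suc N))"
          using AE_circle
        proof eventually_elim
          case (elim w)
          have "cmod (p m w - p n w) \<le> cmod (f w - p n w) + cmod (f w - p m w)"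
            using norm_triangle_ineq4[of "f w - p n w" "f w - p m w"] by simp
          also have "\<dots> \<le> 1 / real (Suc n) + 1 / real (Suc m)" by (intro add_mono close elim)
          also have "\<dots> \<le> 1 / real (Suc N) + 1 / real (Suc N)"
            using that by (intro add_mono divide_left_mono) auto
          finally show ?case by simp
        qed
      qed simp
      then show ?thesis using N by simp
    qed
    then show "\<exists>N. \<forall>m\<ge>N. \<forall>n\<ge>N. norm2 (\<lambda>k. \<eta> m k - \<eta> n k) \<le> e" by blast
  qed
  then obtain \<zeta> where \<zeta>: "\<zeta> \<in> ell2" and lim: "(\<lambda>m. norm2 (\<lambda>k. \<zeta> k - \<eta> m k)) \<longlonglongrightarrow> 0" by blast
  have "norm2 (\<lambda>k. (U \<zeta> k - z * \<zeta> k) - \<psi> k) \<le> 0"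
  proof (rule LIMSEQ_le_const)
    define d where "d m = norm2 (\<lambda>k. \<zeta> k - \<eta> m k)" for m
    show "(\<lambda>m. (1 + cmod z) * d m + sqrt K * (1 + cmod z) * (1 / real (Suc m))) \<longlonglongrightarrow> 0"
      using tendsto_add[OF tendsto_mult[OF tendsto_const[of "1 + cmod z"] lim] null[of "sqrt K * (1 + cmod z)"]]
      by (simp add: d_def)
    have "norm2 (\<lambda>k. (U \<zeta> k - z * \<zeta> k) - \<psi> k) \<le> (1 + cmod z) * d m + sqrt K * (1 + cmod z) * (1 / real (Suc m))" for m
    proof -
      define x where "x = (\<lambda>k. \<zeta> k - \<eta> m k)"
      \<comment> \<open>The defect of the m-th approximant. It is represented by (w - z) p m w - 1,
        which equals (w - z)(p m w - f w) almost everywhere and is therefore small.\<close>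
      define y where "y = (\<lambda>k. (U (\<eta> m) k - z * \<eta> m k) - \<psi> k)"
      have x: "x \<in> ell2" unfolding x_def using \<zeta> mem by (rule ell2_diff)
      have rep: "lrep U \<psi> y (\<lambda>w. (w * p m w - z * p m w) - 1)"
        unfolding y_def by (intro lrep_diff lrep.scale lrep.shift lrep lrep.base)
      have Ux: "U x = (\<lambda>k. U \<zeta> k - U (\<eta> m) k)" unfolding x_def using \<zeta> mem by (rule U_diff)
      have split: "(\<lambda>k. (U \<zeta> k - z * \<zeta> k) - \<psi> k) = (\<lambda>k. (U x k + - z * x k) + y k)"
        unfolding Ux y_def by (simp add: x_def algebra_simps)
      have "norm2 (\<lambda>k. (U \<zeta> k - z * \<zeta> k) - \<psi> k) \<le> (norm2 (U x) + norm2 (\<lambda>k. - z * x k)) + norm2 y"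
        unfolding split using norm2_triangle[OF ell2_add[OF U_mem[OF x] ell2_scale[OF x, of "- z"]] lrep_mem[OF rep]]
          norm2_triangle[OF U_mem[OF x] ell2_scale[OF x, of "- z"]] by linarith
      also have "\<dots> = (1 + cmod z) * d m + norm2 y"
        unfolding norm2_scale U_norm[OF x] by (simp add: d_def x_def algebra_simps)
      also have "norm2 y \<le> sqrt K * ((1 + cmod z) * (1 / real (Suc m)))"
      proof (rule bound[OF rep])
        show "AE w in \<mu>. cmod ((w * p m w - z * p m w) - 1) \<le> (1 + cmod z) * (1 / real (Suc m))"
          using AE_circle inverse
        proof eventually_elim
          case (elim w)
          have "(w * p m w - z * p m w) - 1 = (w * p m w - z * p m w) - (w - z) * f w"
            using elim(2) by simp
          also have "\<dots> = (w - z) * (p m w - f w)" by (simp add: algebra_simps)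
          also have "cmod \<dots> \<le> (1 + cmod z) * (1 / real (Suc m))"
            unfolding norm_mult using norm_triangle_ineq4[of w z] close[OF elim(1), of m] elim(1)
            by (intro mult_mono) (auto simp: norm_minus_commute)
          finally show ?case .
        qed
      qed simp
      finally show ?thesis by (simp add: mult.assoc)
    qed
    then show "\<exists>N. \<forall>m\<ge>N. norm2 (\<lambda>k. (U \<zeta> k - z * \<zeta> k) - \<psi> k) \<le>
       (1 + cmod z) * d m + sqrt K * (1 + cmod z) * (1 / real (Suc m))" by blast
  qed
  then have "norm2 (\<lambda>k. (U \<zeta> k - z * \<zeta> k) - \<psi> k) = 0"
    by (rule antisym) (rule norm2_nonneg)
  moreover have "(\<lambda>k. (U \<zeta> k - z * \<zeta> k) - \<psi> k) \<in> ell2"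
    using \<zeta> by (intro ell2_diff ell2_scale U_mem psi_mem)
  ultimately have zero: "(\<lambda>k. (U \<zeta> k - z * \<zeta> k) - \<psi> k) = (\<lambda>k. 0)"
    by (intro norm2_eq_0D)
  have eq: "(\<lambda>k. U \<zeta> k - z * \<zeta> k) = \<psi>"
    by (rule ext) (use fun_cong[OF zero] in \<open>simp only: right_minus_eq\<close>)
  obtain B where B: "\<And>w. cmod w = 1 \<Longrightarrow> cmod (f w) \<le> B" using bounded_circle[OF cont] by blast
  then have "B \<ge> 0" using norm_ge_zero order_trans by (metis norm_one)
  have f_meas [measurable]: "f \<in> borel_measurable borel" by (rule borel_measurable_continuous_onI[OF cont])
  have "\<zeta> \<in> ac_subspace U"
  proof (rule spectral_density[OF \<zeta>, where h = "\<lambda>w. (cmod (f w))\<^sup>2" and B = "B\<^sup>2"])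
    fix n
    have Un: "(U ^^ n) (\<lambda>k. \<phi> k - \<xi> k) = (\<lambda>k. (U ^^ n) \<phi> k - (U ^^ n) \<xi> k)"
      if "\<phi> \<in> ell2" "\<xi> \<in> ell2" for \<phi> \<xi>
      using that by (induction n) (simp_all add: U_diff)
    have Unorm: "norm2 ((U ^^ n) \<phi>) = norm2 \<phi>" if "\<phi> \<in> ell2" for \<phi>
      using that by (induction n) (simp_all add: U_norm)
    have "norm2 (\<lambda>k. (U ^^ n) \<zeta> k - (U ^^ n) (\<eta> m) k) = norm2 (\<lambda>k. \<zeta> k - \<eta> m k)" for m
      using Unorm[OF ell2_diff[OF \<zeta> mem[of m]]] Un[OF \<zeta> mem[of m]] by simp
    then have "(\<lambda>m. inner2 (\<eta> m) ((U ^^ n) (\<eta> m))) \<longlonglongrightarrow> inner2 \<zeta> ((U ^^ n) \<zeta>)"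
      using lim \<zeta> mem by (intro inner2_tendsto) simp_all
    \<comment> \<open>\<open>\<zeta>\<close> itself is only a limit of represented vectors, so its
      moments are computed as limits. The majorant works because |p m| \<le> |f| + 1 \<le> B + 1 on
      the circle.\<close>
    moreover have "(\<lambda>m. inner2 (\<eta> m) ((U ^^ n) (\<eta> m))) \<longlonglongrightarrow> (\<integral>w. w ^ n * complex_of_real ((cmod (f w))\<^sup>2) \<partial>\<mu>)"
      unfolding lrep_inner[OF lrep lrep_funpow[OF lrep]]
    proof (rule integral_dominated_convergence[where w = "\<lambda>w. (B + 1)\<^sup>2"])
      note [measurable] = borel_measurable_continuous_onI[OF lrep_continuous[OF lrep]]
      have [measurable]: "cnj \<in> borel_measurable borel"
        by (intro borel_measurable_continuous_onI continuous_intros)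
      show "(\<lambda>w. w ^ n * complex_of_real ((cmod (f w))\<^sup>2)) \<in> borel_measurable \<mu>"
        "(\<lambda>w. cnj (p m w) * (w ^ n * p m w)) \<in> borel_measurable \<mu>" for m
        by measurable
      show "integrable \<mu> (\<lambda>w. (B + 1)\<^sup>2)" by (rule integrable_circle[where B = "(B + 1)\<^sup>2"]) auto
      show "AE w in \<mu>. (\<lambda>m. cnj (p m w) * (w ^ n * p m w)) \<longlonglongrightarrow> w ^ n * complex_of_real ((cmod (f w))\<^sup>2)"
        using AE_circle
      proof eventually_elim
        case (elim w)
        have "(\<lambda>m. p m w - f w) \<longlonglongrightarrow> 0"
          by (rule Lim_null_comparison[OF _ null[of 1]])
             (use close[OF elim] in \<open>simp add: norm_minus_commute\<close>)
        then have "(\<lambda>m. p m w) \<longlonglongrightarrow> f w" by (rule LIM_zero_cancel)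
        then have "(\<lambda>m. cnj (p m w) * (w ^ n * p m w)) \<longlonglongrightarrow> cnj (f w) * (w ^ n * f w)"
          by (intro tendsto_mult tendsto_cnj tendsto_const)
        then show ?case unfolding complex_norm_square by (simp add: mult_ac)
      qed
      show "AE w in \<mu>. cmod (cnj (p m w) * (w ^ n * p m w)) \<le> (B + 1)\<^sup>2" for m
        using AE_circle
      proof eventually_elim
        case (elim w)
        have "1 / real (Suc m) \<le> 1" by simp
        moreover have "cmod (p m w) \<le> cmod (f w) + cmod (f w - p m w)"
          using norm_triangle_ineq4[of "f w" "f w - p m w"] by simp
        ultimately have "cmod (p m w) \<le> B + 1"
          using close[OF elim, of m] B[OF elim] by linarith
        then have "cmod (p m w) * cmod (p m w) \<le> (B + 1) * (B + 1)"
          using \<open>B \<ge> 0\<close> by (intro mult_mono) auto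
        then show ?case by (simp add: norm_mult norm_power elim power2_eq_square)
      qed
    qed
    ultimately show "inner2 \<zeta> ((U ^^ n) \<zeta>) = (\<integral>w. w ^ n * complex_of_real ((cmod (f w))\<^sup>2) \<partial>\<mu>)"
      by (rule LIMSEQ_unique)
  qed (auto intro: power_mono B ac)
  with eq show ?thesis by blast
qed

end

text \<open>A Borel inverse of \<open>cis\<close> on [0, 2 pi). Clamping the argument keeps
  \<open>arccos\<close> on its domain, so the formula is Borel on the whole plane.\<close>

definition circle_angle :: "complex \<Rightarrow> real" where
  "circle_angle w = (let a = arccos (max (-1) (min 1 (Re w))) in if Im w \<ge> 0 then a else 2 * pi - a)"

lemma circle_angle_measurable [measurable]: "circle_angle \<in> borel_measurable borel"
proof -
  have [measurable]: "(\<lambda>w. arccos (max (-1) (min 1 (Re w)))) \<in> borel_measurable borel"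
    by (intro borel_measurable_continuous_onI continuous_intros) auto
  show ?thesis unfolding circle_angle_def[abs_def] Let_def by measurable
qed

lemma circle_angle_cis:
  assumes "0 \<le> \<theta>" "\<theta> < 2 * pi"
  shows "circle_angle (cis \<theta>) = \<theta>"
proof (cases "\<theta> \<le> pi")
  case True
  then have "sin \<theta> \<ge> 0" using assms by (intro sin_ge_zero) auto
  then show ?thesis using True assms by (simp add: circle_angle_def arccos_cos)
next
  case False
  then have "sin \<theta> < 0" using assms by (intro sin_lt_zero) auto
  moreover have "arccos (cos \<theta>) = 2 * pi - \<theta>"
    using arccos_cos[of "2 * pi - \<theta>"] False assms by (simp add: cos_diff)
  ultimately show ?thesis by (simp add: circle_angle_def)
qed

text \<open>\<open>P\<close> need not be measurable (in the application it quantifies over all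
  sequences), so the argument passes through a Borel null set that contains the exceptions.\<close>

lemma AE_arc_length:
  assumes "AE \<theta> in lborel. P \<theta>"
  shows "AE w in arc_length. P (circle_angle w)"
proof -
  obtain N where N: "{\<theta> \<in> space lborel. \<not> P \<theta>} \<subseteq> N" "N \<in> null_sets lborel"
    using assms unfolding eventually_ae_filter by blast
  then have [measurable]: "N \<in> sets borel" by auto
  have "AE \<theta> in lborel. \<theta> \<notin> N" using N(2) by (rule AE_not_in)
  then have "AE \<theta> in lborel. \<theta> \<in> {0..<2 * pi} \<longrightarrow> circle_angle (cis \<theta>) \<notin> N"
    by eventually_elim (simp add: circle_angle_cis)
  then have *: "AE \<theta> in restrict_space lborel {0..<2 * pi}. circle_angle (cis \<theta>) \<notin> N"
    by (subst AE_restrict_space_iff) auto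
  have [measurable]: "cis \<in> borel_measurable borel"
    by (intro borel_measurable_continuous_onI continuous_intros)
  have "AE w in arc_length. circle_angle w \<notin> N"
    unfolding arc_length_def
  proof (subst AE_distr_iff)
    show "cis \<in> restrict_space lborel {0..<2 * pi} \<rightarrow>\<^sub>M borel"
      by (rule measurable_restrict_space1) simp
    show "{w \<in> space borel. circle_angle w \<notin> N} \<in> sets borel" by measurable
  qed (rule *)
  then show ?thesis by eventually_elim (use N(1) in auto)
qed

text \<open>For z outside \<open>C\<close>, a ball of radius \<delta> around z avoids
  \<open>C\<close>. Absolute continuity turns the Lebesgue null set of exceptional angles into a
  null set of every spectral measure in question; outside it, points off \<open>C\<close> admit no
  eigenvector of the kind that \<open>AE_generalized_eigenvector\<close> supplies. So these measures
  live at distance at least \<delta> from z.\<close>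

theorem ac_spectrum_subset:
  assumes "unitary2 U" and band: "has_band_structure U" and "closed C"
    and no: "AE \<theta> in lborel. cis \<theta> \<notin> C \<longrightarrow>
      (\<forall>c. generalized_eigenvector U \<theta> c \<longrightarrow> linearly_bounded c \<longrightarrow> c = (\<lambda>k. 0))"
  shows "ac_spectrum U \<subseteq> C"
proof
  fix z assume z: "z \<in> ac_spectrum U"
  interpret unitary_seq U by unfold_locales fact
  show "z \<in> C"
  proof (rule ccontr)
    assume "z \<notin> C"
    with \<open>closed C\<close> have "open (- C)" "z \<in> - C" by auto
    then obtain \<delta> where "\<delta> > 0" and ball: "ball z \<delta> \<subseteq> - C" by (auto simp: open_contains_ball)
    have cyc: "\<exists>\<mu>. cyclic_subspace U \<phi> \<mu> \<and> absolutely_continuous arc_length \<mu> \<and>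
        (AE w in \<mu>. \<delta> \<le> cmod (w - z))" if "\<phi> \<in> ac_subspace U" for \<phi>
    proof -
      from that obtain \<mu> where "\<phi> \<in> ell2" "is_spectral_measure U \<phi> \<mu>"
        and ac: "absolutely_continuous arc_length \<mu>" by (auto simp: ac_subspace_def)
      then interpret cyclic_subspace U \<phi> \<mu> by unfold_locales
      have "AE w in \<mu>. cis (circle_angle w) \<notin> C \<longrightarrow>
          (\<forall>c. generalized_eigenvector U (circle_angle w) c \<longrightarrow> linearly_bounded c \<longrightarrow> c = (\<lambda>k. 0))"
        by (rule absolutely_continuous_AE[OF _ ac AE_arc_length[OF no]])
           (simp add: sets_mu arc_length_def)
      with AE_circle AE_generalized_eigenvector[OF band] have "AE w in \<mu>. \<delta> \<le> cmod (w - z)"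
      proof eventually_elim
        case (elim w)
        obtain \<theta> where \<theta>: "0 \<le> \<theta>" "\<theta> < 2 * pi" "w = cis \<theta>"
          using Arg2pi_ge_0 Arg2pi_lt_2pi Arg2pi_eq[of w] elim(1)
          by (metis cis_conv_exp mult.left_neutral norm_eq_zero norm_one of_real_1 zero_neq_one)
        then have "w \<in> C"
          using elim(2,3) circle_angle_cis[OF \<theta>(1,2)] unfolding generalized_eigenvector_def by metis
        then have "w \<notin> ball z \<delta>" using ball by auto
        then show ?case by (simp add: dist_norm norm_minus_commute)
      qed
      then show ?thesis using ac cyclic_subspace_axioms by blast
    qed
    let ?A = "\<lambda>\<phi> k. U \<phi> k - z * \<phi> k"
    have mem: "\<phi> \<in> ell2" if "\<phi> \<in> ac_subspace U" for \<phi>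
      using that by (simp add: ac_subspace_def)
    have maps: "?A \<phi> \<in> ac_subspace U" if "\<phi> \<in> ac_subspace U" for \<phi>
      using cyc[OF that] cyclic_subspace.shifted_in_ac_subspace by blast
    have surj: "\<exists>\<zeta>\<in>ac_subspace U. ?A \<zeta> = \<phi>" if "\<phi> \<in> ac_subspace U" for \<phi>
      using cyc[OF that] cyclic_subspace.resolvent_in_ac_subspace[OF _ \<open>\<delta> > 0\<close>] by blast
    have bounded: "norm2 \<phi> \<le> 1 / \<delta> * norm2 (?A \<phi>)" if "\<phi> \<in> ac_subspace U" for \<phi>
      using cyc[OF that] cyclic_subspace.shifted_norm_bound[OF _ \<open>\<delta> > 0\<close>] by blast
    \<comment> \<open>\<open>ac_subspace U\<close> is not known to be a subspace here; the difference of two elements with equal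
      image is an eigenvector, hence orthogonal to the range of \<open>U - z\<close>, which contains both.\<close>
    have inj: "\<phi> = \<phi>'" if \<phi>: "\<phi> \<in> ac_subspace U" "\<phi>' \<in> ac_subspace U" and eq: "?A \<phi> = ?A \<phi>'" for \<phi> \<phi>'
    proof -
      define x where "x = (\<lambda>k. \<phi> k - \<phi>' k)"
      have x: "x \<in> ell2" unfolding x_def using \<phi> mem by (intro ell2_diff) auto
      have Ux: "U x = (\<lambda>k. z * x k)"
      proof
        fix k
        have "U x k = U \<phi> k - U \<phi>' k" unfolding x_def using \<phi> mem by (simp add: U_diff)
        also have "\<dots> = z * (\<phi> k - \<phi>' k)" using fun_cong[OF eq, of k] by (simp add: algebra_simps)
        finally show "U x k = z * x k" by (simp add: x_def)
      qed
      have "norm2 x = cmod z * norm2 x" using U_norm[OF x] by (simp add: Ux norm2_scale)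
      moreover have "inner2 x \<rho> = 0" if norm: "cmod z = 1" and \<rho>: "\<rho> \<in> ac_subspace U" for \<rho>
      proof -
        obtain \<zeta> where \<zeta>: "\<zeta> \<in> ac_subspace U" "?A \<zeta> = \<rho>" using surj[OF \<rho>] by blast
        have zz: "z * cnj z = 1" using complex_norm_square[of z] norm by simp
        have "inner2 x \<zeta> = cnj z * inner2 x (U \<zeta>)"
          using U_inner[OF x mem[OF \<zeta>(1)]] mem[OF \<zeta>(1)] x by (simp add: Ux inner2_scale_left)
        then have "z * inner2 x \<zeta> = inner2 x (U \<zeta>)" using zz by (simp add: mult.assoc[symmetric])
        then show ?thesis
          unfolding \<zeta>(2)[symmetric] using x mem[OF \<zeta>(1)]
          by (simp add: inner2_diff_right inner2_scale_right ell2_scale)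
      qed
      ultimately have "norm2 x = 0"
      proof (cases "cmod z = 1")
        case True
        then have "inner2 x x = 0"
          using \<phi> mem x \<open>\<And>\<rho>. cmod z = 1 \<Longrightarrow> \<rho> \<in> ac_subspace U \<Longrightarrow> inner2 x \<rho> = 0\<close>
          by (subst (2) x_def) (simp add: inner2_diff_right)
        then show ?thesis using inner2_self[OF x] by simp
      qed auto
      then have "x = (\<lambda>k. 0)" using x by (intro norm2_eq_0D)
      from fun_cong[OF this] show ?thesis unfolding x_def by (simp add: fun_eq_iff)
    qed
    have "bij_betw ?A (ac_subspace U) (ac_subspace U)"
      unfolding bij_betw_def
    proof
      show "inj_on ?A (ac_subspace U)" using inj by (intro inj_onI) auto
      show "?A ` ac_subspace U = ac_subspace U" using maps surj by (fastforce simp: image_iff)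
    qed
    with bounded z show False unfolding ac_spectrum_def spectrum_on_def by blast
  qed
qed

section \<open>Growth of transfer matrices\<close>

lemma norm_matrix_power2:
  fixes A :: "complex^2^2"
  shows "(norm A)\<^sup>2 = (cmod (A $ 1 $ 1))\<^sup>2 + (cmod (A $ 1 $ 2))\<^sup>2 + (cmod (A $ 2 $ 1))\<^sup>2 + (cmod (A $ 2 $ 2))\<^sup>2"
  by (simp add: norm_vec_def L2_set_def sum_2 sum_nonneg)

text \<open>The type's \<open>norm\<close> is the Frobenius norm. Through this identity the growth
  of \<Phi>(n) is read off the trace of a power of \<open>R n\<close>.\<close>

lemma trace_conj_transpose_mult: "trace (conj_transpose A ** A) = complex_of_real ((norm A)\<^sup>2)"
  unfolding norm_matrix_power2
  by (simp add: trace_def conj_transpose_def matrix_matrix_mult_def sum_2 complex_norm_square mult.commute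
      del: of_real_power)

lemma matrix_power_0 [simp]: "matrix_power A 0 = mat 1"
  by (simp add: matrix_power_def)

lemma matrix_power_Suc: "matrix_power A (Suc n) = A ** matrix_power A n"
  by (simp add: matrix_power_def)

lemma det_matrix_power: "det (matrix_power A n) = det A ^ n"
  by (induction n) (simp_all add: matrix_power_Suc det_mul det_I)

lemma det_conj_transpose: "det (conj_transpose A) = cnj (det A)"
  by (simp add: det_2 conj_transpose_def)

text \<open>Cayley-Hamilton, multiplied by X and traced; it yields a two-term recurrence for traces
  of powers.\<close>

lemma trace_Cayley_Hamilton:
  fixes A X :: "complex^2^2"
  shows "trace (A ** (A ** X)) = trace A * trace (A ** X) - det A * trace X"
  by (simp add: trace_def matrix_matrix_mult_def sum_2 det_2 algebra_simps)

lemma cosh_recurrence: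
  "2 * cosh (real (Suc (Suc k)) * s) = 2 * cosh s * (2 * cosh (real (Suc k) * s)) - 2 * cosh (real k * s)"
proof -
  have "cosh (real (Suc k) * s + s) + cosh (real (Suc k) * s - s) = 2 * cosh (real (Suc k) * s) * cosh s"
    by (simp add: cosh_add cosh_diff)
  moreover have "real (Suc k) * s + s = real (Suc (Suc k)) * s" "real (Suc k) * s - s = real k * s"
    by (simp_all add: algebra_simps)
  ultimately show ?thesis by (simp add: mult.commute del: of_nat_Suc)
qed

text \<open>The eigenvalues are exp s and exp (-s). Both sides obey the same recurrence with the
  same first two terms, which replaces a diagonalization.\<close>

lemma trace_matrix_power:
  assumes "det A = 1" "trace A = complex_of_real (2 * cosh s)"
  shows "trace (matrix_power A k) = complex_of_real (2 * cosh (real k * s))"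
proof (induction k rule: induct_nat_012)
  case 0
  show ?case by (simp add: trace_def sum_2 mat_def)
next
  case 1
  show ?case using assms(2) by (simp add: matrix_power_Suc)
next
  case (ge2 k)
  have "trace (matrix_power A (Suc (Suc k))) =
      complex_of_real (2 * cosh s * (2 * cosh (real (Suc k) * s)) - 2 * cosh (real k * s))"
    unfolding matrix_power_Suc trace_Cayley_Hamilton using ge2 assms
    by (simp add: matrix_power_Suc del: of_nat_Suc)
  then show ?case by (simp only: cosh_recurrence)
qed

lemma eigenvalue_char_poly:
  assumes "x \<in> eigenvalues A"
  shows "x\<^sup>2 - trace A * x + det A = 0"
proof -
  obtain v where v: "v \<noteq> 0" "A *v v = x *s v" using assms by (auto simp: eigenvalues_def)
  have e1: "A $ 1 $ 1 * v $ 1 + A $ 1 $ 2 * v $ 2 = x * v $ 1"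
    and e2: "A $ 2 $ 1 * v $ 1 + A $ 2 $ 2 * v $ 2 = x * v $ 2"
    using arg_cong[OF v(2), of "\<lambda>w. w $ 1"] arg_cong[OF v(2), of "\<lambda>w. w $ 2"]
    by (simp_all add: matrix_vector_mult_def sum_2)
  have "(x\<^sup>2 - trace A * x + det A) * v $ 1 = 0" "(x\<^sup>2 - trace A * x + det A) * v $ 2 = 0"
    unfolding trace_def sum_2 det_2 using e1 e2 by algebra+
  moreover have "v $ 1 \<noteq> 0 \<or> v $ 2 \<noteq> 0" using v(1) by (auto simp: vec_eq_iff forall_2)
  ultimately show ?thesis by auto
qed

text \<open>With tr (R n) = 2 cosh (s n) the squared norm is exactly 2 cosh (2 n s n), and s n tends
  to \<gamma>. The constants are 2 (1 - 1/10) and 2 (1 + 1/10); the tolerance is small enough for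
  the lower rate at length 2n, 36/10, to beat the upper rate 22/10 at length n.\<close>

lemma lyapunov_growth:
  assumes lyap: "lyapunov_exponents \<Phi> \<gamma> (- \<gamma>)" and "\<gamma> > 0" and det: "\<And>n. cmod (det (\<Phi> n)) = 1"
  shows "\<forall>\<^sub>F n in sequentially. exp (18/10 * \<gamma> * real n) \<le> (norm (\<Phi> n))\<^sup>2 \<and>
     (norm (\<Phi> n))\<^sup>2 \<le> 2 * exp (22/10 * \<gamma> * real n)"
proof -
  obtain R L where psd: "\<And>n. n \<ge> 1 \<Longrightarrow> positive_semidefinite (R n)"
    and root: "\<And>n. n \<ge> 1 \<Longrightarrow> matrix_power (R n) (2 * n) = conj_transpose (\<Phi> n) ** \<Phi> n"
    and lim: "R \<longlonglongrightarrow> L"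
    and ev: "eigenvalues L = {complex_of_real (exp \<gamma>), complex_of_real (exp (- \<gamma>))}"
    using lyap unfolding lyapunov_exponents_def by blast
  define a b where "a = complex_of_real (exp \<gamma>)" and "b = complex_of_real (exp (- \<gamma>))"
  have "a \<noteq> b" using \<open>\<gamma> > 0\<close> by (simp add: a_def b_def)
  have ab: "a * b = 1" by (simp add: a_def b_def flip: of_real_mult exp_add)
  have pa: "a\<^sup>2 - trace L * a + det L = 0" and pb: "b\<^sup>2 - trace L * b + det L = 0"
    using ev by (auto intro!: eigenvalue_char_poly simp: a_def b_def)
  \<comment> \<open>Subtracting the two characteristic equations; as a and b differ, which uses
    \<gamma> > 0, the trace is their sum.\<close>
  have "(a - b) * (a + b - trace L) = 0" using pa pb by algebra
  then have trL: "trace L = a + b" using \<open>a \<noteq> b\<close> by auto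
  then have detL: "det L = 1" using pa ab by algebra
  have nth: "(\<lambda>n. R n $ i $ j) \<longlonglongrightarrow> L $ i $ j" for i j
    by (intro tendsto_vec_nth lim)
  have "(\<lambda>n. Re (trace (R n))) \<longlonglongrightarrow> Re (trace L)"
    unfolding trace_def sum_2 by (intro tendsto_intros nth)
  moreover have "Re (trace L) = 2 * cosh \<gamma>"
    by (simp add: trL a_def b_def cosh_field_def)
  ultimately have lim_tr: "(\<lambda>n. Re (trace (R n)) / 2) \<longlonglongrightarrow> cosh \<gamma>"
    using tendsto_divide[of "\<lambda>n. Re (trace (R n))" "2 * cosh \<gamma>" sequentially "\<lambda>_. 2" 2] by simp
  have lim_det: "(\<lambda>n. Re (det (R n))) \<longlonglongrightarrow> 1"
  proof -
    have "(\<lambda>n. det (R n)) \<longlonglongrightarrow> det L"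
      unfolding det_2 by (intro tendsto_intros nth)
    from tendsto_Re[OF this] show ?thesis by (simp only: detL one_complex.sel)
  qed
  have "cosh \<gamma> > 1" using \<open>\<gamma> > 0\<close> cosh_real_strict_mono[of 0 \<gamma>] by simp
  \<comment> \<open>Only arguments above 1 are meaningful for \<open>arcosh\<close>;
    \<open>e3\<close> guarantees them for large n.\<close>
  define s where "s n = arcosh (Re (trace (R n)) / 2)" for n
  have "(\<lambda>n. s n) \<longlonglongrightarrow> arcosh (cosh \<gamma>)"
    unfolding s_def using \<open>cosh \<gamma> > 1\<close> by (intro tendsto_arcosh lim_tr)
  then have lim_s: "s \<longlonglongrightarrow> \<gamma>" using \<open>\<gamma> > 0\<close> by (simp add: arcosh_cosh_real)
  have e1: "\<forall>\<^sub>F n in sequentially. 9/10 * \<gamma> < s n"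
    by (rule order_tendstoD(1)[OF lim_s]) (use \<open>\<gamma> > 0\<close> in simp)
  have e2: "\<forall>\<^sub>F n in sequentially. s n < 11/10 * \<gamma>"
    by (rule order_tendstoD(2)[OF lim_s]) (use \<open>\<gamma> > 0\<close> in simp)
  have e3: "\<forall>\<^sub>F n in sequentially. 1 < Re (trace (R n)) / 2"
    by (rule order_tendstoD(1)[OF lim_tr \<open>cosh \<gamma> > 1\<close>])
  have e4: "\<forall>\<^sub>F n in sequentially. 0 < Re (det (R n))"
    by (rule order_tendstoD(1)[OF lim_det]) simp
  show ?thesis using e1 e2 e3 e4 eventually_ge_at_top[of "1::nat"]
  proof eventually_elim
    case (elim n)
    have herm: "cnj (R n $ j $ i) = R n $ i $ j" for i j
    proof -
      have "conj_transpose (R n) $ i $ j = R n $ i $ j"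
        using psd[OF elim(5)] by (simp only: positive_semidefinite_def)
      then show ?thesis by (simp add: conj_transpose_def)
    qed
    have im: "Im (trace (R n)) = 0" "Im (det (R n)) = 0"
    proof -
      have "cnj (trace (R n)) = trace (R n)" "cnj (det (R n)) = det (R n)"
        by (simp_all add: trace_def sum_2 det_2 herm mult.commute)
      then show "Im (trace (R n)) = 0" "Im (det (R n)) = 0" by (simp_all add: complex_eq_iff)
    qed
    have tr: "trace (R n) = complex_of_real (2 * cosh (s n))"
      using elim(3) im(1) by (simp add: s_def complex_eq_iff)
    \<comment> \<open>The determinant is real because \<open>R n\<close> is Hermitian, and of
      modulus 1 because that of \<Phi>(n) is. Its convergence to 1 leaves only the value 1 for large
      n.\<close>
    have "cmod (det (R n)) ^ (2 * n) = cmod (det (matrix_power (R n) (2 * n)))"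
      by (simp only: det_matrix_power norm_power)
    also have "\<dots> = 1" unfolding root[OF elim(5)] by (simp add: det_mul det_conj_transpose norm_mult det)
    finally have "cmod (det (R n)) ^ (2 * n) = 1" .
    then have "cmod (det (R n)) = 1"
      using power_eq_imp_eq_base[of "cmod (det (R n))" "2 * n" 1] elim(5) by simp
    then have "det (R n) = 1"
      using elim(4) im(2) by (simp add: complex_eq_iff cmod_eq_Re)
    then have "complex_of_real (2 * cosh (real (2 * n) * s n)) = complex_of_real ((norm (\<Phi> n))\<^sup>2)"
      using trace_matrix_power[OF _ tr, of "2 * n"] root[OF elim(5)] trace_conj_transpose_mult by metis
    then have norm: "(norm (\<Phi> n))\<^sup>2 = 2 * cosh (real (2 * n) * s n)" by (simp only: of_real_eq_iff)
    have cosh: "exp y \<le> 2 * cosh y" "y \<ge> 0 \<Longrightarrow> 2 * cosh y \<le> 2 * exp y" for y :: real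
      by (auto simp: cosh_field_def)
    have "exp (18/10 * \<gamma> * real n) \<le> exp (real (2 * n) * s n)"
      using mult_right_mono[of "9/10 * \<gamma>" "s n" "2 * real n"] elim(1) by (simp add: mult_ac)
    moreover have "exp (real (2 * n) * s n) \<le> exp (22/10 * \<gamma> * real n)"
      using mult_right_mono[of "s n" "11/10 * \<gamma>" "2 * real n"] elim(2) by (simp add: mult_ac)
    moreover have "real (2 * n) * s n \<ge> 0" using elim(1) \<open>\<gamma> > 0\<close> by simp
    ultimately show ?case unfolding norm using cosh[of "real (2 * n) * s n"] by linarith
  qed
qed

lemma norm_component_le: "cmod ((A :: complex^2^2) $ i $ j) \<le> norm A"
  by (rule order_trans[OF Finite_Cartesian_Product.norm_nth_le Finite_Cartesian_Product.norm_nth_le])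

lemma norm_vec2_le: "norm (v :: complex^2) \<le> cmod (v $ 1) + cmod (v $ 2)"
  by (simp add: norm_vec_def L2_set_def sum_2 sqrt_sum_squares_le_sum)

text \<open>A vector that stays bounded both under \<open>Y\<close> and under the inverse of \<open>X\<close> prevents the growth of \<open>Y X\<close>.\<close>

lemma norm_product_le:
  fixes X Y :: "complex^2^2" and u v :: "complex^2"
  assumes det: "cmod (det X) = 1" and v: "v = X *v u"
  shows "norm (Y ** X) * norm v \<le> 8 * (norm (Y *v v) * norm X + norm u * norm Y)"
proof -
  define y where "y = Y *v v"
  define B where "B = norm y * norm X + norm u * norm Y"
  have v_eq: "v $ k = X $ k $ 1 * u $ 1 + X $ k $ 2 * u $ 2" for k
    unfolding v by (simp add: matrix_vector_mult_def sum_2)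
  have y_eq: "y $ k = Y $ k $ 1 * v $ 1 + Y $ k $ 2 * v $ 2" for k
    unfolding y_def by (simp add: matrix_vector_mult_def sum_2)
  have nv: "complex_of_real ((norm v)\<^sup>2) = v $ 1 * cnj (v $ 1) + v $ 2 * cnj (v $ 2)"
    by (simp add: norm_vec_def L2_set_def sum_2 sum_nonneg complex_norm_square del: of_real_power)
  have comp: "cmod (w $ k) \<le> norm w" for w :: "complex^2" and k
    by (rule Finite_Cartesian_Product.norm_nth_le)
  have entry: "cmod ((Y ** X) $ i $ j) * norm v \<le> 2 * B" for i j
  proof (cases "v = 0")
    case False
    then have "norm v > 0" by simp
    \<comment> \<open>The determinant of v and the j-th column of X. Since v = X u, it equals det X
      times the determinant of u and the j-th unit vector, which is a component of u up to
      sign.\<close>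
    define d where "d = v $ 1 * X $ 2 $ j - v $ 2 * X $ 1 $ j"
    have "cmod d \<le> norm u"
    proof -
      have "d = (if j = 1 then - u $ 2 * det X else u $ 1 * det X)"
        unfolding d_def v_eq det_2 using exhaust_2[of j] by (auto simp: algebra_simps)
      then have "cmod d = cmod (u $ (if j = 1 then 2 else 1))" by (auto simp: norm_mult det)
      then show ?thesis by (simp only: comp)
    qed
    \<comment> \<open>The j-th column of X is split into its component along v and the one along the
      orthogonal vector (- cnj v2, cnj v1). \<open>Y\<close> maps the first into the span of y, and
      the coefficient d of the second is bounded by the norm of u.\<close>
    have "complex_of_real ((norm v)\<^sup>2) * (Y ** X) $ i $ j =
        y $ i * (cnj (v $ 1) * X $ 1 $ j + cnj (v $ 2) * X $ 2 $ j) +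
        (Y $ i $ 2 * cnj (v $ 1) - Y $ i $ 1 * cnj (v $ 2)) * d"
      unfolding nv y_eq d_def by (simp add: matrix_matrix_mult_def sum_2 algebra_simps)
    then have "(norm v)\<^sup>2 * cmod ((Y ** X) $ i $ j) =
       cmod (y $ i * (cnj (v $ 1) * X $ 1 $ j + cnj (v $ 2) * X $ 2 $ j) +
        (Y $ i $ 2 * cnj (v $ 1) - Y $ i $ 1 * cnj (v $ 2)) * d)"
      by (metis abs_of_nonneg norm_mult norm_of_real zero_le_power2)
    also have "\<dots> \<le> norm y * (norm v * norm X + norm v * norm X) + (norm Y * norm v + norm Y * norm v) * norm u"
    proof (rule order_trans[OF norm_triangle_ineq add_mono])
      have "cmod (cnj (v $ 1) * X $ 1 $ j + cnj (v $ 2) * X $ 2 $ j) \<le> norm v * norm X + norm v * norm X"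
        by (rule order_trans[OF norm_triangle_ineq add_mono])
           (auto simp: norm_mult intro!: mult_mono comp norm_component_le)
      then show "cmod (y $ i * (cnj (v $ 1) * X $ 1 $ j + cnj (v $ 2) * X $ 2 $ j)) \<le>
          norm y * (norm v * norm X + norm v * norm X)"
        unfolding norm_mult by (intro mult_mono comp) auto
      have "cmod (Y $ i $ 2 * cnj (v $ 1) - Y $ i $ 1 * cnj (v $ 2)) \<le> norm Y * norm v + norm Y * norm v"
        by (rule order_trans[OF norm_triangle_ineq4 add_mono])
           (auto simp: norm_mult intro!: mult_mono comp norm_component_le)
      then show "cmod ((Y $ i $ 2 * cnj (v $ 1) - Y $ i $ 1 * cnj (v $ 2)) * d) \<le>
          (norm Y * norm v + norm Y * norm v) * norm u"
        unfolding norm_mult using \<open>cmod d \<le> norm u\<close> by (intro mult_mono) auto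
    qed
    also have "\<dots> = norm v * (2 * B)" by (simp add: B_def algebra_simps)
    finally have "norm v * (cmod ((Y ** X) $ i $ j) * norm v) \<le> norm v * (2 * B)"
      by (simp add: power2_eq_square mult_ac)
    then show ?thesis using \<open>norm v > 0\<close> by (rule mult_left_le_imp_le)
  qed (simp add: B_def)
  have "norm (Y ** X) \<le> norm ((Y ** X) $ 1) + norm ((Y ** X) $ 2)"
    by (simp add: norm_vec_def[of "Y ** X"] L2_set_def sum_2 sqrt_sum_squares_le_sum)
  also have "\<dots> \<le> (cmod ((Y ** X) $ 1 $ 1) + cmod ((Y ** X) $ 1 $ 2)) + (cmod ((Y ** X) $ 2 $ 1) + cmod ((Y ** X) $ 2 $ 2))"
    by (intro add_mono norm_vec2_le)
  finally have "norm (Y ** X) * norm v \<le> ((cmod ((Y ** X) $ 1 $ 1) + cmod ((Y ** X) $ 1 $ 2)) + (cmod ((Y ** X) $ 2 $ 1) + cmod ((Y ** X) $ 2 $ 2))) * norm v"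
    by (intro mult_right_mono) auto
  also have "\<dots> \<le> 8 * B"
    using entry[of 1 1] entry[of 1 2] entry[of 2 1] entry[of 2 2] by (simp only: distrib_right)
  finally show ?thesis by (simp add: B_def y_def)
qed

section \<open>Products of transfer matrices along a solution\<close>

lemma transfer_product_add:
  "transfer_product T (m + n) = transfer_product (\<lambda>k. T (k + int m)) n ** transfer_product T m"
  by (induction n) (simp_all add: matrix_mul_assoc[symmetric] add.commute add.left_commute)

lemma det_transfer_product:
  "(\<And>k. cmod (det (T k)) = 1) \<Longrightarrow> cmod (det (transfer_product T n)) = 1"
  by (induction n) (simp_all add: det_mul norm_mult)

lemma transfer_product_solution:
  assumes "\<And>k. v k = T k *v v (k - 1)"
  shows "v (m + int n) = transfer_product (\<lambda>k. T (k + m)) n *v v m"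
proof (induction n)
  case (Suc n)
  have "v (m + int (Suc n)) = T (m + int (Suc n)) *v v (m + int n)"
    using assms[of "m + int (Suc n)"] by simp
  then show ?case using Suc by (simp add: matrix_vector_mul_assoc add.commute)
qed simp

text \<open>The constant depends on the solution. Taking it in the natural numbers reduces the
  exclusion of all constants to countably many null sets.\<close>

lemma linearly_bounded_solution:
  assumes T: "\<And>k. invertible (T k)" "\<And>k. cmod (det (T k)) = 1"
    and sol: "\<And>k. (vector [c (2 * k), c (2 * k + 1)] :: complex^2) = T k *v vector [c (2 * k - 2), c (2 * k - 1)]"
    and bdd: "linearly_bounded c" and "c \<noteq> (\<lambda>k. 0)"
  shows "\<exists>C::nat. \<forall>n. norm (transfer_product (\<lambda>k. T (k - int n)) (2 * n)) \<le>
    real C * (1 + real n) * (norm (transfer_product (\<lambda>k. T (k - int n)) n) + norm (transfer_product T n))"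
proof -
  define v where "v k = (vector [c (2 * k), c (2 * k + 1)] :: complex^2)" for k
  have rec: "v k = T k *v v (k - 1)" for k
    using sol[of k] by (simp add: v_def algebra_simps)
  obtain B where B: "\<And>k. cmod (c k) \<le> B * (1 + real_of_int \<bar>k\<bar>)"
    using bdd unfolding linearly_bounded_def by blast
  have "B \<ge> 0" using order_trans[OF norm_ge_zero B[of 0]] by simp
  \<comment> \<open>Forward by the recursion and backward by invertibility, v 0 = 0 would annihilate
    the whole solution.\<close>
  have "v 0 \<noteq> 0"
  proof
    assume "v 0 = 0"
    have "v k = 0" for k
    proof (induction k rule: int_induct[where k = 0])
      case base
      then show ?case by (rule \<open>v 0 = 0\<close>)
    next
      case (step1 i)
      then show ?case using rec[of "i + 1"] by simp
    next
      case (step2 i)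
      obtain A where "A ** T i = mat 1" using T(1)[of i] unfolding invertible_def by blast
      then have "v (i - 1) = A *v v i"
        using rec[of i] by (simp add: matrix_vector_mul_assoc)
      then show ?case using step2 by simp
    qed
    then have "v k $ 1 = 0" "v k $ 2 = 0" for k by simp_all
    then have z: "c (2 * k) = 0" "c (2 * k + 1) = 0" for k by (simp_all add: v_def)
    have "c k = 0" for k
      using z[of "k div 2"] by (cases "even k") (auto elim!: evenE oddE)
    then show False using \<open>c \<noteq> (\<lambda>k. 0)\<close> by auto
  qed
  \<comment> \<open>The entries sit at sites 2k and 2k + 1, which contribute at most 1 + 2|k| and 2
    + 2|k|; hence the factor 4.\<close>
  have vle: "norm (v k) \<le> 4 * B * (1 + real_of_int \<bar>k\<bar>)" for k
  proof -
    have "norm (v k) \<le> cmod (c (2 * k)) + cmod (c (2 * k + 1))"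
      using norm_vec2_le[of "v k"] by (simp add: v_def)
    also have "\<dots> \<le> B * (1 + real_of_int \<bar>2 * k\<bar>) + B * (1 + real_of_int \<bar>2 * k + 1\<bar>)"
      by (intro add_mono B)
    also have "\<dots> = B * ((1 + real_of_int \<bar>2 * k\<bar>) + (1 + real_of_int \<bar>2 * k + 1\<bar>))"
      by (simp only: distrib_left)
    also have "\<dots> \<le> B * (4 * (1 + real_of_int \<bar>k\<bar>))"
    proof (rule mult_left_mono[OF _ \<open>B \<ge> 0\<close>])
      have "(1 + \<bar>2 * k\<bar>) + (1 + \<bar>2 * k + 1\<bar>) \<le> 4 * (1 + \<bar>k\<bar>)"
        by (cases "k \<ge> 0") auto
      then have "real_of_int ((1 + \<bar>2 * k\<bar>) + (1 + \<bar>2 * k + 1\<bar>)) \<le> real_of_int (4 * (1 + \<bar>k\<bar>))"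
        by (simp only: of_int_le_iff)
      then show "(1 + real_of_int \<bar>2 * k\<bar>) + (1 + real_of_int \<bar>2 * k + 1\<bar>) \<le> 4 * (1 + real_of_int \<bar>k\<bar>)"
        by (simp only: of_int_add of_int_mult of_int_1 of_int_numeral)
    qed
    finally show ?thesis by (simp only: mult_ac)
  qed
  \<comment> \<open>32 is the 8 of \<open>norm_product_le\<close> times the 4 of
    \<open>vle\<close>.\<close>
  obtain C :: nat where C: "32 * B / norm (v 0) \<le> real C" using real_arch_simple by blast
  have "norm (transfer_product (\<lambda>k. T (k - int n)) (2 * n)) \<le>
    real C * (1 + real n) * (norm (transfer_product (\<lambda>k. T (k - int n)) n) + norm (transfer_product T n))" for n
  proof -
    \<comment> \<open>\<open>transfer_product\<close> runs over sites 1 to n, so the shift by -n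
      covers 1 - n to 0: X carries v (-n) to v 0, and Y carries v 0 to v n.\<close>
    define X where "X = transfer_product (\<lambda>k. T (k - int n)) n"
    define Y where "Y = transfer_product T n"
    have X: "v 0 = X *v v (- int n)"
      using transfer_product_solution[of v T "- int n" n, OF rec] by (simp add: X_def)
    have Y: "v (int n) = Y *v v 0"
      using transfer_product_solution[of v T 0 n, OF rec] by (simp add: Y_def)
    have "norm (Y ** X) * norm (v 0) \<le> 8 * (norm (Y *v v 0) * norm X + norm (v (- int n)) * norm Y)"
      by (rule norm_product_le[OF _ X]) (simp add: X_def det_transfer_product T)
    also have "\<dots> \<le> 8 * (4 * B * (1 + real n) * norm X + 4 * B * (1 + real n) * norm Y)"
      using vle[of "int n"] vle[of "- int n"] unfolding Y
      by (intro mult_left_mono add_mono mult_right_mono) auto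
    also have "\<dots> = 32 * B * ((1 + real n) * (norm X + norm Y))" by (simp add: algebra_simps)
    finally have "norm (Y ** X) \<le> 32 * B / norm (v 0) * ((1 + real n) * (norm X + norm Y))"
      using \<open>v 0 \<noteq> 0\<close> by (simp add: field_simps)
    also have "\<dots> \<le> real C * ((1 + real n) * (norm X + norm Y))"
      using C by (intro mult_right_mono) auto
    also have "Y ** X = transfer_product (\<lambda>k. T (k - int n)) (2 * n)"
      using transfer_product_add[of "\<lambda>k. T (k - int n)" n n] by (simp add: X_def Y_def mult_2)
    finally show ?thesis by (simp add: X_def Y_def mult.assoc)
  qed
  then show ?thesis by blast
qed

section \<open>Stationary transfer matrices\<close>

lemma measurable_transfer_product [measurable (raw)]:
  fixes T :: "int \<Rightarrow> 'b \<Rightarrow> complex^2^2"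
  assumes "\<And>k. T k \<in> borel_measurable N"
  shows "(\<lambda>x. transfer_product (\<lambda>k. T (k + j) x) n) \<in> borel_measurable N"
proof (induction n)
  case (Suc n)
  have "continuous_on UNIV (\<lambda>x :: (complex^2^2) \<times> (complex^2^2). fst x ** snd x)"
    unfolding matrix_matrix_mult_def by (intro continuous_intros)
  from borel_measurable_continuous_Pair[OF assms[of "int (Suc n) + j"] Suc this]
  show ?case by simp
qed simp

locale stationary_transfer = prob_space M for M :: "'w measure" +
  fixes S :: "'w \<Rightarrow> 'w" and T :: "int \<Rightarrow> 'w \<Rightarrow> complex^2^2"
  assumes S_measurable [measurable]: "S \<in> measurable M M"
    and S_preserves: "distr M M S = M"
    and T_measurable [measurable]: "\<And>k. T k \<in> borel_measurable M"
    and T_shift: "\<And>k \<omega>. \<omega> \<in> space M \<Longrightarrow> T (k + 1) \<omega> = T k (S \<omega>)"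
begin

lemma funpow_space: "\<omega> \<in> space M \<Longrightarrow> (S ^^ n) \<omega> \<in> space M"
  by (induction n) (auto intro: measurable_space[OF S_measurable])

lemma T_shift_funpow: "\<omega> \<in> space M \<Longrightarrow> T k ((S ^^ n) \<omega>) = T (k + int n) \<omega>"
proof (induction n arbitrary: k)
  case (Suc n)
  have "T k ((S ^^ Suc n) \<omega>) = T (k + 1) ((S ^^ n) \<omega>)"
    using T_shift[OF funpow_space[OF Suc.prems]] by simp
  also have "\<dots> = T (k + 1 + int n) \<omega>" by (rule Suc.IH[OF Suc.prems])
  finally show ?case by (simp add: add_ac)
qed simp

lemma prob_S_vimage:
  assumes [measurable]: "A \<in> sets M"
  shows "prob ((S ^^ n) -` A \<inter> space M) = prob A"
proof (induction n)
  case 0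
  then show ?case using sets.sets_into_space[OF assms] by (simp add: Int_absorb2)
next
  case (Suc n)
  have meas: "(S ^^ n) \<in> measurable M M" for n
    by (induction n) (auto simp: id_def[symmetric] comp_def)
  have "(S ^^ Suc n) -` A \<inter> space M = S -` ((S ^^ n) -` A \<inter> space M) \<inter> space M"
    by (auto simp: funpow_swap1 intro: measurable_space[OF S_measurable])
  then have "prob ((S ^^ Suc n) -` A \<inter> space M) = measure (distr M M S) ((S ^^ n) -` A \<inter> space M)"
    using measurable_sets[OF meas assms] by (simp add: measure_distr)
  then show ?case by (simp only: S_preserves Suc)
qed

text \<open>Stationarity transports the growth of the forward products to the products that end at site \<open>0\<close>.\<close>

lemma prob_shifted_product:
  assumes [measurable]: "{A. P A} \<in> sets borel"
  shows "prob {\<omega> \<in> space M. P (transfer_product (\<lambda>k. T (k - int n) \<omega>) m)} =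
    prob {\<omega> \<in> space M. P (transfer_product (\<lambda>k. T k \<omega>) m)}"
proof -
  let ?Q = "{\<omega> \<in> space M. P (transfer_product (\<lambda>k. T (k - int n) \<omega>) m)}"
  have [measurable]: "(\<lambda>\<omega>. transfer_product (\<lambda>k. T (k - int n) \<omega>) m) \<in> borel_measurable M"
    using measurable_transfer_product[of T M "- int n" m] by simp
  have Q: "?Q = (\<lambda>\<omega>. transfer_product (\<lambda>k. T (k - int n) \<omega>) m) -` {A. P A} \<inter> space M" by auto
  have "?Q \<in> sets M" unfolding Q by measurable
  then have "prob ?Q = prob ((S ^^ n) -` ?Q \<inter> space M)" by (rule prob_S_vimage[symmetric])
  also have "(S ^^ n) -` ?Q \<inter> space M = {\<omega> \<in> space M. P (transfer_product (\<lambda>k. T k \<omega>) m)}"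
    by (auto simp: T_shift_funpow funpow_space)
  finally show ?thesis .
qed

text \<open>For fixed C the inequality for all n is one event \<open>E\<close>. For large n it
  forces one of three norms out of its growth window, and by stationarity the probability of this is
  at most p(2n) + 2 p(n), which tends to 0.\<close>

lemma AE_growth:
  assumes "\<gamma> > 0" and det: "\<And>k \<omega>. \<omega> \<in> space M \<Longrightarrow> cmod (det (T k \<omega>)) = 1"
    and lyap: "AE \<omega> in M. lyapunov_exponents (transfer_product (\<lambda>k. T k \<omega>)) \<gamma> (- \<gamma>)"
  shows "AE \<omega> in M. \<not> (\<exists>C::nat. \<forall>n. norm (transfer_product (\<lambda>k. T (k - int n) \<omega>) (2 * n)) \<le>
    real C * (1 + real n) *
      (norm (transfer_product (\<lambda>k. T (k - int n) \<omega>) n) + norm (transfer_product (\<lambda>k. T k \<omega>) n)))"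
proof -
  define bad where "bad n A \<longleftrightarrow> \<not> (exp (18/10 * \<gamma> * real n) \<le> (norm A)\<^sup>2 \<and>
    (norm A)\<^sup>2 \<le> 2 * exp (22/10 * \<gamma> * real n))" for n and A :: "complex^2^2"
  have bad_meas [measurable]: "{A. bad n A} \<in> sets borel" for n unfolding bad_def by measurable
  have tp_meas [measurable]: "(\<lambda>\<omega>. transfer_product (\<lambda>k. T (k - j) \<omega>) n) \<in> borel_measurable M" for j n
    using measurable_transfer_product[of T M "- j" n] by simp
  have tp_meas0 [measurable]: "(\<lambda>\<omega>. transfer_product (\<lambda>k. T k \<omega>) n) \<in> borel_measurable M" for n
    using tp_meas[of 0 n] by simp
  define p where "p n = prob {\<omega> \<in> space M. bad n (transfer_product (\<lambda>k. T k \<omega>) n)}" for n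
  have sets0: "{\<omega> \<in> space M. bad m (transfer_product (\<lambda>k. T k \<omega>) n)} \<in> sets M" for m n
    using measurable_sets[OF tp_meas0 bad_meas[of m]] by (simp add: vimage_def Int_def conj_commute)
  have sets1: "{\<omega> \<in> space M. bad m (transfer_product (\<lambda>k. T (k - j) \<omega>) n)} \<in> sets M" for m n j
    using measurable_sets[OF tp_meas bad_meas[of m]] by (simp add: vimage_def Int_def conj_commute)
  \<comment> \<open>From almost surely eventually good to small probability of being bad, by
    dominated convergence of the indicators.\<close>
  have "p \<longlonglongrightarrow> 0"
  proof -
    have "(\<lambda>n. \<integral>\<omega>. indicator {\<omega> \<in> space M. bad n (transfer_product (\<lambda>k. T k \<omega>) n)} \<omega> \<partial>M) \<longlonglongrightarrow>
        (\<integral>\<omega>. (0::real) \<partial>M)"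
    proof (rule integral_dominated_convergence[where w = "\<lambda>_. 1"])
      show "AE \<omega> in M. (\<lambda>n. indicator {\<omega> \<in> space M. bad n (transfer_product (\<lambda>k. T k \<omega>) n)} \<omega> :: real) \<longlonglongrightarrow> 0"
        using lyap AE_space
      proof eventually_elim
        case (elim \<omega>)
        have "\<forall>\<^sub>F n in sequentially. \<not> bad n (transfer_product (\<lambda>k. T k \<omega>) n)"
          unfolding bad_def not_not
          by (rule lyapunov_growth[OF elim(1) \<open>\<gamma> > 0\<close>]) (simp add: det_transfer_product det elim(2))
        then have "\<forall>\<^sub>F n in sequentially. indicator {\<omega> \<in> space M. bad n (transfer_product (\<lambda>k. T k \<omega>) n)} \<omega> = (0::real)"
          by eventually_elim (simp add: indicator_def)
        then show ?case by (rule tendsto_eventually)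
      qed
      show "(\<lambda>\<omega>. indicator {\<omega> \<in> space M. bad n (transfer_product (\<lambda>k. T k \<omega>) n)} \<omega> :: real) \<in> borel_measurable M" for n
        using sets0 by (intro borel_measurable_indicator)
    qed (auto simp: indicator_def)
    then show ?thesis unfolding p_def using sets0 sets.sets_into_space by (simp add: Int_absorb2)
  qed
  have "AE \<omega> in M. \<not> (\<forall>n. norm (transfer_product (\<lambda>k. T (k - int n) \<omega>) (2 * n)) \<le>
    real C * (1 + real n) *
      (norm (transfer_product (\<lambda>k. T (k - int n) \<omega>) n) + norm (transfer_product (\<lambda>k. T k \<omega>) n)))" for C
  proof -
    define E where "E = {\<omega> \<in> space M. \<forall>n. norm (transfer_product (\<lambda>k. T (k - int n) \<omega>) (2 * n)) \<le>
      real C * (1 + real n) *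
      (norm (transfer_product (\<lambda>k. T (k - int n) \<omega>) n) + norm (transfer_product (\<lambda>k. T k \<omega>) n))}"
    have [measurable]: "E \<in> sets M" unfolding E_def by measurable
    \<comment> \<open>14/10 = 36/10 - 22/10 is the gap between the squared growth rates at lengths
      2n and n. The factor 8 comes from (x + y)^2 \<le> 2 x^2 + 2 y^2 with both squares at most 2
      exp (22/10 \<gamma> n).\<close>
    have "((\<lambda>n. 8 * (real C)\<^sup>2 * (1 + real n)\<^sup>2 * exp (- (14/10 * \<gamma>) * real n)) \<longlongrightarrow> 0) sequentially"
      using \<open>\<gamma> > 0\<close> by real_asymp
    then have "\<forall>\<^sub>F n in sequentially. 8 * (real C)\<^sup>2 * (1 + real n)\<^sup>2 * exp (- (14/10 * \<gamma>) * real n) < 1"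
      by (rule order_tendstoD) simp
    then have "\<forall>\<^sub>F n in sequentially. prob E \<le> p (2 * n) + (p n + p n)"
    proof eventually_elim
      case (elim n)
      let ?B1 = "{\<omega> \<in> space M. bad (2 * n) (transfer_product (\<lambda>k. T (k - int n) \<omega>) (2 * n))}"
      let ?B2 = "{\<omega> \<in> space M. bad n (transfer_product (\<lambda>k. T (k - int n) \<omega>) n)}"
      let ?B3 = "{\<omega> \<in> space M. bad n (transfer_product (\<lambda>k. T k \<omega>) n)}"
      have "E \<subseteq> ?B1 \<union> (?B2 \<union> ?B3)"
      proof
        fix \<omega> assume "\<omega> \<in> E"
        define x where "x = norm (transfer_product (\<lambda>k. T (k - int n) \<omega>) n)"
        define y where "y = norm (transfer_product (\<lambda>k. T k \<omega>) n)"
        define z where "z = norm (transfer_product (\<lambda>k. T (k - int n) \<omega>) (2 * n))"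
        have "\<omega> \<in> space M" and le: "z \<le> real C * (1 + real n) * (x + y)"
          using \<open>\<omega> \<in> E\<close> by (auto simp: E_def x_def y_def z_def)
        show "\<omega> \<in> ?B1 \<union> (?B2 \<union> ?B3)"
        proof (rule ccontr)
          assume "\<not> ?thesis"
          then have z: "exp (18/10 * \<gamma> * real (2 * n)) \<le> z\<^sup>2"
            and x: "x\<^sup>2 \<le> 2 * exp (22/10 * \<gamma> * real n)" and y: "y\<^sup>2 \<le> 2 * exp (22/10 * \<gamma> * real n)"
            using \<open>\<omega> \<in> space M\<close> by (auto simp: bad_def x_def y_def z_def)
          have "z \<ge> 0" by (simp add: z_def)
          then have "z\<^sup>2 \<le> (real C * (1 + real n) * (x + y))\<^sup>2" using le by (intro power_mono)
          also have "\<dots> = (real C)\<^sup>2 * (1 + real n)\<^sup>2 * (x + y)\<^sup>2" by (simp add: power_mult_distrib)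
          also have "\<dots> \<le> (real C)\<^sup>2 * (1 + real n)\<^sup>2 * (8 * exp (22/10 * \<gamma> * real n))"
          proof (rule mult_left_mono)
            have "(x + y)\<^sup>2 \<le> 2 * x\<^sup>2 + 2 * y\<^sup>2"
              using zero_le_power2[of "x - y"] by (simp add: power2_eq_square algebra_simps)
            then show "(x + y)\<^sup>2 \<le> 8 * exp (22/10 * \<gamma> * real n)" using x y by linarith
          qed simp
          finally have "exp (18/10 * \<gamma> * real (2 * n)) \<le>
              8 * (real C)\<^sup>2 * (1 + real n)\<^sup>2 * exp (22/10 * \<gamma> * real n)"
            using z by (simp add: mult_ac)
          then have "exp (18/10 * \<gamma> * real (2 * n)) * exp (- (36/10 * \<gamma>) * real n) \<le>
              8 * (real C)\<^sup>2 * (1 + real n)\<^sup>2 * exp (22/10 * \<gamma> * real n) * exp (- (36/10 * \<gamma>) * real n)"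
            by (rule mult_right_mono) simp
          moreover have "exp (18/10 * \<gamma> * real (2 * n)) * exp (- (36/10 * \<gamma>) * real n) = 1"
            by (simp flip: exp_add)
          moreover have "exp (22/10 * \<gamma> * real n) * exp (- (36/10 * \<gamma>) * real n) = exp (- (14/10 * \<gamma>) * real n)"
            by (simp flip: exp_add)
          ultimately have "1 \<le> 8 * (real C)\<^sup>2 * (1 + real n)\<^sup>2 * exp (- (14/10 * \<gamma>) * real n)"
            by (simp only: mult.assoc)
          then show False using elim by linarith
        qed
      qed
      then have "prob E \<le> prob (?B1 \<union> (?B2 \<union> ?B3))"
        by (intro finite_measure_mono sets.Un sets0 sets1)
      also have "\<dots> \<le> prob ?B1 + prob (?B2 \<union> ?B3)"
        by (intro measure_Un_le sets.Un sets0 sets1)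
      also have "\<dots> \<le> prob ?B1 + (prob ?B2 + prob ?B3)"
        by (intro add_left_mono measure_Un_le sets0 sets1)
      also have "\<dots> = p (2 * n) + (p n + p n)"
        unfolding p_def by (simp only: prob_shifted_product[OF bad_meas])
      finally show ?case .
    qed
    moreover have "(\<lambda>n. p (2 * n) + (p n + p n)) \<longlonglongrightarrow> 0 + (0 + 0)"
      using \<open>p \<longlonglongrightarrow> 0\<close> LIMSEQ_subseq_LIMSEQ[OF \<open>p \<longlonglongrightarrow> 0\<close>, of "\<lambda>n. 2 * n"]
      by (intro tendsto_add) (auto simp: strict_mono_def o_def)
    ultimately have "prob E \<le> 0"
      by (intro tendsto_lowerbound[where f = "\<lambda>n. p (2 * n) + (p n + p n)" and F = sequentially]) auto
    then have "emeasure M E = 0" by (simp add: emeasure_eq_measure measure_le_0_iff)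
    then show ?thesis by (intro AE_I[where N = E]) (auto simp: E_def)
  qed
  then have "AE \<omega> in M. \<forall>C::nat. \<not> (\<forall>n. norm (transfer_product (\<lambda>k. T (k - int n) \<omega>) (2 * n)) \<le>
    real C * (1 + real n) *
      (norm (transfer_product (\<lambda>k. T (k - int n) \<omega>) n) + norm (transfer_product (\<lambda>k. T k \<omega>) n)))"
    by (subst AE_all_countable) blast
  then show ?thesis by eventually_elim blast
qed

end

section \<open>Exchange of angle and randomness\<close>

theorem theorem5p3:
  fixes M :: "'w measure" and S :: "'w \<Rightarrow> 'w"
    and U :: "'w \<Rightarrow> (int \<Rightarrow> complex) \<Rightarrow> (int \<Rightarrow> complex)"
    and T :: "real \<Rightarrow> int \<Rightarrow> 'w \<Rightarrow> complex^2^2"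
    and \<gamma>\<^sub>1 \<gamma>\<^sub>2 :: "real \<Rightarrow> real"
  assumes "prob_space M"
    and "invertible_ergodic M S"
    and "weakly_measurable M U"
    and "\<And>\<omega>. \<omega> \<in> space M \<Longrightarrow> unitary2 (U \<omega>)"
    and "\<And>\<omega>. \<omega> \<in> space M \<Longrightarrow> has_band_structure (U \<omega>)"
    and "governed_by_transfer_matrices M S U T"
    and "\<And>\<theta>. AE \<omega> in M.
           lyapunov_exponents (transfer_product (\<lambda>k. T \<theta> k \<omega>)) (\<gamma>\<^sub>1 \<theta>) (\<gamma>\<^sub>2 \<theta>)"
    and "\<And>\<theta>. \<gamma>\<^sub>1 \<theta> \<ge> \<gamma>\<^sub>2 \<theta>"
    and "\<And>\<theta>. \<gamma>\<^sub>2 \<theta> = - \<gamma>\<^sub>1 \<theta>"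
  shows "AE \<omega> in M. ac_spectrum (U \<omega>) \<subseteq> closure {cis \<theta> | \<theta>. \<gamma>\<^sub>1 \<theta> = 0}"
proof -
  interpret prob_space M by fact
  define K where "K = closure {cis \<theta> | \<theta>. \<gamma>\<^sub>1 \<theta> = 0}"
  have "closed K" by (simp add: K_def)
  note governed = assms(6)[unfolded governed_by_transfer_matrices_def]
  note T_meas = governed[THEN conjunct1, rule_format]
  note T_props = governed[THEN conjunct2, THEN conjunct1, rule_format]
  note T_inv = T_props[THEN conjunct1]
  note T_det = T_props[THEN conjunct2, THEN conjunct1]
  note T_shift = T_props[THEN conjunct2, THEN conjunct2]
  note T_sol = governed[THEN conjunct2, THEN conjunct2, THEN conjunct2, rule_format]
  note S = assms(2)[unfolded invertible_ergodic_def, THEN conjunct2, THEN conjunct1]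
    assms(2)[unfolded invertible_ergodic_def, THEN conjunct2, THEN conjunct2, THEN conjunct2, THEN conjunct1]
  \<comment> \<open>A consequence of the existence of a linearly bounded solution that has countable
    quantifiers only; this makes it jointly measurable in angle and \<omega>, as the exchange of the
    two almost-everywhere statements requires.\<close>
  define tame where "tame \<theta> \<omega> \<longleftrightarrow> (\<exists>C::nat. \<forall>n.
    norm (transfer_product (\<lambda>k. T \<theta> (k - int n) \<omega>) (2 * n)) \<le> real C * (1 + real n) *
      (norm (transfer_product (\<lambda>k. T \<theta> (k - int n) \<omega>) n) + norm (transfer_product (\<lambda>k. T \<theta> k \<omega>) n)))" for \<theta> \<omega>
  have "AE \<theta> in lborel. AE \<omega> in M. cis \<theta> \<notin> K \<longrightarrow> \<not> tame \<theta> \<omega>"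
  proof (rule AE_I2)
    fix \<theta> :: real
    show "AE \<omega> in M. cis \<theta> \<notin> K \<longrightarrow> \<not> tame \<theta> \<omega>"
    proof (cases "cis \<theta> \<in> K")
      case False
      have "\<gamma>\<^sub>1 \<theta> \<noteq> 0"
      proof
        assume "\<gamma>\<^sub>1 \<theta> = 0"
        then have "cis \<theta> \<in> {cis \<theta> | \<theta>. \<gamma>\<^sub>1 \<theta> = 0}" by auto
        then have "cis \<theta> \<in> K" unfolding K_def by (rule closure_subset[THEN subsetD])
        with False show False by contradiction
      qed
      then have "\<gamma>\<^sub>1 \<theta> > 0" using assms(8,9)[of \<theta>] by simp
      interpret stationary_transfer M S "T \<theta>"
      proof unfold_locales
        show "T \<theta> k \<in> borel_measurable M" for k
          using measurable_Pair2[OF T_meas, of \<theta> k] by simp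
      qed (use S T_shift in auto)
      have "AE \<omega> in M. \<not> tame \<theta> \<omega>"
        unfolding tame_def using T_det assms(7)[of \<theta>] assms(9)[of \<theta>]
        by (intro AE_growth[OF \<open>\<gamma>\<^sub>1 \<theta> > 0\<close>]) auto
      then show ?thesis by eventually_elim simp
    qed simp
  qed
  moreover interpret pair_sigma_finite lborel M ..
  have "{x \<in> space (lborel \<Otimes>\<^sub>M M). cis (fst x) \<notin> K \<longrightarrow> \<not> tame (fst x) (snd x)} \<in> sets (lborel \<Otimes>\<^sub>M M)"
  proof -
    have "(\<lambda>x. T (fst x) k (snd x)) \<in> borel_measurable (borel \<Otimes>\<^sub>M M)" for k
      using T_meas[of k] by (simp add: case_prod_beta')
    then have T_meas': "(\<lambda>x. T (fst x) k (snd x)) \<in> borel_measurable (lborel \<Otimes>\<^sub>M M)" for k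
      by (simp add: measurable_cong_sets[OF sets_pair_measure_cong[OF sets_lborel refl] refl])
    have tp [measurable]: "(\<lambda>x. transfer_product (\<lambda>k. T (fst x) (k - j) (snd x)) n) \<in> borel_measurable (lborel \<Otimes>\<^sub>M M)" for j n
      using measurable_transfer_product[of "\<lambda>k x. T (fst x) k (snd x)" _ "- j" n, OF T_meas'] by simp
    have [measurable]: "(\<lambda>x. transfer_product (\<lambda>k. T (fst x) k (snd x)) n) \<in> borel_measurable (lborel \<Otimes>\<^sub>M M)" for n
      using tp[of 0 n] by simp
    have [measurable]: "cis \<in> borel_measurable borel" "K \<in> sets borel"
      using \<open>closed K\<close> by (auto intro!: borel_measurable_continuous_onI continuous_intros)
    show ?thesis unfolding tame_def by measurable
  qed
  ultimately have "AE \<omega> in M. AE \<theta> in lborel. cis \<theta> \<notin> K \<longrightarrow> \<not> tame \<theta> \<omega>"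
    by (subst (asm) AE_commute)
  then show ?thesis using AE_space unfolding K_def[symmetric]
  proof eventually_elim
    case (elim \<omega>)
    show ?case
    proof (rule ac_spectrum_subset[OF assms(4,5)[OF elim(2)] \<open>closed K\<close>])
      have "AE \<theta> in lborel. cis \<theta> \<notin> K \<longrightarrow> \<not> tame \<theta> \<omega>" by (rule elim(1))
      then show "AE \<theta> in lborel. cis \<theta> \<notin> K \<longrightarrow>
         (\<forall>c. generalized_eigenvector (U \<omega>) \<theta> c \<longrightarrow> linearly_bounded c \<longrightarrow> c = (\<lambda>k. 0))"
      proof eventually_elim
        case (elim \<theta>)
        show ?case
        proof (intro impI allI, rule ccontr)
          fix c assume "cis \<theta> \<notin> K" "generalized_eigenvector (U \<omega>) \<theta> c" "linearly_bounded c" "c \<noteq> (\<lambda>k. 0)"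
          then have "tame \<theta> \<omega>"
            unfolding tame_def using T_sol[OF \<open>\<omega> \<in> space M\<close>] T_inv[OF \<open>\<omega> \<in> space M\<close>] T_det[OF \<open>\<omega> \<in> space M\<close>]
            by (intro linearly_bounded_solution[where T = "\<lambda>k. T \<theta> k \<omega>"]) auto
          then show False using elim \<open>cis \<theta> \<notin> K\<close> by blast
        qed
      qed
    qed
  qed
qed

end
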